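(* Let $r\ge0$ be an integer and let $(G,M)$ be a measure graph over a groupoid $\mathcal G$ which is essentially $(r+1)$-regular, i.e. $\deg(x)=r+1$ for $M$-almost all $x\in V$. Put $R:=\frac{(r+1)+\sqrt{(r+1)^2+4(r+1)}}{2}$. Then for every $u\in\mathbb C$ with $|u|<R^{-1}$ $$Z_{(G,M)}(u)^{-1}=(1-u^2)^{\frac{(r-1)\tau(I)}{2}}\exp\left(\int_{\sigma(A_G)}\log(1-u\lambda+u^2r)\,d\mu_G(\lambda)\right),$$ where $\log$ is the main branch of the complex logarithm on $\mathbb C\setminus\{x\in\mathbb R:x\le0\}$ and $\mu_G$ is the spectral measure of the adjacency operator $A_G$ with respect to the trace $\tau$.
   Context: GRAPHS. A graph $G=(V,E)$ has a nonempty vertex set $V$ (of arbitrary cardinality), a symmetric edge set $E\subseteq V\times V$ containing no $(x,x)$, and uniformly bounded vertex degree $\deg(x)=\#\{y:(x,y)\in E\}$. Write $x\sim y$ if $(x,y)\in E$, $x\approx y$ if $x,y$ lie in the same connected component, and $d$ for the combinatorial distance. $B^G_r(x)$ is the graph induced on $\{y:d(x,y)\le r\}$, rooted at $x$. $\mathcal A^D$ is the countable set of isomorphism classes of finite connected rooted graphs with degrees at most $D$, with the discrete $\sigma$-algebra, and $\pi_r:V\to\mathcal A^D$, $\pi_r(x)=[B_r^G(x)]$ ($D$ a degree bound of $G$). $V^{(2)}=\{(x,y)\in V\times V:x\approx y\}$, and $a_G:V^{(2)}\to\{0,1\}$ is the adjacency matrix. MEASURABLE GRAPH: a graph with a $\sigma$-algebra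 on $V$ (and $V^{(2)}$ with the $\sigma$-algebra induced from the product) such that all $\pi_r$ and $a_G$ are measurable and for all measurable $a,b:V^{(2)}\to[0,\infty]$ the product $(a*b)(x,y)=\sum_{z\approx x}a(x,z)b(z,y)$ is measurable. GROUPOID: $\mathcal G$ is a groupoid (small category with all morphisms invertible) with range $r(g)=gg^{-1}$, source $s(g)=g^{-1}g$, unit set $\Omega=\mathcal G^{(0)}$, $\mathcal G^\omega=r^{-1}(\{\omega\})$; it is measurable: it carries a $\sigma$-algebra for which multiplication, inversion, $r,s$ are measurable and singletons in $\Omega$ are measurable. A transversal function is a family $\nu=(\nu^\omega)_{\omega\in\Omega}$ of measures on $\mathcal G$ with $\nu^\omega$ supported on $\mathcal G^\omega$, $\omega\mapsto\nu^\omega(f)$ measurable for measurable $f\ge0$, and $\int f(gh)\,d\nu^{s(g)}(h)=\int f(k)\,d\nu^{r(g)}(k)$ for all $g$ and measurable $f\ge 0$ on $\mathcal G^{r(g)}$. A measure $m$ on $\Omega$ is $\nu$-invariant if $m\circ\nu=\int\nu^\omega dm(\omega)$ is invariant under $g\mapsto g^{-1}$. GRAPH OVER $\mathcal G$: a measurable graph $G$ with a measurable map $\pi:V\to\Omega$ with countable fibers $V^\omega=\pi^{-1}(\omega)$, such that $\eta^\omega:=\sum_{y\in V^\omega}\delta_y$ satisfies that $\omega\mapsto\eta^\omega(F)$ is measurable for each measurable $F:V\to[0,\infty]$, and with graph isomorphisms $J(g):G^{s(g)}\to G^{r(g)}$ between the induced graphs on fibers, $J(g^{-1})=J(g)^{-1}$,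 $J(g_1g_2)=J(g_1)J(g_2)$ if $s(g_1)=r(g_2)$; write $gx=J(g)x$. The action $(g,x)\mapsto gx$ is measurable and edges of $G$ only join vertices in the same fiber. AVERAGING FUNCTION: measurable $\mathfrak u:V\to[0,\infty]$ with $\int_{\mathcal G^{\pi(x)}}\mathfrak u(g^{-1}x)\,d\nu^{\pi(x)}(g)=1$ for all $x\in V$. MEASURE GRAPH over $\mathcal G$: a pair $(G,M)$ where $G$ is a graph over the measurable groupoid $\mathcal G$ with transversal function $\nu$ and $\nu$-invariant measure $m$, $M=m\circ\eta=\int\eta^\omega\,dm(\omega)$, the $\sigma$-algebras of $V$ and $\Omega$ have countable bases of sets of finite $M$- resp. $m$-measure, there is a strictly positive averaging function $\mathfrak u$, and $\int_V\mathfrak u\,dM<\infty$. ZETA FUNCTION. A path of length $n$ is a sequence of edges $(e_1,\dots,e_n)$ with terminal vertex of $e_i$ equal to origin of $e_{i+1}$; it is closed if the terminal vertex of $e_n$ is the origin of $e_1$. With $\bar e$ the reversed edge, a closed path is reduced if $e_{i+1}\ne\bar e_i$ for $1\le i\le n-1$ and $\bar e_1\neq e_n$. $N_j(x)$ is the number of reduced closed paths of length $j$ starting at $x$; $\overline N_j=\int_VN_j\,\mathfrak u\,dM$ (independent of the averaging function $\mathfrak u$); $Z_{(G,M)}(u)=\exp\bigl(\sum_{j\ge1}\frac{\overline N_j}{j}u^j\bigr)$. VON NEUMANN ALGEBRA. For $g\in\mathcal G$ let $U_g:\ell^2(V^{s(g)})\to\ell^2(V^{r(g)})$, $U_gf(x)=f(g^{-1}x)$.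 $\mathcal N(\mathcal G,G)$ is the algebra of families $A=(A_\omega)_{\omega\in\Omega}$ of bounded operators on $\ell^2(V^\omega)$, essentially uniformly bounded in norm, with $\omega\mapsto\langle g_\omega,A_\omega f_\omega\rangle$ measurable for $f,g\in L^2(V,M)$ (subscript = restriction to $V^\omega$), and $A_{r(g)}=U_gA_{s(g)}U_g^*$ for all $g$, modulo $m$-a.e. equality; the norm is the essential supremum of $\|A_\omega\|$. For $A\ge0$, $\tau(A)=\int_\Omega\mathrm{tr}(A_\omega^{1/2}M_{\mathfrak u_\omega}A_\omega^{1/2})\,dm(\omega)$, where $M_{\mathfrak u_\omega}$ is multiplication by $\mathfrak u|_{V^\omega}$, i.e. $\tau(A)=\int_\Omega\sum_{x\in V^\omega}\mathfrak u(x)\langle\delta_x,A_\omega\delta_x\rangle\,dm(\omega)$; it is independent of the averaging function, $\tau(I)<\infty$, and $\tau$ extends uniquely to a norm-continuous linear functional on $\mathcal N(\mathcal G,G)$. $A_G$ acts on each fiber by $(A_Gf)(x)=\sum_{y\sim x}f(y)$. The measure $\mu_G$ on the spectrum $\sigma(A_G)$ is the unique measure with $\tau(\varphi(A_G))=\int_{\sigma(A_G)}\varphi\,d\mu_G$ for all $\varphi\in C(\sigma(A_G))$. The power of $1-u^2$ is taken with the principal branch. *)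

theory Defs
  imports "HOL-Analysis.Analysis" "HOL-Computational_Algebra.Polynomial"
begin

section \<open>Graphs\<close>

definition graph :: "'v set \<Rightarrow> ('v \<times> 'v) set \<Rightarrow> bool" where
  "graph V E \<longleftrightarrow> V \<noteq> {} \<and> E \<subseteq> V \<times> V \<and> sym E \<and> irrefl E"

definition degree_bound :: "'v set \<Rightarrow> ('v \<times> 'v) set \<Rightarrow> nat \<Rightarrow> bool" where
  "degree_bound V E D \<longleftrightarrow> (\<forall>x\<in>V. finite {y. (x, y) \<in> E} \<and> card {y. (x, y) \<in> E} \<le> D)"

definition vdegree :: "('v \<times> 'v) set \<Rightarrow> 'v \<Rightarrow> nat" where
  "vdegree E x = card {y. (x, y) \<in> E}"

text \<open>A rooted graph is a triple of vertex set, edge set and root.\<close>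

type_synonym 'a rooted = "'a set \<times> ('a \<times> 'a) set \<times> 'a"

definition rooted_iso :: "'a rooted \<Rightarrow> 'b rooted \<Rightarrow> bool" where
  "rooted_iso = (\<lambda>(W, F, a) (W', F', a'). \<exists>h. bij_betw h W W' \<and> h a = a' \<and>
     (\<forall>x\<in>W. \<forall>y\<in>W. (x, y) \<in> F \<longleftrightarrow> (h x, h y) \<in> F'))"

definition rooted_ball :: "('v \<times> 'v) set \<Rightarrow> nat \<Rightarrow> 'v \<Rightarrow> 'v rooted" where
  "rooted_ball E n x =
     (let W = {y. \<exists>k\<le>n. (x, y) \<in> E ^^ k} in (W, E \<inter> W \<times> W, x))"

text \<open>Every finite rooted graph is isomorphic to one with vertices in \<open>nat\<close>, so an isomorphism
  class is represented by the set of its members with vertices in \<open>nat\<close>.\<close>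

definition rooted_graphs :: "nat \<Rightarrow> nat rooted set" where
  "rooted_graphs D = {(W, F, a). finite W \<and> graph W F \<and> a \<in> W \<and> W \<subseteq> F\<^sup>* `` {a} \<and>
     degree_bound W F D}"

definition iso_class :: "nat \<Rightarrow> 'a rooted \<Rightarrow> nat rooted set" where
  "iso_class D H = {H' \<in> rooted_graphs D. rooted_iso H' H}"

definition iso_classes :: "nat \<Rightarrow> nat rooted set set" where
  "iso_classes D = iso_class D ` rooted_graphs D"

section \<open>Measurable graphs\<close>

text \<open>A measurable space is encoded, as usual, by the \<open>space\<close> and \<open>sets\<close> of a value of type
  \<open>measure\<close>; the measure carried by \<open>V\<close> below is irrelevant.\<close>

definition connected_pairs :: "'v measure \<Rightarrow> ('v \<times> 'v) set \<Rightarrow> ('v \<times> 'v) measure" where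
  "connected_pairs V E =
     restrict_space (V \<Otimes>\<^sub>M V) {(x, y). x \<in> space V \<and> y \<in> space V \<and> (x, y) \<in> E\<^sup>*}"

definition kernel_prod ::
  "('v \<times> 'v) set \<Rightarrow> ('v \<times> 'v \<Rightarrow> ennreal) \<Rightarrow> ('v \<times> 'v \<Rightarrow> ennreal) \<Rightarrow> 'v \<times> 'v \<Rightarrow> ennreal" where
  "kernel_prod E a b = (\<lambda>(x, y). \<integral>\<^sup>+z. a (x, z) * b (z, y) \<partial>count_space {z. (x, z) \<in> E\<^sup>*})"

definition measurable_graph :: "'v measure \<Rightarrow> ('v \<times> 'v) set \<Rightarrow> bool" where
  "measurable_graph V E \<longleftrightarrow>
     graph (space V) E \<and>
     (\<exists>D. degree_bound (space V) E D \<and>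
        (\<forall>n. (\<lambda>x. iso_class D (rooted_ball E n x)) \<in> measurable V (count_space (iso_classes D)))) \<and>
     (indicator E :: 'v \<times> 'v \<Rightarrow> real) \<in> borel_measurable (connected_pairs V E) \<and>
     (\<forall>a \<in> borel_measurable (connected_pairs V E). \<forall>b \<in> borel_measurable (connected_pairs V E).
        kernel_prod E a b \<in> borel_measurable (connected_pairs V E))"

section \<open>Measurable groupoids, transversal functions, invariant measures\<close>

record 'g groupoid =
  arrows :: "'g measure"
  gmul :: "'g \<Rightarrow> 'g \<Rightarrow> 'g"
  ginv :: "'g \<Rightarrow> 'g"

definition rng :: "'g groupoid \<Rightarrow> 'g \<Rightarrow> 'g" where
  "rng \<G> g = gmul \<G> g (ginv \<G> g)"

definition src :: "'g groupoid \<Rightarrow> 'g \<Rightarrow> 'g" where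
  "src \<G> g = gmul \<G> (ginv \<G> g) g"

definition units :: "'g groupoid \<Rightarrow> 'g set" where
  "units \<G> = rng \<G> ` space (arrows \<G>)"

definition unit_space :: "'g groupoid \<Rightarrow> 'g measure" where
  "unit_space \<G> = restrict_space (arrows \<G>) (units \<G>)"

definition rfiber :: "'g groupoid \<Rightarrow> 'g \<Rightarrow> 'g set" where
  "rfiber \<G> \<omega> = {g \<in> space (arrows \<G>). rng \<G> g = \<omega>}"

text \<open>A small category with invertible morphisms, its objects being identified with the identity
  morphisms; \<open>gmul \<G> g h\<close> is meaningful only if \<open>src \<G> g = rng \<G> h\<close>.\<close>

definition is_groupoid :: "'g groupoid \<Rightarrow> bool" where
  "is_groupoid \<G> \<longleftrightarrow>
     (\<forall>g \<in> space (arrows \<G>).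
        ginv \<G> g \<in> space (arrows \<G>) \<and> rng \<G> g \<in> space (arrows \<G>) \<and> src \<G> g \<in> space (arrows \<G>) \<and>
        rng \<G> (rng \<G> g) = rng \<G> g \<and> src \<G> (rng \<G> g) = rng \<G> g \<and>
        rng \<G> (src \<G> g) = src \<G> g \<and> src \<G> (src \<G> g) = src \<G> g \<and>
        rng \<G> (ginv \<G> g) = src \<G> g \<and> src \<G> (ginv \<G> g) = rng \<G> g \<and>
        gmul \<G> (rng \<G> g) g = g \<and> gmul \<G> g (src \<G> g) = g) \<and>
     (\<forall>g \<in> space (arrows \<G>). \<forall>h \<in> space (arrows \<G>). src \<G> g = rng \<G> h \<longrightarrow>
        gmul \<G> g h \<in> space (arrows \<G>) \<and>
        rng \<G> (gmul \<G> g h) = rng \<G> g \<and> src \<G> (gmul \<G> g h) = src \<G> h) \<and>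
     (\<forall>g \<in> space (arrows \<G>). \<forall>h \<in> space (arrows \<G>). \<forall>k \<in> space (arrows \<G>).
        src \<G> g = rng \<G> h \<longrightarrow> src \<G> h = rng \<G> k \<longrightarrow>
        gmul \<G> (gmul \<G> g h) k = gmul \<G> g (gmul \<G> h k))"

definition measurable_groupoid :: "'g groupoid \<Rightarrow> bool" where
  "measurable_groupoid \<G> \<longleftrightarrow>
     is_groupoid \<G> \<and>
     (\<lambda>(g, h). gmul \<G> g h) \<in>
       measurable (restrict_space (arrows \<G> \<Otimes>\<^sub>M arrows \<G>) {(g, h). src \<G> g = rng \<G> h}) (arrows \<G>) \<and>
     ginv \<G> \<in> measurable (arrows \<G>) (arrows \<G>) \<and>
     rng \<G> \<in> measurable (arrows \<G>) (unit_space \<G>) \<and>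
     src \<G> \<in> measurable (arrows \<G>) (unit_space \<G>) \<and>
     (\<forall>\<omega> \<in> units \<G>. {\<omega>} \<in> sets (unit_space \<G>))"

definition transversal_function :: "'g groupoid \<Rightarrow> ('g \<Rightarrow> 'g measure) \<Rightarrow> bool" where
  "transversal_function \<G> \<nu> \<longleftrightarrow>
     (\<forall>\<omega> \<in> units \<G>. sets (\<nu> \<omega>) = sets (arrows \<G>) \<and>
        emeasure (\<nu> \<omega>) (space (arrows \<G>) - rfiber \<G> \<omega>) = 0) \<and>
     (\<forall>f \<in> borel_measurable (arrows \<G>).
        (\<lambda>\<omega>. \<integral>\<^sup>+g. f g \<partial>\<nu> \<omega>) \<in> borel_measurable (unit_space \<G>)) \<and>
     (\<forall>g \<in> space (arrows \<G>).
        \<forall>f \<in> borel_measurable (restrict_space (arrows \<G>) (rfiber \<G> (rng \<G> g))).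
        (\<integral>\<^sup>+h \<in> rfiber \<G> (src \<G> g). f (gmul \<G> g h) \<partial>\<nu> (src \<G> g)) =
        (\<integral>\<^sup>+k \<in> rfiber \<G> (rng \<G> g). f k \<partial>\<nu> (rng \<G> g)))"

text \<open>The measure \<open>\<integral> K \<omega> dm(\<omega>)\<close> on the measurable space \<open>N\<close>.\<close>

definition mixture :: "'a measure \<Rightarrow> ('a \<Rightarrow> 'b measure) \<Rightarrow> 'b measure \<Rightarrow> 'b measure" where
  "mixture m K N = measure_of (space N) (sets N) (\<lambda>B. \<integral>\<^sup>+\<omega>. emeasure (K \<omega>) B \<partial>m)"

definition invariant_measure :: "'g groupoid \<Rightarrow> ('g \<Rightarrow> 'g measure) \<Rightarrow> 'g measure \<Rightarrow> bool" where
  "invariant_measure \<G> \<nu> m \<longleftrightarrow>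
     sets m = sets (unit_space \<G>) \<and>
     distr (mixture m \<nu> (arrows \<G>)) (arrows \<G>) (ginv \<G>) = mixture m \<nu> (arrows \<G>)"

section \<open>Graphs over a groupoid\<close>

record ('g, 'v) ggraph =
  verts :: "'v measure"
  edges :: "('v \<times> 'v) set"
  proj :: "'v \<Rightarrow> 'g"
  act :: "'g \<Rightarrow> 'v \<Rightarrow> 'v"

definition vfiber :: "('g, 'v) ggraph \<Rightarrow> 'g \<Rightarrow> 'v set" where
  "vfiber G \<omega> = {x \<in> space (verts G). proj G x = \<omega>}"

definition fiber_count :: "('g, 'v) ggraph \<Rightarrow> 'g \<Rightarrow> 'v measure" where
  "fiber_count G \<omega> = distr (count_space (vfiber G \<omega>)) (verts G) (\<lambda>x. x)"

definition graph_over :: "'g groupoid \<Rightarrow> ('g, 'v) ggraph \<Rightarrow> bool" where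
  "graph_over \<G> G \<longleftrightarrow>
     measurable_graph (verts G) (edges G) \<and>
     proj G \<in> measurable (verts G) (unit_space \<G>) \<and>
     (\<forall>\<omega> \<in> units \<G>. countable (vfiber G \<omega>)) \<and>
     (\<forall>F \<in> borel_measurable (verts G).
        (\<lambda>\<omega>. \<integral>\<^sup>+x. F x \<partial>fiber_count G \<omega>) \<in> borel_measurable (unit_space \<G>)) \<and>
     (\<forall>g \<in> space (arrows \<G>).
        bij_betw (act G g) (vfiber G (src \<G> g)) (vfiber G (rng \<G> g)) \<and>
        (\<forall>x \<in> vfiber G (src \<G> g). \<forall>y \<in> vfiber G (src \<G> g).
           (x, y) \<in> edges G \<longleftrightarrow> (act G g x, act G g y) \<in> edges G) \<and>
        (\<forall>x \<in> vfiber G (src \<G> g). act G (ginv \<G> g) (act G g x) = x)) \<and>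
     (\<forall>g \<in> space (arrows \<G>). \<forall>h \<in> space (arrows \<G>). src \<G> g = rng \<G> h \<longrightarrow>
        (\<forall>x \<in> vfiber G (src \<G> h). act G (gmul \<G> g h) x = act G g (act G h x))) \<and>
     (\<lambda>(g, x). act G g x) \<in>
       measurable (restrict_space (arrows \<G> \<Otimes>\<^sub>M verts G) {(g, x). src \<G> g = proj G x}) (verts G) \<and>
     (\<forall>(x, y) \<in> edges G. proj G x = proj G y)"

definition averaging_function ::
  "'g groupoid \<Rightarrow> ('g \<Rightarrow> 'g measure) \<Rightarrow> ('g, 'v) ggraph \<Rightarrow> ('v \<Rightarrow> ennreal) \<Rightarrow> bool" where
  "averaging_function \<G> \<nu> G \<uu> \<longleftrightarrow>
     \<uu> \<in> borel_measurable (verts G) \<and>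
     (\<forall>x \<in> space (verts G).
        (\<integral>\<^sup>+g \<in> rfiber \<G> (proj G x). \<uu> (act G (ginv \<G> g) x) \<partial>\<nu> (proj G x)) = 1)"

definition vertex_measure :: "'g measure \<Rightarrow> ('g, 'v) ggraph \<Rightarrow> 'v measure" where
  "vertex_measure m G = mixture m (fiber_count G) (verts G)"

text \<open>A countable base of a \<open>\<sigma>\<close>-algebra is a countable family generating it.\<close>

definition finite_countable_base :: "'a measure \<Rightarrow> bool" where
  "finite_countable_base N \<longleftrightarrow>
     (\<exists>\<B>. countable \<B> \<and> \<B> \<subseteq> sets N \<and> sets N = sigma_sets (space N) \<B> \<and>
        (\<forall>B\<in>\<B>. emeasure N B < \<infinity>))"

definition measure_graph ::
  "'g groupoid \<Rightarrow> ('g \<Rightarrow> 'g measure) \<Rightarrow> 'g measure \<Rightarrow> ('g, 'v) ggraph \<Rightarrow> bool" where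
  "measure_graph \<G> \<nu> m G \<longleftrightarrow>
     measurable_groupoid \<G> \<and> transversal_function \<G> \<nu> \<and> invariant_measure \<G> \<nu> m \<and>
     graph_over \<G> G \<and>
     finite_countable_base (vertex_measure m G) \<and> finite_countable_base m \<and>
     (\<exists>\<uu>. averaging_function \<G> \<nu> G \<uu> \<and> (\<forall>x \<in> space (verts G). 0 < \<uu> x) \<and>
        (\<integral>\<^sup>+x. \<uu> x \<partial>vertex_measure m G) < \<infinity>)"

section \<open>The zeta function\<close>

definition reduced_closed_paths :: "('v \<times> 'v) set \<Rightarrow> nat \<Rightarrow> 'v \<Rightarrow> ('v \<times> 'v) list set" where
  "reduced_closed_paths E n x = {es. length es = n \<and> es \<noteq> [] \<and> set es \<subseteq> E \<and>
     (\<forall>i. Suc i < n \<longrightarrow> snd (es ! i) = fst (es ! Suc i) \<and> es ! Suc i \<noteq> prod.swap (es ! i)) \<and>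
     snd (last es) = fst (hd es) \<and> prod.swap (hd es) \<noteq> last es \<and> fst (hd es) = x}"

definition mean_path_count ::
  "'g measure \<Rightarrow> ('g, 'v) ggraph \<Rightarrow> ('v \<Rightarrow> ennreal) \<Rightarrow> nat \<Rightarrow> real" where
  "mean_path_count m G \<uu> j =
     enn2real (\<integral>\<^sup>+x. of_nat (card (reduced_closed_paths (edges G) j x)) * \<uu> x \<partial>vertex_measure m G)"

definition ihara_zeta ::
  "'g measure \<Rightarrow> ('g, 'v) ggraph \<Rightarrow> ('v \<Rightarrow> ennreal) \<Rightarrow> complex \<Rightarrow> complex" where
  "ihara_zeta m G \<uu> u =
     exp (\<Sum>j. complex_of_real (mean_path_count m G \<uu> (Suc j)) / of_nat (Suc j) * u ^ Suc j)"

section \<open>The Hilbert spaces of square summable functions\<close>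

text \<open>Elements of \<open>\<ell>\<^sup>2(S)\<close> are functions on the whole type that vanish outside \<open>S\<close>.\<close>

definition ell2 :: "'v set \<Rightarrow> ('v \<Rightarrow> complex) set" where
  "ell2 S = {f. (\<forall>x. x \<notin> S \<longrightarrow> f x = 0) \<and> (\<lambda>x. (norm (f x))\<^sup>2) summable_on S}"

definition ell2_inner :: "'v set \<Rightarrow> ('v \<Rightarrow> complex) \<Rightarrow> ('v \<Rightarrow> complex) \<Rightarrow> complex" where
  "ell2_inner S g f = (\<Sum>\<^sub>\<infinity>x\<in>S. cnj (g x) * f x)"

definition ell2_norm :: "'v set \<Rightarrow> ('v \<Rightarrow> complex) \<Rightarrow> real" where
  "ell2_norm S f = sqrt (\<Sum>\<^sub>\<infinity>x\<in>S. (norm (f x))\<^sup>2)"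

definition ell2_delta :: "'v \<Rightarrow> 'v \<Rightarrow> complex" where
  "ell2_delta x = (\<lambda>y. if y = x then 1 else 0)"

definition ell2_restrict :: "'v set \<Rightarrow> ('v \<Rightarrow> complex) \<Rightarrow> 'v \<Rightarrow> complex" where
  "ell2_restrict S f = (\<lambda>x. if x \<in> S then f x else 0)"

type_synonym 'v operator = "('v \<Rightarrow> complex) \<Rightarrow> 'v \<Rightarrow> complex"

text \<open>Only the values of an operator on \<open>ell2 S\<close> matter.\<close>

definition bounded_operator :: "'v set \<Rightarrow> 'v operator \<Rightarrow> bool" where
  "bounded_operator S T \<longleftrightarrow>
     (\<forall>f \<in> ell2 S. T f \<in> ell2 S) \<and>
     (\<forall>f \<in> ell2 S. \<forall>h \<in> ell2 S. \<forall>a b.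
        T (\<lambda>x. a * f x + b * h x) = (\<lambda>x. a * T f x + b * T h x)) \<and>
     (\<exists>C. \<forall>f \<in> ell2 S. ell2_norm S (T f) \<le> C * ell2_norm S f)"

definition operator_norm :: "'v set \<Rightarrow> 'v operator \<Rightarrow> real" where
  "operator_norm S T = Inf {C. 0 \<le> C \<and> (\<forall>f \<in> ell2 S. ell2_norm S (T f) \<le> C * ell2_norm S f)}"

text \<open>The adjoint of an operator from \<open>\<ell>\<^sup>2(S)\<close> to \<open>\<ell>\<^sup>2(S')\<close>.\<close>

definition operator_adjoint :: "'v set \<Rightarrow> 'v set \<Rightarrow> 'v operator \<Rightarrow> 'v operator" where
  "operator_adjoint S S' T =
     (\<lambda>f. THE h. h \<in> ell2 S \<and> (\<forall>k \<in> ell2 S. ell2_inner S k h = ell2_inner S' (T k) f))"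

definition operator_poly :: "complex poly \<Rightarrow> 'v operator \<Rightarrow> 'v operator" where
  "operator_poly p T = (\<lambda>f x. \<Sum>k\<le>degree p. coeff p k * (T ^^ k) f x)"

section \<open>The von Neumann algebra, its trace, and the spectral measure\<close>

definition translation :: "'g groupoid \<Rightarrow> ('g, 'v) ggraph \<Rightarrow> 'g \<Rightarrow> 'v operator" where
  "translation \<G> G g =
     (\<lambda>f x. if x \<in> vfiber G (rng \<G> g) then f (act G (ginv \<G> g) x) else 0)"

definition square_integrable :: "'g measure \<Rightarrow> ('g, 'v) ggraph \<Rightarrow> ('v \<Rightarrow> complex) set" where
  "square_integrable m G = {f \<in> borel_measurable (vertex_measure m G).
     (\<integral>\<^sup>+x. ennreal ((norm (f x))\<^sup>2) \<partial>vertex_measure m G) < \<infinity>}"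

type_synonym ('g, 'v) op_family = "'g \<Rightarrow> 'v operator"

text \<open>A square integrable \<open>f\<close> has \<open>f\<^sub>\<omega> \<in> \<ell>\<^sup>2(V\<^sup>\<omega>)\<close> only for almost every \<open>\<omega>\<close>; on the remaining null
  set, which is measurable, the matrix coefficient is taken to be 0.\<close>

definition matrix_coefficient ::
  "('g, 'v) ggraph \<Rightarrow> ('g, 'v) op_family \<Rightarrow> ('v \<Rightarrow> complex) \<Rightarrow> ('v \<Rightarrow> complex) \<Rightarrow> 'g \<Rightarrow> complex" where
  "matrix_coefficient G A h f \<omega> =
     (let h\<^sub>\<omega> = ell2_restrict (vfiber G \<omega>) h; f\<^sub>\<omega> = ell2_restrict (vfiber G \<omega>) f in
      if h\<^sub>\<omega> \<in> ell2 (vfiber G \<omega>) \<and> f\<^sub>\<omega> \<in> ell2 (vfiber G \<omega>)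
      then ell2_inner (vfiber G \<omega>) h\<^sub>\<omega> (A \<omega> f\<^sub>\<omega>) else 0)"

text \<open>The elements of the algebra are the families below up to the equality \<open>family_eq\<close>.\<close>

definition vn_algebra ::
  "'g groupoid \<Rightarrow> 'g measure \<Rightarrow> ('g, 'v) ggraph \<Rightarrow> ('g, 'v) op_family set" where
  "vn_algebra \<G> m G = {A.
     (\<forall>\<omega> \<in> units \<G>. bounded_operator (vfiber G \<omega>) (A \<omega>)) \<and>
     (\<exists>C. AE \<omega> in m. operator_norm (vfiber G \<omega>) (A \<omega>) \<le> C) \<and>
     (\<forall>f \<in> square_integrable m G. \<forall>h \<in> square_integrable m G.
        matrix_coefficient G A h f \<in> borel_measurable (unit_space \<G>)) \<and>
     (\<forall>g \<in> space (arrows \<G>). \<forall>f \<in> ell2 (vfiber G (rng \<G> g)).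
        A (rng \<G> g) f =
        translation \<G> G g (A (src \<G> g)
          (operator_adjoint (vfiber G (src \<G> g)) (vfiber G (rng \<G> g)) (translation \<G> G g) f)))}"

definition family_eq ::
  "'g measure \<Rightarrow> ('g, 'v) ggraph \<Rightarrow> ('g, 'v) op_family \<Rightarrow> ('g, 'v) op_family \<Rightarrow> bool" where
  "family_eq m G A B \<longleftrightarrow> (AE \<omega> in m. \<forall>f \<in> ell2 (vfiber G \<omega>). A \<omega> f = B \<omega> f)"

definition family_id :: "('g, 'v) op_family" where
  "family_id = (\<lambda>\<omega> f. f)"

definition family_diff ::
  "('g, 'v) op_family \<Rightarrow> ('g, 'v) op_family \<Rightarrow> ('g, 'v) op_family" where
  "family_diff A B = (\<lambda>\<omega> f x. A \<omega> f x - B \<omega> f x)"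

definition family_scale :: "complex \<Rightarrow> ('g, 'v) op_family \<Rightarrow> ('g, 'v) op_family" where
  "family_scale c A = (\<lambda>\<omega> f x. c * A \<omega> f x)"

definition family_comp ::
  "('g, 'v) op_family \<Rightarrow> ('g, 'v) op_family \<Rightarrow> ('g, 'v) op_family" where
  "family_comp A B = (\<lambda>\<omega> f. A \<omega> (B \<omega> f))"

definition vn_norm :: "'g measure \<Rightarrow> ('g, 'v) ggraph \<Rightarrow> ('g, 'v) op_family \<Rightarrow> real" where
  "vn_norm m G A = Inf {C. 0 \<le> C \<and> (AE \<omega> in m. operator_norm (vfiber G \<omega>) (A \<omega>) \<le> C)}"

text \<open>The formula that defines the trace on positive elements is linear in \<open>A\<close>, and is bounded by
  \<open>vn_norm m G A\<close> times the integral of \<open>\<uu>\<close>; so on all of the algebra it is the norm-continuous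
  linear extension.  By integrability \<open>\<uu>\<close> is finite almost everywhere, whence \<open>enn2real\<close>.
  The completion makes the integral depend on \<open>A\<close> only up to \<open>family_eq\<close>.\<close>

definition vn_trace ::
  "'g measure \<Rightarrow> ('g, 'v) ggraph \<Rightarrow> ('v \<Rightarrow> ennreal) \<Rightarrow> ('g, 'v) op_family \<Rightarrow> complex" where
  "vn_trace m G \<uu> A =
     (\<integral>\<omega>. (\<Sum>\<^sub>\<infinity>x \<in> vfiber G \<omega>. complex_of_real (enn2real (\<uu> x)) *
        ell2_inner (vfiber G \<omega>) (ell2_delta x) (A \<omega> (ell2_delta x))) \<partial>completion m)"

definition adjacency_operator :: "('g, 'v) ggraph \<Rightarrow> ('g, 'v) op_family" where
  "adjacency_operator G =
     (\<lambda>\<omega> f x. if x \<in> vfiber G \<omega> then \<Sum>y | (x, y) \<in> edges G. f y else 0)"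

definition vn_spectrum ::
  "'g groupoid \<Rightarrow> 'g measure \<Rightarrow> ('g, 'v) ggraph \<Rightarrow> ('g, 'v) op_family \<Rightarrow> complex set" where
  "vn_spectrum \<G> m G A = {z. \<not> (\<exists>B \<in> vn_algebra \<G> m G.
     family_eq m G (family_comp (family_diff A (family_scale z family_id)) B) family_id \<and>
     family_eq m G (family_comp B (family_diff A (family_scale z family_id))) family_id)}"

text \<open>\<open>has_functional_calculus \<G> m G A \<phi> B\<close> means \<open>B = \<phi>(A)\<close> in the continuous functional calculus
  of the self-adjoint element \<open>A\<close>: it is the norm limit of \<open>p\<^sub>n(A)\<close> for polynomials \<open>p\<^sub>n\<close> converging to
  \<open>\<phi>\<close> uniformly on the spectrum.\<close>

definition has_functional_calculus ::
  "'g groupoid \<Rightarrow> 'g measure \<Rightarrow> ('g, 'v) ggraph \<Rightarrow> ('g, 'v) op_family \<Rightarrow> (complex \<Rightarrow> complex) \<Rightarrow>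
     ('g, 'v) op_family \<Rightarrow> bool" where
  "has_functional_calculus \<G> m G A \<phi> B \<longleftrightarrow>
     B \<in> vn_algebra \<G> m G \<and>
     (\<exists>p. uniform_limit (vn_spectrum \<G> m G A) (\<lambda>n. poly (p n)) \<phi> sequentially \<and>
        (\<lambda>n. vn_norm m G (family_diff (\<lambda>\<omega>. operator_poly (p n) (A \<omega>)) B)) \<longlonglongrightarrow> 0)"

definition spectral_measure ::
  "'g groupoid \<Rightarrow> 'g measure \<Rightarrow> ('g, 'v) ggraph \<Rightarrow> ('v \<Rightarrow> ennreal) \<Rightarrow> complex measure \<Rightarrow> bool" where
  "spectral_measure \<G> m G \<uu> \<mu> \<longleftrightarrow>
     sets \<mu> = sets (restrict_space borel (vn_spectrum \<G> m G (adjacency_operator G))) \<and>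
     finite_measure \<mu> \<and>
     (\<forall>\<phi> B. continuous_on (vn_spectrum \<G> m G (adjacency_operator G)) \<phi> \<longrightarrow>
        has_functional_calculus \<G> m G (adjacency_operator G) \<phi> B \<longrightarrow>
        vn_trace m G \<uu> B = (\<integral>z. \<phi> z \<partial>\<mu>))"

end

theory Submission
  imports Defs "HOL-Probability.Giry_Monad"
begin

text \<open>On an \<open>(r+1)\<close>-regular graph, counting non-backtracking walks by their last edge gives a
  two-step recursion, solved by the Chebyshev-like polynomials \<open>U\<^sub>n\<close> with
  \<open>U\<^sub>n\<^sub>+\<^sub>2 = X U\<^sub>n\<^sub>+\<^sub>1 - r U\<^sub>n\<close> in the adjacency operator. For the reduced closed paths it yields,
  pointwise,
  \<open>N\<^sub>n(x) = p\<^sub>n(A)(x,x) + (r-1)[n even] + \<Delta>F(x)\<close>, where \<open>p\<^sub>n(\<alpha>+\<beta>) = \<alpha>\<^sup>n + \<beta>\<^sup>n\<close> if \<open>\<alpha>\<beta> = r\<close>, and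
  \<open>F\<close> is invariant under the groupoid. Closed paths with a tail enter only through the Laplacian
  \<open>\<Delta>F\<close>, whose \<open>\<uu>\<close>-weighted integral vanishes by invariance of \<open>m\<close> (mass transport). So the mean of
  \<open>N\<^sub>n\<close> is \<open>\<integral> p\<^sub>n d\<mu> + (r-1)[n even] \<tau>(I)\<close>. The spectrum lies in the disc of radius \<open>r+1\<close>,
  on which both roots \<open>\<alpha>, \<beta>\<close> of \<open>t\<^sup>2 - z t + r\<close> have modulus at most \<open>R\<close>; hence
  \<open>\<Sum> p\<^sub>n(z) u\<^sup>n / n = - Ln (1 - u\<alpha>) - Ln (1 - u\<beta>) = - Ln (1 - uz + u\<^sup>2r)\<close> may be integrated termwise.
  Only polynomials in \<open>A\<close> are needed from the functional calculus, and reality of the spectrum is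
  never used.\<close>

section \<open>Non-backtracking walks in regular graphs\<close>

text \<open>Regularity holds only almost everywhere, and the degree bound of the whole graph may
  exceed r + 1. Since M counts the points of each fibre, almost every fibre is regular at all of its
  vertices. Edges stay inside fibres, so the combinatorics is done on one fibre at a time; this is
  also how the spectrum gets the bound r + 1. The constant R is the positive root of t^2 = (r+1) t +
  (r+1). The triangle inequality gives |\<alpha>|^2 \<le> (r+1) |\<alpha>| + r for the roots, which
  is just enough. The measure-theoretic obstacle is mass transport: it integrates over arrows a
  fibre sum whose summand depends on the arrow, whereas the hypotheses give measurability only for
  the fibre sums of one fixed function. Weights taken from a positive integrable averaging function
  make almost all counting measures finite and remove this obstacle. The averaging function of the
  statement need not be that one; transport along the diagonal shows that both have the same
  integral.\<close>

definition nbr_sum :: "('v \<times> 'v) set \<Rightarrow> ('v \<Rightarrow> 'a) \<Rightarrow> 'v \<Rightarrow> 'a::comm_monoid_add" where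
  "nbr_sum E f x = (\<Sum>y | (x, y) \<in> E. f y)"

primrec walks :: "('v \<times> 'v) set \<Rightarrow> nat \<Rightarrow> 'v \<Rightarrow> 'v \<Rightarrow> nat" where
  "walks E 0 x y = of_bool (x = y)"
| "walks E (Suc k) x y = nbr_sum E (\<lambda>z. walks E k z y) x"

text \<open>The entry at (x, y) of the polynomial p in the adjacency operator. Walk counts make it a
  finite sum that is available before any Hilbert space.\<close>

definition kern :: "('v \<times> 'v) set \<Rightarrow> complex poly \<Rightarrow> 'v \<Rightarrow> 'v \<Rightarrow> complex" where
  "kern E p x y = (\<Sum>k\<le>degree p. coeff p k * of_nat (walks E k x y))"

lemma kern_eq: "degree p \<le> n \<Longrightarrow> kern E p x y = (\<Sum>k\<le>n. coeff p k * of_nat (walks E k x y))"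
  unfolding kern_def by (rule sum.mono_neutral_left) (auto simp: coeff_eq_0)

lemma kern_0 [simp]: "kern E 0 x y = 0"
  by (simp add: kern_def)

lemma kern_1 [simp]: "kern E 1 x y = of_bool (x = y)"
  by (simp add: kern_def)

lemma kern_add: "kern E (p + q) x y = kern E p x y + kern E q x y"
proof -
  define n where "n = max (degree p) (degree q)"
  have "degree p \<le> n" "degree q \<le> n" "degree (p + q) \<le> n"
    by (auto simp: n_def degree_add_le)
  then show ?thesis
    by (simp add: kern_eq[where n = n] algebra_simps sum.distrib)
qed

lemma kern_smult: "kern E (smult c p) x y = c * kern E p x y"
  by (simp add: kern_eq[where n = "degree p"] degree_smult_le sum_distrib_left mult.assoc)

lemma kern_diff: "kern E (p - q) x y = kern E p x y - kern E q x y"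
  using kern_add[of E p "smult (-1) q" x y] kern_smult[of E "-1" q x y] by simp

text \<open>\<open>pCons 0\<close> multiplies by the indeterminate, which acts as the adjacency
  operator on the first vertex. Recursions of polynomials thereby become recursions along
  neighbours.\<close>

lemma kern_X_mult: "kern E (pCons 0 p) x y = nbr_sum E (\<lambda>z. kern E p z y) x"
proof -
  have "kern E (pCons 0 p) x y
      = (\<Sum>k\<le>Suc (degree p). coeff (pCons 0 p) k * of_nat (walks E k x y))"
    by (rule kern_eq) (simp add: degree_pCons_le)
  also have "\<dots> = (\<Sum>k\<le>degree p. coeff p k * of_nat (walks E (Suc k) x y))"
    by (subst sum.atMost_Suc_shift) simp
  also have "\<dots> = nbr_sum E (\<lambda>z. kern E p z y) x"
    unfolding kern_def nbr_sum_def walks.simps of_nat_sum sum_distrib_left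
    by (rule sum.swap)
  finally show ?thesis .
qed

section \<open>Walks without backtracking on oriented edges\<close>

definition follows :: "('v \<times> 'v) set \<Rightarrow> 'v \<times> 'v \<Rightarrow> 'v \<times> 'v \<Rightarrow> bool" where
  "follows E e g \<longleftrightarrow> g \<in> E \<and> fst g = snd e \<and> g \<noteq> prod.swap e"

text \<open>Entries of the n-th power of the Hashimoto matrix, whose rows and columns are the
  oriented edges.\<close>

primrec nbw :: "('v \<times> 'v) set \<Rightarrow> nat \<Rightarrow> 'v \<times> 'v \<Rightarrow> 'v \<times> 'v \<Rightarrow> nat" where
  "nbw E 0 e f = of_bool (e = f)"
| "nbw E (Suc n) e f = (\<Sum>g | follows E e g. nbw E n g f)"

text \<open>The starting edge is not stored, so n steps are a list of length n; for n = 0 the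
  condition on \<open>last (e # es)\<close> says e = f.\<close>

definition nb_lists :: "('v \<times> 'v) set \<Rightarrow> nat \<Rightarrow> 'v \<times> 'v \<Rightarrow> 'v \<times> 'v \<Rightarrow> ('v \<times> 'v) list set" where
  "nb_lists E n e f = {es. length es = n \<and> successively (follows E) (e # es) \<and> last (e # es) = f}"

lemma nb_lists_Suc: "nb_lists E (Suc n) e f = (\<Union>g\<in>{g. follows E e g}. (#) g ` nb_lists E n g f)"
  unfolding nb_lists_def by (fastforce simp: length_Suc_conv image_iff)

text \<open>The list attached to a reduced closed path starting with the edge \<open>e\<close> consists of the edges after
  \<open>e\<close>, followed by \<open>e\<close> itself; reducedness at the base point becomes one more \<open>follows\<close> step.\<close>

lemma reduced_closed_paths_eq:
  assumes "0 < n"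
  shows "reduced_closed_paths E n x =
    (\<Union>e\<in>{e \<in> E. fst e = x}. (\<lambda>fs. e # butlast fs) ` nb_lists E n e e)" (is "?L = ?R")
proof
  show "?L \<subseteq> ?R"
  proof
    fix es assume "es \<in> ?L"
    then have es: "length es = n" "es \<noteq> []" "set es \<subseteq> E"
      and ch: "\<And>i. Suc i < n \<Longrightarrow> snd (es ! i) = fst (es ! Suc i) \<and> es ! Suc i \<noteq> prod.swap (es ! i)"
      and cl: "snd (last es) = fst (hd es)" "prod.swap (hd es) \<noteq> last es" "fst (hd es) = x"
      by (auto simp: reduced_closed_paths_def)
    obtain e rest where er: "es = e # rest"
      using es(2) by (cases es) auto
    have "successively (follows E) es"
      unfolding successively_conv_nth follows_def
      using ch es nth_mem[of "Suc _" es] by (metis subsetD)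
    moreover have "follows E (last es) e"
      using cl es er unfolding follows_def by (metis list.sel(1) list.set_intros(1) subsetD swap_swap)
    ultimately have "successively (follows E) (es @ [e])"
      using es by (simp add: successively_append_iff)
    then have "rest @ [e] \<in> nb_lists E n e e"
      using es er by (simp add: nb_lists_def)
    moreover have "es = (\<lambda>fs. e # butlast fs) (rest @ [e])"
      by (simp add: er)
    moreover have "e \<in> {e \<in> E. fst e = x}"
      using es er cl by auto
    ultimately show "es \<in> ?R" by blast
  qed
  show "?R \<subseteq> ?L"
  proof
    fix es assume "es \<in> ?R"
    then obtain e fs where e: "e \<in> E" "fst e = x" and fs: "fs \<in> nb_lists E n e e"
      and es: "es = e # butlast fs" by auto
    have len: "length fs = n" and su: "successively (follows E) (e # fs)" and la: "last (e # fs) = e"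
      using fs by (auto simp: nb_lists_def)
    have "fs \<noteq> []" using len assms by auto
    then have fs_eq: "fs = butlast fs @ [e]"
      using la by (metis append_butlast_last_id last_ConsR)
    have su': "successively (follows E) (es @ [e])"
      using su es fs_eq by (metis append_Cons)
    then have "successively (follows E) es \<and> (es = [] \<or> follows E (last es) e)"
      by (simp add: successively_append_iff)
    then have 1: "successively (follows E) es" "follows E (last es) e"
      using es by auto
    have len': "length es = n" using es len \<open>fs \<noteq> []\<close> by (cases fs) auto
    have ch: "follows E (es ! i) (es ! Suc i)" if "Suc i < n" for i
      using 1(1) that len' by (simp add: successively_conv_nth)
    have "es ! i \<in> E" if "i < n" for i
      using that ch e by (cases i) (auto simp: es follows_def)
    then have "set es \<subseteq> E" using len' by (metis in_set_conv_nth subsetI)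
    moreover have "snd (last es) = fst (hd es)" "prod.swap (hd es) \<noteq> last es"
      using 1(2) unfolding follows_def es by (simp, metis list.sel(1) swap_swap)
    ultimately show "es \<in> ?L"
      using ch len' e unfolding reduced_closed_paths_def es follows_def by auto
  qed
qed

text \<open>\<open>S\<close> is a union of connected components. Instances are the whole vertex set
  and the fibres with the global degree bound, and the regular fibres with the better bound
  \<open>r + 1\<close>.\<close>

locale bounded_region =
  fixes E :: "('v \<times> 'v) set" and S :: "'v set" and D :: nat
  assumes symE: "sym E"
    and closed: "\<And>x y. (x, y) \<in> E \<Longrightarrow> x \<in> S \<Longrightarrow> y \<in> S"
    and fin: "\<And>x. x \<in> S \<Longrightarrow> finite {y. (x, y) \<in> E}"
    and deg_le: "\<And>x. x \<in> S \<Longrightarrow> card {y. (x, y) \<in> E} \<le> D"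
begin

lemma edge_sym: "(x, y) \<in> E \<longleftrightarrow> (y, x) \<in> E"
  using symE by (auto dest: symD)

lemma walks_one: "x \<in> S \<Longrightarrow> walks E (Suc 0) x y = of_bool ((x, y) \<in> E)"
  using fin by (auto simp: nbr_sum_def of_bool_def if_distrib sum.delta cong: if_cong)

text \<open>The definition of \<open>walks\<close> peels off the first step. Symmetry of
  \<open>E\<close> allows the last step to be peeled off as well, and comparing the two makes the
  kernel symmetric.\<close>

lemma walks_Suc_right:
  "x \<in> S \<Longrightarrow> y \<in> S \<Longrightarrow> walks E (Suc k) x y = nbr_sum E (\<lambda>z. walks E k x z) y"
proof (induction k arbitrary: x)
  case 0
  have "nbr_sum E (\<lambda>z. walks E 0 x z) y = of_bool ((y, x) \<in> E)"
    using fin[OF 0(2)] by (simp add: nbr_sum_def of_bool_def if_distrib sum.delta' cong: if_cong)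
  then show ?case using walks_one[OF 0(1)] edge_sym by auto
next
  case (Suc k)
  have "walks E (Suc (Suc k)) x y = (\<Sum>z | (x, z) \<in> E. walks E (Suc k) z y)"
    by (simp add: nbr_sum_def)
  also have "\<dots> = (\<Sum>z | (x, z) \<in> E. \<Sum>z' | (y, z') \<in> E. walks E k z z')"
    using Suc closed by (intro sum.cong) (auto simp: nbr_sum_def)
  also have "\<dots> = (\<Sum>z' | (y, z') \<in> E. \<Sum>z | (x, z) \<in> E. walks E k z z')"
    by (rule sum.swap)
  finally show ?case by (simp add: nbr_sum_def)
qed

lemma walks_commute: "x \<in> S \<Longrightarrow> y \<in> S \<Longrightarrow> walks E k x y = walks E k y x"
proof (induction k arbitrary: x y)
  case 0
  then show ?case by auto
next
  case (Suc k)
  have "walks E (Suc k) x y = nbr_sum E (\<lambda>z. walks E k x z) y"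
    using Suc by (simp only: walks_Suc_right)
  also have "\<dots> = walks E (Suc k) y x"
    using Suc closed by (auto simp: nbr_sum_def intro!: sum.cong)
  finally show ?case .
qed

lemma walks_le: "x \<in> S \<Longrightarrow> walks E k x y \<le> D ^ k"
proof (induction k arbitrary: x)
  case (Suc k)
  have "walks E (Suc k) x y \<le> (\<Sum>z | (x, z) \<in> E. D ^ k)"
    unfolding walks.simps nbr_sum_def using Suc closed by (intro sum_mono) auto
  also have "\<dots> \<le> D * D ^ k"
    using deg_le[OF Suc.prems] by simp
  finally show ?case by simp
qed auto

lemma kern_commute: "x \<in> S \<Longrightarrow> y \<in> S \<Longrightarrow> kern E p x y = kern E p y x"
  unfolding kern_def using walks_commute by auto

end

locale regular_region = bounded_region E S "r + 1"
  for E :: "('v \<times> 'v) set" and S :: "'v set" and r :: nat +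
  assumes irreflE: "irrefl E"
    and deg: "\<And>x. x \<in> S \<Longrightarrow> card {y. (x, y) \<in> E} = r + 1"
begin

lemma finite_follows: "snd e \<in> S \<Longrightarrow> finite {g. follows E e g}"
  by (rule finite_subset[of _ "Pair (snd e) ` {z. (snd e, z) \<in> E}"])
     (auto simp: follows_def fin)

lemma nb_lists_card: "snd e \<in> S \<Longrightarrow> finite (nb_lists E n e f) \<and> card (nb_lists E n e f) = nbw E n e f"
proof (induction n arbitrary: e)
  case 0
  have "nb_lists E 0 e f = (if e = f then {[]} else {})"
    by (auto simp: nb_lists_def)
  then show ?case by simp
next
  case (Suc n)
  have S: "snd g \<in> S" if "follows E e g" for g
    using that Suc.prems closed by (cases g) (auto simp: follows_def)
  have "card (nb_lists E (Suc n) e f) = (\<Sum>g | follows E e g. card ((#) g ` nb_lists E n g f))"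
    unfolding nb_lists_Suc using S Suc
    by (intro card_UN_disjoint) (auto simp: finite_follows)
  also have "\<dots> = nbw E (Suc n) e f"
    using S Suc by (auto simp: card_image intro!: sum.cong)
  finally show ?case
    unfolding nb_lists_Suc using S Suc finite_follows by auto
qed

lemma card_reduced_closed_paths:
  assumes "x \<in> S" "0 < n"
  shows "card (reduced_closed_paths E n x) = (\<Sum>y | (x, y) \<in> E. nbw E n (x, y) (x, y))"
proof -
  let ?I = "Pair x ` {y. (x, y) \<in> E}"
  have I: "{e \<in> E. fst e = x} = ?I" by auto
  have S: "snd e \<in> S" if "e \<in> ?I" for e using that assms closed by auto
  \<comment> \<open>For n > 0 every list here ends in e, so \<open>butlast\<close> forgets
    nothing.\<close>
  have inj: "inj_on (\<lambda>fs. e # butlast fs) (nb_lists E n e e)" for e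
  proof (rule inj_onI)
    fix fs gs assume "fs \<in> nb_lists E n e e" "gs \<in> nb_lists E n e e"
      and eq: "e # butlast fs = e # butlast gs"
    then have "fs \<noteq> []" "gs \<noteq> []" "last fs = e" "last gs = e"
      using assms by (auto simp: nb_lists_def split: if_splits)
    then show "fs = gs" using eq by (metis append_butlast_last_id list.inject)
  qed
  have "card (reduced_closed_paths E n x) =
      (\<Sum>e\<in>?I. card ((\<lambda>fs. e # butlast fs) ` nb_lists E n e e))"
    unfolding reduced_closed_paths_eq[OF assms(2)] I
    using S nb_lists_card fin[OF assms(1)] by (intro card_UN_disjoint) auto
  also have "\<dots> = (\<Sum>e\<in>?I. nbw E n e e)"
    using S nb_lists_card by (intro sum.cong) (auto simp: card_image[OF inj])
  also have "\<dots> = (\<Sum>y | (x, y) \<in> E. nbw E n (x, y) (x, y))"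
    by (subst sum.reindex) (auto simp: inj_on_def)
  finally show ?thesis .
qed

text \<open>Sums over all first edges at x. Single edges satisfy no closed recursion over vertices,
  because each step excludes one edge; these sums do.\<close>

definition nbv :: "nat \<Rightarrow> 'v \<Rightarrow> 'v \<times> 'v \<Rightarrow> complex" where
  "nbv n x f = (\<Sum>y | (x, y) \<in> E. of_nat (nbw E n (x, y) f))"

text \<open>The edges that may follow (x, y) are all edges at y except the reversal (y, x), whose
  share is subtracted from the full vertex sum.\<close>

lemma nbw_Suc:
  assumes "(x, y) \<in> E" "x \<in> S"
  shows "of_nat (nbw E (Suc n) (x, y) f) = nbv n y f - of_nat (nbw E n (y, x) f)"
proof -
  have y: "y \<in> S" using assms closed by auto
  have "{g. follows E (x, y) g} = Pair y ` ({z. (y, z) \<in> E} - {x})"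
    by (auto simp: follows_def)
  then have "nbw E (Suc n) (x, y) f = (\<Sum>z\<in>{z. (y, z) \<in> E} - {x}. nbw E n (y, z) f)"
    by (simp add: sum.reindex inj_on_def)
  moreover have "(\<Sum>z | (y, z) \<in> E. nbw E n (y, z) f) =
      nbw E n (y, x) f + (\<Sum>z\<in>{z. (y, z) \<in> E} - {x}. nbw E n (y, z) f)"
    using assms edge_sym fin[OF y] by (intro sum.remove) auto
  ultimately show ?thesis
    by (simp add: nbv_def flip: of_nat_sum)
qed

text \<open>Two uses of \<open>nbw_Suc\<close> reverse the first edge twice and so return to it.
  Regularity enters in the sum over the neighbours of x: r + 1 copies of \<open>nbv n x f\<close>
  are subtracted and one is given back, which leaves the factor r.\<close>

lemma nbv_rec:
  assumes "x \<in> S"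
  shows "nbv (Suc (Suc n)) x f = nbr_sum E (\<lambda>y. nbv (Suc n) y f) x - of_nat r * nbv n x f"
proof -
  have "nbv (Suc (Suc n)) x f =
      (\<Sum>y | (x, y) \<in> E. nbv (Suc n) y f - (nbv n x f - of_nat (nbw E n (x, y) f)))"
    unfolding nbv_def[of "Suc (Suc n)"]
    using assms closed edge_sym nbw_Suc by (intro sum.cong) (auto simp del: nbw.simps)
  also have "\<dots> = nbr_sum E (\<lambda>y. nbv (Suc n) y f) x - (of_nat (r + 1) * nbv n x f - nbv n x f)"
    using deg[OF assms] by (simp add: sum_subtractf nbr_sum_def nbv_def)
  finally show ?thesis by (simp add: algebra_simps)
qed

lemma nbv_0: "x \<in> S \<Longrightarrow> (z, w) \<in> E \<Longrightarrow> nbv 0 x (z, w) = of_bool (x = z)"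
  using fin[of x] by (cases "x = z") (auto simp: nbv_def)

text \<open>The edge (x, y) is followed by (z, w) iff y = z and x differs from w; the second term
  removes the backtracking case x = w.\<close>

lemma nbv_1:
  assumes "x \<in> S" "(z, w) \<in> E"
  shows "nbv (Suc 0) x (z, w) = of_bool ((x, z) \<in> E) - of_bool (x = w)"
proof -
  have "nbv (Suc 0) x (z, w) = (\<Sum>y | (x, y) \<in> E. of_bool (y = z) - of_bool (y = z \<and> x = w))"
    unfolding nbv_def[of "Suc 0"]
    using assms closed nbw_Suc[where n = 0] nbv_0
    by (intro sum.cong) (auto simp del: nbw.simps(2))
  also have "\<dots> = of_bool ((x, z) \<in> E) - of_bool (x = w)"
    using fin[OF assms(1)] assms(2) edge_sym
    by (cases "x = w") (auto simp: sum_subtractf of_bool_def)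
  finally show ?thesis .
qed

end

text \<open>\<open>U\<^sub>n\<close>, \<open>p\<^sub>n\<close> and \<open>U\<^sub>n\<^sub>-\<^sub>1\<close> (with \<open>U\<^sub>-\<^sub>1 = 0\<close>) in the notation above; \<open>chebU_sum\<close> is the polynomial whose
  diagonal is the function \<open>F\<close> under the Laplacian.\<close>

fun chebU :: "complex \<Rightarrow> nat \<Rightarrow> complex poly" where
  "chebU c 0 = 1"
| "chebU c (Suc 0) = [:0, 1:]"
| "chebU c (Suc (Suc n)) = pCons 0 (chebU c (Suc n)) - smult c (chebU c n)"

fun dickson :: "complex \<Rightarrow> nat \<Rightarrow> complex poly" where
  "dickson c 0 = [:2:]"
| "dickson c (Suc 0) = [:0, 1:]"
| "dickson c (Suc (Suc n)) = pCons 0 (dickson c (Suc n)) - smult c (dickson c n)"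

fun chebU_sum :: "complex \<Rightarrow> nat \<Rightarrow> complex poly" where
  "chebU_sum c 0 = 0"
| "chebU_sum c (Suc 0) = 0"
| "chebU_sum c (Suc (Suc n)) = chebU_sum c n - chebU c n"

definition chebU_pred :: "complex \<Rightarrow> nat \<Rightarrow> complex poly" where
  "chebU_pred c n = (case n of 0 \<Rightarrow> 0 | Suc k \<Rightarrow> chebU c k)"

lemma chebU_pred_rec:
  "chebU_pred c (Suc (Suc n)) = pCons 0 (chebU_pred c (Suc n)) - smult c (chebU_pred c n)"
  by (cases n) (auto simp: chebU_pred_def one_pCons)

lemma two_step_recursion_unique:
  fixes f g :: "nat \<Rightarrow> complex poly"
  assumes "\<And>n. f (Suc (Suc n)) = pCons 0 (f (Suc n)) - smult c (f n)"
    and "\<And>n. g (Suc (Suc n)) = pCons 0 (g (Suc n)) - smult c (g n)"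
    and "f 0 = g 0" "f (Suc 0) = g (Suc 0)"
  shows "f n = g n"
proof -
  have "f n = g n \<and> f (Suc n) = g (Suc n)"
    by (induction n) (auto simp: assms)
  then show ?thesis ..
qed

text \<open>Behind it lie X U_k = U_{k+1} + c U_{k-1} and p_k = U_k - c U_{k-2}. To avoid negative
  indices, both sides are shown to satisfy the same two-step recursion, so that the cases n = 0 and
  n = 1 decide.\<close>

lemma dickson_step:
  "pCons 0 (chebU c (Suc n)) - smult (2 * (c + 1)) (chebU c n) + pCons 0 (chebU_pred c n)
     = dickson c (Suc (Suc n)) - dickson c n"
proof (rule two_step_recursion_unique[where c = c])
  \<comment> \<open>With shifts and scalars written as factors of a commutative ring, the recursion
    is a plain ring identity.\<close>
  define X C where "X = [:0, 1::complex:]" and "C = [:c:]"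
  have X: "pCons 0 p = X * p" and C: "smult c p = C * p" "smult (2 * (c + 1)) p = 2 * (C + 1) * p" for p
    by (simp_all add: X_def C_def numeral_poly one_pCons algebra_simps)
  fix n
  show "pCons 0 (chebU c (Suc (Suc (Suc n)))) - smult (2 * (c + 1)) (chebU c (Suc (Suc n)))
      + pCons 0 (chebU_pred c (Suc (Suc n))) =
    pCons 0 (pCons 0 (chebU c (Suc (Suc n))) - smult (2 * (c + 1)) (chebU c (Suc n))
      + pCons 0 (chebU_pred c (Suc n)))
    - smult c (pCons 0 (chebU c (Suc n)) - smult (2 * (c + 1)) (chebU c n)
      + pCons 0 (chebU_pred c n))"
    unfolding chebU.simps(3)[of c "Suc n"] chebU.simps(3)[of c n] chebU_pred_rec X C
    by (simp add: algebra_simps del: chebU.simps dickson.simps)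
  show "dickson c (Suc (Suc (Suc (Suc n)))) - dickson c (Suc (Suc n)) =
    pCons 0 (dickson c (Suc (Suc (Suc n))) - dickson c (Suc n))
    - smult c (dickson c (Suc (Suc n)) - dickson c n)"
    unfolding dickson.simps(3)[of c "Suc (Suc n)"] dickson.simps(3)[of c n] X C
    by (simp add: algebra_simps del: chebU.simps dickson.simps)
qed (auto simp: one_pCons chebU_pred_def algebra_simps)

section \<open>Reduced closed paths expressed by polynomials in the adjacency operator\<close>

context regular_region
begin

text \<open>For a fixed last edge, \<open>nbv_rec\<close> is the recursion of \<open>chebU\<close>
  with X acting on the first vertex, and \<open>nbv_0\<close>, \<open>nbv_1\<close> are its initial
  values. The induction must range over all x, since X moves x to its neighbours.\<close>

lemma nbv_Suc:
  assumes "x \<in> S" "(z, w) \<in> E"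
  shows "nbv n x (z, w) = kern E (chebU r n) x z - kern E (chebU_pred r n) x w"
proof -
  have "x \<in> S \<Longrightarrow> nbv n x (z, w) = kern E (chebU r n) x z - kern E (chebU_pred r n) x w" for x
  proof (induction n arbitrary: x rule: less_induct)
    case (less n)
    consider "n = 0" | "n = Suc 0" | k where "n = Suc (Suc k)"
      by (metis not0_implies_Suc)
    then show ?case
    proof cases
      case 1
      then show ?thesis using nbv_0 less assms by (simp add: chebU_pred_def)
    next
      case 2
      have "kern E [:0, 1:] x z = of_nat (walks E (Suc 0) x z)"
        by (simp add: kern_def del: walks.simps)
      then show ?thesis using 2 nbv_1[OF less.prems assms(2)] walks_one[OF less.prems]
        by (simp add: chebU_pred_def del: walks.simps)
    next
      case 3
      have "nbr_sum E (\<lambda>y. nbv (Suc k) y (z, w)) x = nbr_sum E (\<lambda>y. kern E (chebU r (Suc k)) y z) x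
          - nbr_sum E (\<lambda>y. kern E (chebU_pred r (Suc k)) y w) x"
        unfolding nbr_sum_def sum_subtractf[symmetric]
        using 3 less closed by (intro sum.cong) auto
      then show ?thesis
        unfolding 3 nbv_rec[OF less.prems] chebU_pred_rec chebU.simps kern_diff kern_X_mult kern_smult
        by (simp add: less.prems less.IH[of k] 3 right_diff_distrib)
    qed
  qed
  then show ?thesis using assms by blast
qed

text \<open>\<open>nbw_Suc\<close> applied twice relates the loops of n + 2 steps at the edge (x, y)
  to those of n steps, up to values of \<open>nbv\<close> and hence of U. The value U_n(y, y) at a
  neighbour stems from a closed walk based at y, reached from x by a tail; comparing it with U_n(x,
  x) produces the Laplacian.\<close>

lemma loop_count_step:
  assumes x: "x \<in> S"
  defines "Q \<equiv> \<lambda>n. \<Sum>y | (x, y) \<in> E. complex_of_nat (nbw E n (x, y) (x, y))"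
  shows "Q (Suc (Suc n)) = Q n + kern E (dickson r (Suc (Suc n))) x x - kern E (dickson r n) x x
    - (\<Sum>y | (x, y) \<in> E. kern E (chebU r n) y y - kern E (chebU r n) x x)"
proof -
  let ?U = "chebU r" and ?V = "chebU_pred r" and ?N = "{y. (x, y) \<in> E}"
  have "complex_of_nat (nbw E (Suc (Suc n)) (x, y) (x, y)) =
      (kern E (?U (Suc n)) y x - kern E (?U n) y y) - (kern E (?U n) x x - kern E (?V n) y x)
      + of_nat (nbw E n (x, y) (x, y))"
    if y: "(x, y) \<in> E" for y
  proof -
    have yS: "y \<in> S" and yE: "(y, x) \<in> E" using y x closed edge_sym by auto
    have "complex_of_nat (nbw E (Suc (Suc n)) (x, y) (x, y)) =
      nbv (Suc n) y (x, y) - (nbv n x (x, y) - of_nat (nbw E n (x, y) (x, y)))"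
      using nbw_Suc[OF y x] nbw_Suc[OF yE yS] by (simp del: nbw.simps)
    then show ?thesis
      using nbv_Suc[OF yS y] nbv_Suc[OF x y] kern_commute[OF x yS]
      by (simp add: chebU_pred_def del: nbw.simps)
  qed
  then have "Q (Suc (Suc n)) =
      (\<Sum>y\<in>?N. (kern E (?U (Suc n)) y x - kern E (?U n) y y) - (kern E (?U n) x x - kern E (?V n) y x)
      + of_nat (nbw E n (x, y) (x, y)))"
    unfolding Q_def by (intro sum.cong) auto
  also have "\<dots> = Q n + kern E (pCons 0 (?U (Suc n))) x x + kern E (pCons 0 (?V n)) x x
      - (\<Sum>y\<in>?N. kern E (?U n) y y) - of_nat (r + 1) * kern E (?U n) x x"
    using deg[OF x] by (simp add: Q_def sum.distrib sum_subtractf kern_X_mult nbr_sum_def)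
  \<comment> \<open>Completing the Laplacian moves another (r + 1) U_n(x, x) into the main term,
    hence the factor 2 (r + 1) that \<open>dickson_step\<close> expects.\<close>
  also have "\<dots> = Q n + kern E (pCons 0 (?U (Suc n)) - smult (2 * (of_nat r + 1)) (?U n) + pCons 0 (?V n)) x x
      - (\<Sum>y\<in>?N. kern E (?U n) y y - kern E (?U n) x x)"
    unfolding kern_add kern_diff kern_smult
    using deg[OF x] by (simp add: sum_subtractf algebra_simps)
  finally show ?thesis
    unfolding dickson_step by (simp add: kern_diff)
qed

text \<open>\<open>loop_count_step\<close> is summed in steps of two. At n = 0 there are r + 1 edges
  against p_0 = 2, and this surplus r - 1 persists for all even n. At n = 1 both sides vanish, as
  the graph has no loops.\<close>

theorem reduced_closed_paths_count:
  assumes x: "x \<in> S" and "0 < n"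
  shows "of_nat (card (reduced_closed_paths E n x)) =
    kern E (dickson r n) x x + (if even n then of_nat r - 1 else 0)
    + (\<Sum>y | (x, y) \<in> E. kern E (chebU_sum r n) y y - kern E (chebU_sum r n) x x)"
proof -
  define Q where "Q n = (\<Sum>y | (x, y) \<in> E. complex_of_nat (nbw E n (x, y) (x, y)))" for n
  let ?F = "\<lambda>n. kern E (dickson r n) x x + (if even n then of_nat r - 1 else 0)
    + (\<Sum>y | (x, y) \<in> E. kern E (chebU_sum r n) y y - kern E (chebU_sum r n) x x)"
  have "Q n = ?F n \<and> Q (Suc n) = ?F (Suc n)"
  proof (induction n)
    case 0
    have "kern E [:2:] x x = 2"
      by (simp add: kern_def)
    moreover have "Q 0 = of_nat r + 1"
      using deg[OF x] by (simp add: Q_def)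
    moreover have "Q (Suc 0) = 0"
      unfolding Q_def
    proof (rule sum.neutral, safe)
      fix y assume y: "(x, y) \<in> E"
      then have "y \<in> S" "x \<noteq> y" using x closed irreflE by (auto simp: irrefl_def)
      then show "complex_of_nat (nbw E (Suc 0) (x, y) (x, y)) = 0"
        using nbw_Suc[OF y x, of 0 "(x, y)"] nbv_0[of y x y] y by simp
    qed
    moreover have "kern E [:0, 1:] x x = 0"
      using walks_one[OF x] irreflE
      by (simp add: kern_def irrefl_def del: walks.simps)
    ultimately show ?case by simp
  next
    case (Suc n)
    have "Q (Suc (Suc n)) = ?F (Suc (Suc n))"
      unfolding loop_count_step[OF x, of n, folded Q_def] conjunct1[OF Suc]
      by (simp add: kern_diff sum_subtractf algebra_simps sum.distrib del: dickson.simps)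
    then show ?case using Suc by blast
  qed
  then show ?thesis
    using card_reduced_closed_paths[OF assms] by (simp add: Q_def)
qed

end

section \<open>Power series in the adjacency operator\<close>

lemma ell2_outside: "f \<in> ell2 S \<Longrightarrow> x \<notin> S \<Longrightarrow> f x = 0"
  by (auto simp: ell2_def)

lemma ell2_norm_nonneg: "0 \<le> ell2_norm S f"
  by (simp add: ell2_norm_def infsum_nonneg)

lemma ell2_finite_sum_le:
  assumes "f \<in> ell2 S" "finite F" "F \<subseteq> S"
  shows "L2_set (\<lambda>x. norm (f x)) F \<le> ell2_norm S f"
  using assms unfolding L2_set_def ell2_norm_def
  by (intro real_sqrt_le_mono finite_sum_le_infsum) (auto simp: ell2_def)

lemma ell2_norm_point_le: "f \<in> ell2 S \<Longrightarrow> norm (f x) \<le> ell2_norm S f"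
  using ell2_finite_sum_le[of f S "{x}"] ell2_outside[of f S x] ell2_norm_nonneg[of S f]
  by (cases "x \<in> S") (auto simp: L2_set_def)

text \<open>Finite subsets decide both membership and the norm, so the operator estimates below
  concern finite sums only.\<close>

lemma ell2_boundI:
  assumes "\<And>x. x \<notin> S \<Longrightarrow> g x = 0" "0 \<le> B"
    and "\<And>F. finite F \<Longrightarrow> F \<subseteq> S \<Longrightarrow> L2_set (\<lambda>x. norm (g x)) F \<le> B"
  shows "g \<in> ell2 S" "ell2_norm S g \<le> B"
proof -
  have le: "(\<Sum>x\<in>F. (norm (g x))\<^sup>2) \<le> B\<^sup>2" if "finite F" "F \<subseteq> S" for F
    using assms(3)[OF that] unfolding L2_set_def by (rule sqrt_le_D)
  have summ: "(\<lambda>x. (norm (g x))\<^sup>2) summable_on S"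
    using le by (intro nonneg_bdd_above_summable_on) (auto simp: bdd_above_def)
  then show "g \<in> ell2 S"
    using assms(1) by (auto simp: ell2_def)
  have "(\<Sum>\<^sub>\<infinity>x\<in>S. (norm (g x))\<^sup>2) \<le> B\<^sup>2"
    using summ le by (rule infsum_le_finite_sums)
  then show "ell2_norm S g \<le> B"
    unfolding ell2_norm_def using assms(2) real_le_lsqrt by (simp add: real_sqrt_le_iff real_le_lsqrt infsum_nonneg)
qed

lemma operator_norm_le:
  assumes "0 \<le> C" "\<And>f. f \<in> ell2 S \<Longrightarrow> ell2_norm S (T f) \<le> C * ell2_norm S f"
  shows "operator_norm S T \<le> C"
  unfolding operator_norm_def using assms by (intro cInf_lower bdd_belowI[of _ 0]) auto

lemma operator_norm_zero:
  assumes "\<And>f. f \<in> ell2 S \<Longrightarrow> T f = (\<lambda>_. 0)"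
  shows "operator_norm S T \<le> 0"
  by (rule operator_norm_le) (auto simp: assms ell2_norm_def)

lemma ell2_delta_mem: "x \<in> S \<Longrightarrow> ell2_delta x \<in> ell2 S"
  by (rule ell2_boundI(1)[where B = 1])
     (auto simp: ell2_delta_def L2_set_def if_distrib[of norm] if_distrib[of "\<lambda>z. z\<^sup>2"] cong: if_cong)

lemma ell2_inner_delta:
  assumes "x \<in> S"
  shows "ell2_inner S (ell2_delta x) f = f x"
proof -
  have "ell2_inner S (ell2_delta x) f = (\<Sum>\<^sub>\<infinity>y\<in>{x}. f y)"
    unfolding ell2_inner_def using assms by (intro infsum_cong_neutral) (auto simp: ell2_delta_def)
  then show ?thesis by simp
qed

lemma ell2_inner_summable:
  assumes "f \<in> ell2 S" "h \<in> ell2 S"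
  shows "(\<lambda>x. norm (cnj (h x) * f x)) summable_on S"
proof (rule summable_on_comparison_test)
  show "(\<lambda>x. (norm (f x))\<^sup>2 + (norm (h x))\<^sup>2) summable_on S"
    using assms by (intro summable_on_add) (auto simp: ell2_def)
  show "norm (cnj (h x) * f x) \<le> (norm (f x))\<^sup>2 + (norm (h x))\<^sup>2" for x
  proof -
    have "0 \<le> norm (h x) * norm (f x)"
      by simp
    moreover have "2 * (norm (h x) * norm (f x)) \<le> (norm (f x))\<^sup>2 + (norm (h x))\<^sup>2"
      using sum_squares_bound[of "norm (f x)" "norm (h x)"] by (simp add: ac_simps)
    ultimately show ?thesis
      unfolding norm_mult complex_mod_cnj by linarith
  qed
qed auto

section \<open>Bounds and resolvents for the adjacency operator on one region\<close>

definition adj_op :: "('v \<times> 'v) set \<Rightarrow> 'v set \<Rightarrow> 'v operator" where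
  "adj_op E S f x = (if x \<in> S then nbr_sum E f x else 0)"

text \<open>Formed pointwise. One construction serves both for polynomials, with finitely many
  coefficients, and for the Neumann series of a resolvent.\<close>

definition series_op :: "('v \<times> 'v) set \<Rightarrow> 'v set \<Rightarrow> (nat \<Rightarrow> complex) \<Rightarrow> 'v operator" where
  "series_op E S a f x = (\<Sum>k. a k * (adj_op E S ^^ k) f x)"

lemma adj_op_linear:
  "adj_op E S (\<lambda>x. a * f x + b * h x) = (\<lambda>x. a * adj_op E S f x + b * adj_op E S h x)"
  by (auto simp: adj_op_def nbr_sum_def sum.distrib sum_distrib_left)

lemma adj_op_funpow_linear:
  "(adj_op E S ^^ k) (\<lambda>x. a * f x + b * h x)
     = (\<lambda>x. a * (adj_op E S ^^ k) f x + b * (adj_op E S ^^ k) h x)"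
  by (induction k) (simp_all add: adj_op_linear)

lemma adj_op_funpow_outside: "(\<And>x. x \<notin> S \<Longrightarrow> f x = 0) \<Longrightarrow> x \<notin> S \<Longrightarrow> (adj_op E S ^^ k) f x = 0"
  by (cases k) (auto simp: adj_op_def)

context bounded_region
begin

lemma adj_op_funpow_delta:
  "x \<in> S \<Longrightarrow> (adj_op E S ^^ k) (ell2_delta y) x = of_nat (walks E k x y)"
proof (induction k arbitrary: x)
  case 0
  then show ?case by (auto simp: ell2_delta_def)
next
  case (Suc k)
  then show ?case using closed by (auto simp: adj_op_def nbr_sum_def intro!: sum.cong)
qed

text \<open>Cauchy-Schwarz over the at most D neighbours of x gives one factor D. Exchanging the
  sums gives the other, because by symmetry y is a neighbour of at most D points.\<close>

lemma adj_op_ell2: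
  assumes f: "f \<in> ell2 S"
  shows "adj_op E S f \<in> ell2 S" "ell2_norm S (adj_op E S f) \<le> D * ell2_norm S f"
proof -
  have "L2_set (\<lambda>x. norm (adj_op E S f x)) F \<le> D * ell2_norm S f"
    if F: "finite F" "F \<subseteq> S" for F
  proof -
    define N where "N x = {y. (x, y) \<in> E}" for x
    have N: "finite (N x)" "card (N x) \<le> D" "N x \<subseteq> S" if "x \<in> S" for x
      using fin deg_le closed that by (auto simp: N_def)
    have sq: "(norm (adj_op E S f x))\<^sup>2 \<le> D * (\<Sum>y\<in>N x. (norm (f y))\<^sup>2)" if "x \<in> F" for x
    proof -
      have x: "x \<in> S" using that F by auto
      have "(norm (adj_op E S f x))\<^sup>2 \<le> (\<Sum>y\<in>N x. norm (f y))\<^sup>2"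
        using x by (auto simp: adj_op_def nbr_sum_def N_def intro!: power_mono norm_sum)
      also have "\<dots> = (\<Sum>y\<in>N x. 1 * norm (f y))\<^sup>2" by simp
      also have "\<dots> \<le> (\<Sum>y\<in>N x. 1\<^sup>2) * (\<Sum>y\<in>N x. (norm (f y))\<^sup>2)"
        by (rule Cauchy_Schwarz_ineq_sum)
      also have "\<dots> \<le> D * (\<Sum>y\<in>N x. (norm (f y))\<^sup>2)"
        using N[OF x] by (intro mult_right_mono) (auto simp: sum_nonneg)
      finally show ?thesis .
    qed
    \<comment> \<open>A finite set containing every neighbourhood involved, so that the double sum
      has a rectangular index set.\<close>
    define U where "U = (\<Union>x\<in>F. N x)"
    have U: "finite U" "U \<subseteq> S" using N F by (auto simp: U_def)
    have "(\<Sum>x\<in>F. (norm (adj_op E S f x))\<^sup>2) \<le> (\<Sum>x\<in>F. D * (\<Sum>y\<in>N x. (norm (f y))\<^sup>2))"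
      by (intro sum_mono sq)
    also have "\<dots> = D * (\<Sum>x\<in>F. \<Sum>y\<in>U. if y \<in> N x then (norm (f y))\<^sup>2 else 0)"
    proof -
      have "(\<Sum>y\<in>N x. (norm (f y))\<^sup>2) = (\<Sum>y\<in>U. if y \<in> N x then (norm (f y))\<^sup>2 else 0)"
        if "x \<in> F" for x
      proof -
        have "U \<inter> N x = N x" using that by (auto simp: U_def)
        then show ?thesis using sum.inter_restrict[OF U(1), of _ "N x"] by metis
      qed
      then show ?thesis by (simp add: sum_distrib_left)
    qed
    also have "\<dots> = D * (\<Sum>y\<in>U. \<Sum>x\<in>F. if y \<in> N x then (norm (f y))\<^sup>2 else 0)"
      by (subst sum.swap) simp
    also have "\<dots> = D * (\<Sum>y\<in>U. card (F \<inter> {x. y \<in> N x}) * (norm (f y))\<^sup>2)"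
      using F by (simp add: sum.If_cases)
    also have "\<dots> \<le> D * (\<Sum>y\<in>U. D * (norm (f y))\<^sup>2)"
    proof (intro mult_left_mono sum_mono mult_right_mono)
      fix y assume "y \<in> U"
      then have y: "y \<in> S" using U by auto
      have "card (F \<inter> {x. y \<in> N x}) \<le> card (N y)"
        using N[OF y] symE by (intro card_mono) (auto simp: N_def dest: symD)
      then show "real (card (F \<inter> {x. y \<in> N x})) \<le> real D"
        using N(2)[OF y] by simp
    qed auto
    also have "\<dots> = (D * L2_set (\<lambda>x. norm (f x)) U)\<^sup>2"
      by (simp add: L2_set_def sum_nonneg power_mult_distrib sum_distrib_left[symmetric])
        (simp add: power2_eq_square)
    also have "\<dots> \<le> (D * ell2_norm S f)\<^sup>2"
      by (intro power_mono mult_left_mono ell2_finite_sum_le f U) (auto simp: L2_set_nonneg)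
    finally show ?thesis
      unfolding L2_set_def using ell2_norm_nonneg[of S f] by (intro real_le_lsqrt) (auto simp: sum_nonneg)
  qed
  then show "adj_op E S f \<in> ell2 S" "ell2_norm S (adj_op E S f) \<le> D * ell2_norm S f"
    using ell2_norm_nonneg[of S f]
    by (auto intro!: ell2_boundI[where B = "D * ell2_norm S f"] simp: adj_op_def)
qed

lemma adj_op_funpow_ell2:
  assumes f: "f \<in> ell2 S"
  shows "(adj_op E S ^^ k) f \<in> ell2 S \<and> ell2_norm S ((adj_op E S ^^ k) f) \<le> D ^ k * ell2_norm S f"
proof (induction k)
  case 0
  then show ?case using f by simp
next
  case (Suc k)
  have "ell2_norm S ((adj_op E S ^^ Suc k) f) \<le> D * ell2_norm S ((adj_op E S ^^ k) f)"
    using Suc adj_op_ell2(2) by simp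
  also have "\<dots> \<le> D * (D ^ k * ell2_norm S f)"
    using Suc by (intro mult_left_mono) auto
  finally show ?case using Suc adj_op_ell2(1) by (simp add: mult.assoc)
qed

lemma series_op_summable:
  assumes a: "summable (\<lambda>k. norm (a k) * D ^ k)" and f: "f \<in> ell2 S"
  shows "summable (\<lambda>k. norm (a k * (adj_op E S ^^ k) f x))"
proof (rule summable_comparison_test')
  show "summable (\<lambda>k. norm (a k) * D ^ k * ell2_norm S f)"
    using a by (rule summable_mult2)
  show "norm (norm (a k * (adj_op E S ^^ k) f x)) \<le> norm (a k) * D ^ k * ell2_norm S f" for k
    using order_trans[OF ell2_norm_point_le[of _ S x] conjunct2[OF adj_op_funpow_ell2[OF f, of k]]]
      adj_op_funpow_ell2[OF f, of k]
    by (simp add: norm_mult mult.assoc mult_left_mono)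
qed

text \<open>On a finite set the partial sums obey the triangle inequality for \<open>L2_set\<close>,
  with a bound independent of the set; pointwise convergence then suffices for the limit.\<close>

lemma series_op_ell2:
  assumes a: "summable (\<lambda>k. norm (a k) * D ^ k)" and f: "f \<in> ell2 S"
  shows "series_op E S a f \<in> ell2 S"
    "ell2_norm S (series_op E S a f) \<le> (\<Sum>k. norm (a k) * D ^ k) * ell2_norm S f"
proof -
  let ?C = "\<Sum>k. norm (a k) * D ^ k"
  have C: "0 \<le> ?C" using a by (intro suminf_nonneg) auto
  have "L2_set (\<lambda>x. norm (series_op E S a f x)) F \<le> ?C * ell2_norm S f"
    if F: "finite F" "F \<subseteq> S" for F
  proof (rule LIMSEQ_le_const2)
    let ?s = "\<lambda>n x. \<Sum>k<n. a k * (adj_op E S ^^ k) f x"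
    have "(\<lambda>n. ?s n x) \<longlonglongrightarrow> series_op E S a f x" for x
      unfolding series_op_def
      using summable_norm_cancel[OF series_op_summable[OF assms]] by (rule summable_LIMSEQ)
    then show "(\<lambda>n. L2_set (\<lambda>x. norm (?s n x)) F) \<longlonglongrightarrow> L2_set (\<lambda>x. norm (series_op E S a f x)) F"
      unfolding L2_set_def by (intro tendsto_intros)
    have "L2_set (\<lambda>x. norm (?s n x)) F \<le> (\<Sum>k<n. norm (a k) * D ^ k) * ell2_norm S f" for n
    proof (induction n)
      case 0
      then show ?case by (simp add: L2_set_def)
    next
      case (Suc n)
      let ?g = "(adj_op E S ^^ n) f"
      have "L2_set (\<lambda>x. norm (?s (Suc n) x)) F
          \<le> L2_set (\<lambda>x. norm (?s n x) + norm (a n) * norm (?g x)) F"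
        by (intro L2_set_mono) (auto intro: order_trans[OF norm_triangle_ineq] simp: norm_mult)
      also have "\<dots> \<le> L2_set (\<lambda>x. norm (?s n x)) F + L2_set (\<lambda>x. norm (a n) * norm (?g x)) F"
        by (rule L2_set_triangle_ineq)
      also have "L2_set (\<lambda>x. norm (a n) * norm (?g x)) F = norm (a n) * L2_set (\<lambda>x. norm (?g x)) F"
        by (simp add: L2_set_right_distrib)
      also have "\<dots> \<le> norm (a n) * (D ^ n * ell2_norm S f)"
        using adj_op_funpow_ell2[OF f, of n] ell2_finite_sum_le[OF _ F, of ?g]
        by (intro mult_left_mono) auto
      finally show ?case using Suc by (simp add: algebra_simps)
    qed
    moreover have "(\<Sum>k<n. norm (a k) * D ^ k) * ell2_norm S f \<le> ?C * ell2_norm S f" for n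
      using a ell2_norm_nonneg[of S f] by (intro mult_right_mono sum_le_suminf) auto
    ultimately show "\<exists>N. \<forall>n\<ge>N. L2_set (\<lambda>x. norm (?s n x)) F \<le> ?C * ell2_norm S f"
      using order_trans by blast
  qed
  moreover have "series_op E S a f x = 0" if "x \<notin> S" for x
    using adj_op_funpow_outside[OF ell2_outside[OF f] that] by (simp add: series_op_def)
  ultimately show "series_op E S a f \<in> ell2 S"
    "ell2_norm S (series_op E S a f) \<le> ?C * ell2_norm S f"
    using mult_nonneg_nonneg[OF C ell2_norm_nonneg[of S f]]
      ell2_boundI[of S "series_op E S a f" "?C * ell2_norm S f"] by blast+
qed

lemma series_op_linear:
  assumes a: "summable (\<lambda>k. norm (a k) * D ^ k)" and f: "f \<in> ell2 S" and h: "h \<in> ell2 S"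
  shows "series_op E S a (\<lambda>x. b * f x + c * h x) =
    (\<lambda>x. b * series_op E S a f x + c * series_op E S a h x)"
proof
  fix x
  note s = summable_norm_cancel[OF series_op_summable[OF a f, of x]]
    summable_norm_cancel[OF series_op_summable[OF a h, of x]]
  show "series_op E S a (\<lambda>x. b * f x + c * h x) x =
    b * series_op E S a f x + c * series_op E S a h x"
    using sums_add[OF sums_mult[OF summable_sums[OF s(1)], of b] sums_mult[OF summable_sums[OF s(2)], of c]]
    unfolding series_op_def adj_op_funpow_linear
    by (intro sums_unique[symmetric]) (simp only: distrib_left mult.left_commute)
qed

lemma bounded_operator_series_op:
  assumes a: "summable (\<lambda>k. norm (a k) * D ^ k)"
  shows "bounded_operator S (series_op E S a)"
  unfolding bounded_operator_def
  using series_op_ell2[OF a] series_op_linear[OF a] by blast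

lemma operator_norm_series_op:
  assumes a: "summable (\<lambda>k. norm (a k) * D ^ k)"
  shows "operator_norm S (series_op E S a) \<le> (\<Sum>k. norm (a k) * D ^ k)"
  using series_op_ell2[OF a] a by (intro operator_norm_le suminf_nonneg) auto

lemma adj_op_series_op:
  assumes a: "summable (\<lambda>k. norm (a k) * D ^ k)" and f: "f \<in> ell2 S"
  shows "adj_op E S (series_op E S a f) x = (\<Sum>k. a k * (adj_op E S ^^ Suc k) f x)"
    "series_op E S a (adj_op E S f) x = (\<Sum>k. a k * (adj_op E S ^^ Suc k) f x)"
proof -
  note s = summable_norm_cancel[OF series_op_summable[OF a f]]
  show "adj_op E S (series_op E S a f) x = (\<Sum>k. a k * (adj_op E S ^^ Suc k) f x)"
  proof (cases "x \<in> S")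
    case True
    have "adj_op E S (series_op E S a f) x
        = (\<Sum>y | (x, y) \<in> E. \<Sum>k. a k * (adj_op E S ^^ k) f y)"
      using True by (simp add: adj_op_def nbr_sum_def series_op_def)
    also have "\<dots> = (\<Sum>k. \<Sum>y | (x, y) \<in> E. a k * (adj_op E S ^^ k) f y)"
      by (rule suminf_sum[symmetric]) (rule s)
    also have "\<dots> = (\<Sum>k. a k * (adj_op E S ^^ Suc k) f x)"
      using True by (simp only: funpow.simps comp_def adj_op_def[of E S _ x] nbr_sum_def sum_distrib_left if_True)
    finally show ?thesis .
  qed (simp add: adj_op_def)
  show "series_op E S a (adj_op E S f) x = (\<Sum>k. a k * (adj_op E S ^^ Suc k) f x)"
    unfolding series_op_def funpow_Suc_right comp_def ..
qed

text \<open>The Neumann series of the inverse of A - z, namely the negative sum of A^k / z^(k+1),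
  which converges because A has norm at most D < |z|.\<close>

lemma resolvent_series_op:
  assumes z: "real D < norm z" and f: "f \<in> ell2 S"
  defines "a \<equiv> \<lambda>k. - 1 / z ^ Suc k"
  shows "summable (\<lambda>k. norm (a k) * D ^ k)"
    "adj_op E S (series_op E S a f) x - z * series_op E S a f x = f x"
    "series_op E S a (\<lambda>x. adj_op E S f x - z * f x) x = f x"
proof -
  have z0: "z \<noteq> 0" using z by auto
  have "summable (\<lambda>k. (1 / norm z) * (D / norm z) ^ k)"
    by (rule summable_mult, rule summable_geometric)
      (use z z0 in \<open>simp add: divide_less_eq del: zero_less_norm_iff\<close>)
  moreover have "(1 / norm z) * (D / norm z) ^ k = norm (a k) * D ^ k" for k
    by (simp add: a_def norm_divide norm_mult norm_power power_divide)
  ultimately show a: "summable (\<lambda>k. norm (a k) * D ^ k)"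
    by (simp only:)
  \<comment> \<open>Applying A and multiplying by z yield the negative of this series, the first
    shifted by one index; in their difference only the term f x of index 0 survives.\<close>
  let ?t = "\<lambda>k. (adj_op E S ^^ k) f x / z ^ k"
  have sm: "summable (\<lambda>k. a k * (adj_op E S ^^ k) f x)"
    using summable_norm_cancel[OF series_op_summable[OF a f]] .
  have "summable (\<lambda>k. - z * (a k * (adj_op E S ^^ k) f x))"
    using sm by (rule summable_mult)
  moreover have "- z * (a k * (adj_op E S ^^ k) f x) = ?t k" for k
    using z0 by (simp add: a_def)
  ultimately have t: "summable ?t" by simp
  have t1: "(\<Sum>k. a k * (adj_op E S ^^ Suc k) f x) = - (\<Sum>k. ?t (Suc k))"
  proof -
    have "(\<Sum>k. a k * (adj_op E S ^^ Suc k) f x) = (\<Sum>k. - ?t (Suc k))"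
      by (simp add: a_def)
    also have "\<dots> = - (\<Sum>k. ?t (Suc k))"
      by (rule suminf_minus) (use t summable_Suc_iff[of ?t] in blast)
    finally show ?thesis .
  qed
  have t2: "z * series_op E S a f x = - (\<Sum>k. ?t k)"
  proof -
    have "z * series_op E S a f x = (\<Sum>k. z * (a k * (adj_op E S ^^ k) f x))"
      unfolding series_op_def by (rule suminf_mult[OF sm, symmetric])
    also have "\<dots> = (\<Sum>k. - ?t k)"
      using z0 by (simp add: a_def)
    also have "\<dots> = - (\<Sum>k. ?t k)"
      by (rule suminf_minus[OF t])
    finally show ?thesis .
  qed
  have t3: "(\<Sum>k. ?t k) = (\<Sum>k. ?t (Suc k)) + f x"
    using suminf_split_head[OF t] by simp
  show eq: "adj_op E S (series_op E S a f) x - z * series_op E S a f x = f x"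
    unfolding adj_op_series_op(1)[OF a f] t1 t2 t3 by simp
  have "series_op E S a (\<lambda>x. adj_op E S f x - z * f x) =
      series_op E S a (\<lambda>x. 1 * adj_op E S f x + (- z) * f x)"
    by simp
  then show "series_op E S a (\<lambda>x. adj_op E S f x - z * f x) x = f x"
    unfolding series_op_linear[OF a adj_op_ell2(1)[OF f] f]
    using eq adj_op_series_op[OF a f] by simp
qed

end

section \<open>Mixtures and sums over fibers\<close>

text \<open>Counting measures on fibres may be infinite, so the bind of the Giry monad, made for
  subprobability kernels, cannot represent \<open>mixture\<close> here.\<close>

locale kernel =
  fixes m :: "'a measure" and K :: "'a \<Rightarrow> 'b measure" and N :: "'b measure"
  assumes sets_K: "\<And>\<omega>. \<omega> \<in> space m \<Longrightarrow> sets (K \<omega>) = sets N"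
    and emeasure_K: "\<And>B. B \<in> sets N \<Longrightarrow> (\<lambda>\<omega>. emeasure (K \<omega>) B) \<in> borel_measurable m"
begin

lemma space_mixture [simp]: "space (mixture m K N) = space N"
  and sets_mixture [simp, measurable_cong]: "sets (mixture m K N) = sets N"
  by (simp_all add: mixture_def sets.space_closed)

lemma emeasure_mixture:
  assumes "B \<in> sets N"
  shows "emeasure (mixture m K N) B = (\<integral>\<^sup>+\<omega>. emeasure (K \<omega>) B \<partial>m)"
  unfolding mixture_def
proof (rule emeasure_measure_of[where \<mu> = "\<lambda>B. \<integral>\<^sup>+\<omega>. emeasure (K \<omega>) B \<partial>m"])
  show "countably_additive (sets (measure_of (space N) (sets N) (\<lambda>B. \<integral>\<^sup>+\<omega>. emeasure (K \<omega>) B \<partial>m)))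
     (\<lambda>B. \<integral>\<^sup>+\<omega>. emeasure (K \<omega>) B \<partial>m)"
  proof (rule countably_additiveI)
    fix A :: "nat \<Rightarrow> 'b set"
    assume A: "range A \<subseteq> sets (measure_of (space N) (sets N) (\<lambda>B. \<integral>\<^sup>+\<omega>. emeasure (K \<omega>) B \<partial>m))"
      "disjoint_family A"
    then have An: "A i \<in> sets N" for i
      by (auto simp: sets.space_closed)
    have "(\<Sum>i. \<integral>\<^sup>+\<omega>. emeasure (K \<omega>) (A i) \<partial>m) = (\<integral>\<^sup>+\<omega>. (\<Sum>i. emeasure (K \<omega>) (A i)) \<partial>m)"
      by (rule nn_integral_suminf[symmetric]) (rule emeasure_K[OF An])
    also have "\<dots> = (\<integral>\<^sup>+\<omega>. emeasure (K \<omega>) (\<Union>i. A i) \<partial>m)"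
      using A An sets_K by (intro nn_integral_cong suminf_emeasure) auto
    finally show "(\<Sum>i. \<integral>\<^sup>+\<omega>. emeasure (K \<omega>) (A i) \<partial>m) = (\<integral>\<^sup>+\<omega>. emeasure (K \<omega>) (\<Union>i. A i) \<partial>m)" .
  qed
qed (use assms in \<open>auto simp: positive_def dest: sets.sets_into_space\<close>)

text \<open>Measurability of the inner integral and the formula go through one induction, since
  additivity and monotone convergence of the outer integral use the measurability already obtained
  for the parts.\<close>

lemma nn_integral_kernel:
  assumes "f \<in> borel_measurable N"
  shows "(\<lambda>\<omega>. \<integral>\<^sup>+x. f x \<partial>K \<omega>) \<in> borel_measurable m \<and>
    (\<integral>\<^sup>+x. f x \<partial>mixture m K N) = (\<integral>\<^sup>+\<omega>. \<integral>\<^sup>+x. f x \<partial>K \<omega> \<partial>m)"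
  using assms
proof (induction rule: borel_measurable_induct)
  case (cong f g)
  have "(\<integral>\<^sup>+x. f x \<partial>K \<omega>) = (\<integral>\<^sup>+x. g x \<partial>K \<omega>)" if "\<omega> \<in> space m" for \<omega>
    using cong(3) sets_eq_imp_space_eq[OF sets_K[OF that]] by (intro nn_integral_cong) auto
  moreover have "(\<integral>\<^sup>+x. f x \<partial>mixture m K N) = (\<integral>\<^sup>+x. g x \<partial>mixture m K N)"
    using cong(3) by (intro nn_integral_cong) auto
  ultimately show ?case
    using cong(4) by (simp cong: measurable_cong nn_integral_cong)
next
  case (set A)
  have eq: "(\<integral>\<^sup>+x. indicator A x \<partial>K \<omega>) = emeasure (K \<omega>) A" if "\<omega> \<in> space m" for \<omega>
    using set sets_K[OF that] by (intro nn_integral_indicator) auto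
  have "(\<lambda>\<omega>. \<integral>\<^sup>+x. indicator A x \<partial>K \<omega>) \<in> borel_measurable m"
    using emeasure_K[OF set] by (subst measurable_cong[OF eq]) auto
  moreover have "(\<integral>\<^sup>+x. indicator A x \<partial>mixture m K N) = (\<integral>\<^sup>+\<omega>. emeasure (K \<omega>) A \<partial>m)"
    using set emeasure_mixture by simp
  moreover have "(\<integral>\<^sup>+\<omega>. \<integral>\<^sup>+x. indicator A x \<partial>K \<omega> \<partial>m) = (\<integral>\<^sup>+\<omega>. emeasure (K \<omega>) A \<partial>m)"
    by (intro nn_integral_cong eq)
  ultimately show ?case
    by simp
next
  case (mult u c)
  have eq: "(\<integral>\<^sup>+x. c * u x \<partial>K \<omega>) = c * (\<integral>\<^sup>+x. u x \<partial>K \<omega>)" if "\<omega> \<in> space m" for \<omega>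
    using mult(2) sets_K[OF that] by (intro nn_integral_cmult) (simp cong: measurable_cong_sets)
  have "(\<lambda>\<omega>. \<integral>\<^sup>+x. c * u x \<partial>K \<omega>) \<in> borel_measurable m"
    using mult by (subst measurable_cong[OF eq]) auto
  moreover have "(\<integral>\<^sup>+x. c * u x \<partial>mixture m K N) = c * (\<integral>\<^sup>+x. u x \<partial>mixture m K N)"
    using mult(2) by (intro nn_integral_cmult) simp
  moreover have "(\<integral>\<^sup>+\<omega>. \<integral>\<^sup>+x. c * u x \<partial>K \<omega> \<partial>m) = (\<integral>\<^sup>+\<omega>. c * (\<integral>\<^sup>+x. u x \<partial>K \<omega>) \<partial>m)"
    by (intro nn_integral_cong eq)
  ultimately show ?case
    using mult by (simp add: nn_integral_cmult)
next
  case (add u v)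
  have eq: "(\<integral>\<^sup>+x. v x + u x \<partial>K \<omega>) = (\<integral>\<^sup>+x. v x \<partial>K \<omega>) + (\<integral>\<^sup>+x. u x \<partial>K \<omega>)" if "\<omega> \<in> space m" for \<omega>
    using add sets_K[OF that] by (intro nn_integral_add) (simp_all cong: measurable_cong_sets)
  have "(\<lambda>\<omega>. \<integral>\<^sup>+x. v x + u x \<partial>K \<omega>) \<in> borel_measurable m"
    using add by (subst measurable_cong[OF eq]) auto
  moreover have "(\<integral>\<^sup>+x. v x + u x \<partial>mixture m K N) =
      (\<integral>\<^sup>+x. v x \<partial>mixture m K N) + (\<integral>\<^sup>+x. u x \<partial>mixture m K N)"
    using add by (intro nn_integral_add) simp_all
  moreover have "(\<integral>\<^sup>+\<omega>. \<integral>\<^sup>+x. v x + u x \<partial>K \<omega> \<partial>m)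
      = (\<integral>\<^sup>+\<omega>. (\<integral>\<^sup>+x. v x \<partial>K \<omega>) + (\<integral>\<^sup>+x. u x \<partial>K \<omega>) \<partial>m)"
    by (intro nn_integral_cong eq)
  ultimately show ?case
    using add by (simp add: nn_integral_add)
next
  case (seq U)
  have eq: "(\<integral>\<^sup>+x. (SUP i. U i) x \<partial>K \<omega>) = (SUP i. \<integral>\<^sup>+x. U i x \<partial>K \<omega>)" if "\<omega> \<in> space m" for \<omega>
    using seq sets_K[OF that] unfolding SUP_apply
    by (intro nn_integral_monotone_convergence_SUP) (simp_all cong: measurable_cong_sets)
  have "(\<lambda>\<omega>. \<integral>\<^sup>+x. (SUP i. U i) x \<partial>K \<omega>) \<in> borel_measurable m"
    using seq by (subst measurable_cong[OF eq]) (auto intro!: borel_measurable_SUP)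
  moreover have "(\<integral>\<^sup>+x. (SUP i. U i) x \<partial>mixture m K N) = (SUP i. \<integral>\<^sup>+x. U i x \<partial>mixture m K N)"
    using seq unfolding SUP_apply by (intro nn_integral_monotone_convergence_SUP) simp_all
  moreover have "(\<integral>\<^sup>+\<omega>. (SUP i. \<integral>\<^sup>+x. U i x \<partial>K \<omega>) \<partial>m) = (SUP i. \<integral>\<^sup>+\<omega>. \<integral>\<^sup>+x. U i x \<partial>K \<omega> \<partial>m)"
    using seq by (intro nn_integral_monotone_convergence_SUP)
      (auto simp: incseq_def le_fun_def intro!: nn_integral_mono)
  moreover have "(\<integral>\<^sup>+\<omega>. \<integral>\<^sup>+x. (SUP i. U i) x \<partial>K \<omega> \<partial>m)
      = (\<integral>\<^sup>+\<omega>. (SUP i. \<integral>\<^sup>+x. U i x \<partial>K \<omega>) \<partial>m)"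
    by (intro nn_integral_cong eq)
  ultimately show ?case
    using seq by simp
qed

lemmas measurable_nn_integral_kernel = nn_integral_kernel[THEN conjunct1]
  and nn_integral_mixture = nn_integral_kernel[THEN conjunct2]

lemma AE_mixture:
  assumes "AE x in mixture m K N. P x"
  shows "AE \<omega> in m. AE x in K \<omega>. P x"
proof -
  obtain Z where Z: "Z \<in> sets N" "{x \<in> space N. \<not> P x} \<subseteq> Z" "emeasure (mixture m K N) Z = 0"
    using assms by (auto elim!: AE_E)
  have "AE \<omega> in m. emeasure (K \<omega>) Z = 0"
    using Z emeasure_mixture[OF Z(1)] emeasure_K[OF Z(1)] by (simp add: nn_integral_0_iff_AE)
  moreover have "AE x in K \<omega>. P x" if "emeasure (K \<omega>) Z = 0" "\<omega> \<in> space m" for \<omega>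
    using that Z sets_K[OF that(2)] sets_eq_imp_space_eq[OF sets_K[OF that(2)]]
    by (intro AE_I[of _ _ Z]) simp_all
  ultimately show ?thesis
    by (rule_tac AE_mp[OF _ AE_I2]) auto
qed

lemma AE_mixtureI:
  assumes "AE \<omega> in m. AE x in K \<omega>. x \<notin> B" "B \<in> sets N"
  shows "AE x in mixture m K N. x \<notin> B"
proof -
  have "AE \<omega> in m. emeasure (K \<omega>) B = 0"
    using assms(1)
  proof (rule AE_mp, intro AE_I2 impI)
    fix \<omega> assume "\<omega> \<in> space m" "AE x in K \<omega>. x \<notin> B"
    then show "emeasure (K \<omega>) B = 0"
      using AE_iff_null_sets[of B "K \<omega>"] assms(2) sets_K[of \<omega>] by (simp add: null_setsD1)
  qed
  then have "emeasure (mixture m K N) B = 0"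
    using emeasure_mixture[OF assms(2)] emeasure_K[OF assms(2)] by (simp add: nn_integral_0_iff_AE)
  then show ?thesis
    using assms(2) by (intro AE_not_in) (auto simp: null_sets_def)
qed

end

section \<open>Sums over fibres as integrals\<close>

lemma nonneg_summable_on_iff_nn_integral:
  fixes f :: "'a \<Rightarrow> real"
  assumes "\<And>x. 0 \<le> f x"
  shows "f summable_on S \<longleftrightarrow> (\<integral>\<^sup>+x. ennreal (f x) \<partial>count_space S) < \<infinity>"
proof -
  have "f summable_on S \<longleftrightarrow> integrable (count_space S) f"
    using abs_summable_equivalent[of f S] assms by (simp add: abs_summable_on_def)
  then show ?thesis
    using assms by (simp add: integrable_iff_bounded)
qed

text \<open>A substitute for \<open>infsum\<close> whose dependence on the fibre is visibly
  measurable: it involves only sums of non-negative functions, about which the definition of a graph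
  over a groupoid speaks.\<close>

definition real_fiber_sum :: "'a set \<Rightarrow> ('a \<Rightarrow> real) \<Rightarrow> real" where
  "real_fiber_sum S f = enn2real (\<integral>\<^sup>+x. ennreal (f x) \<partial>count_space S)
     - enn2real (\<integral>\<^sup>+x. ennreal (- f x) \<partial>count_space S)"

lemma infsum_eq_real_fiber_sum:
  assumes "(\<lambda>x. norm (f x)) summable_on S"
  shows "infsum f S = real_fiber_sum S f"
proof -
  have f: "Infinite_Set_Sum.abs_summable_on f S"
    using assms abs_summable_equivalent by blast
  then have "infsum f S = (\<integral>x. f x \<partial>count_space S)"
    by (simp add: infsetsum_infsum[symmetric] infsetsum_def)
  also have "\<dots> = real_fiber_sum S f"
    using f by (subst real_lebesgue_integral_def) (auto simp: abs_summable_on_def real_fiber_sum_def)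
  finally show ?thesis .
qed

lemma infsum_eq_complex_fiber_sum:
  fixes f :: "'a \<Rightarrow> complex"
  assumes "(\<lambda>x. norm (f x)) summable_on S"
  shows "infsum f S = Complex (real_fiber_sum S (\<lambda>x. Re (f x))) (real_fiber_sum S (\<lambda>x. Im (f x)))"
proof -
  have f: "f summable_on S"
    using assms by (rule abs_summable_summable)
  have "(\<lambda>x. norm (Re (f x))) summable_on S" "(\<lambda>x. norm (Im (f x))) summable_on S"
    using assms by (auto intro: summable_on_comparison_test simp: abs_Re_le_cmod abs_Im_le_cmod)
  from this[THEN infsum_eq_real_fiber_sum] show ?thesis
    using infsum_Re[OF f] infsum_Im[OF f] by (simp add: complex_eq_iff)
qed

text \<open>The integrand of the trace is a fibrewise \<open>infsum\<close>, controlled only off a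
  null set of units. Over the completion it inherits measurability from a measurable
  representative.\<close>

lemma integral_completion_cong:
  fixes f g :: "'a \<Rightarrow> complex"
  assumes "g \<in> borel_measurable M" "AE x in M. f x = g x"
  shows "(\<integral>x. f x \<partial>completion M) = (\<integral>x. g x \<partial>M)"
proof -
  have g: "g \<in> borel_measurable (completion M)"
    using assms(1) by (rule measurable_completion)
  have ae: "AE x in completion M. f x = g x"
    using assms(2) by (rule AE_completion)
  have "f \<in> borel_measurable (completion M)"
  proof (rule measurableI)
    fix B :: "complex set" assume B: "B \<in> sets borel"
    show "f -` B \<inter> space (completion M) \<in> sets (completion M)"
    proof (rule completion.in_sets_AE)
      show "AE x in completion M. x \<in> g -` B \<inter> space (completion M) \<longleftrightarrow> x \<in> f -` B \<inter> space (completion M)"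
        by (rule AE_mp[OF ae AE_I2]) simp
      show "g -` B \<inter> space (completion M) \<in> sets (completion M)"
        using g B by (rule measurable_sets)
    qed blast
  qed simp
  then have "(\<integral>x. f x \<partial>completion M) = (\<integral>x. g x \<partial>completion M)"
    using g ae by (intro integral_cong_AE)
  then show ?thesis
    using assms(1) by (simp add: integral_completion)
qed

section \<open>Fibres and neighbourhoods in a measure graph\<close>

locale measured_graph =
  fixes \<G> :: "'g groupoid" and \<nu> :: "'g \<Rightarrow> 'g measure" and m :: "'g measure"
    and G :: "('g, 'v) ggraph"
  assumes measure_graph: "measure_graph \<G> \<nu> m G"
begin

abbreviation "V \<equiv> verts G"
abbreviation "E \<equiv> edges G"
abbreviation "\<Omega> \<equiv> unit_space \<G>"
abbreviation "Fib \<equiv> vfiber G"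
abbreviation "M \<equiv> vertex_measure m G"

lemma is_groupoid: "is_groupoid \<G>"
  and measurable_groupoid: "measurable_groupoid \<G>"
  and transversal: "transversal_function \<G> \<nu>"
  and invariant: "invariant_measure \<G> \<nu> m"
  and graph_over: "graph_over \<G> G"
  and measurable_graph: "measurable_graph V E"
  and graph: "graph (space V) E"
  using measure_graph
  by (auto simp: measure_graph_def measurable_groupoid_def graph_over_def measurable_graph_def)

lemma groupoid_closed:
  assumes "g \<in> space (arrows \<G>)"
  shows "ginv \<G> g \<in> space (arrows \<G>)" "rng \<G> g \<in> units \<G>" "src \<G> g \<in> units \<G>"
    "rng \<G> (ginv \<G> g) = src \<G> g" "src \<G> (ginv \<G> g) = rng \<G> g"
  using is_groupoid assms unfolding is_groupoid_def units_def by (auto, metis imageI)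

lemma units_arrows: "\<omega> \<in> units \<G> \<Longrightarrow> \<omega> \<in> space (arrows \<G>)"
  using is_groupoid unfolding is_groupoid_def units_def by auto

lemma space_unit_space [simp]: "space \<Omega> = units \<G>"
  using units_arrows by (auto simp: unit_space_def space_restrict_space)

lemma sets_m [measurable_cong]: "sets m = sets \<Omega>"
  using invariant by (simp add: invariant_measure_def)

lemma space_m [simp]: "space m = units \<G>"
  using sets_eq_imp_space_eq[OF sets_m] by simp

lemma measurable_proj [measurable]: "proj G \<in> measurable V \<Omega>"
  using graph_over by (simp add: graph_over_def)

lemma proj_units: "x \<in> space V \<Longrightarrow> proj G x \<in> units \<G>"
  using measurable_space[OF measurable_proj] by simp

lemma vfiber_iff: "x \<in> Fib \<omega> \<longleftrightarrow> x \<in> space V \<and> proj G x = \<omega>"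
  by (simp add: vfiber_def)

lemma countable_vfiber: "\<omega> \<in> units \<G> \<Longrightarrow> countable (Fib \<omega>)"
  using graph_over by (simp add: graph_over_def)

lemma edge_verts: "(x, y) \<in> E \<Longrightarrow> x \<in> space V \<and> y \<in> space V"
  and edge_sym: "(x, y) \<in> E \<longleftrightarrow> (y, x) \<in> E"
  and sym_edges: "sym E" and irrefl_edges: "irrefl E"
  using graph by (auto simp: graph_def dest: symD)

lemma proj_edge: "(x, y) \<in> E \<Longrightarrow> proj G x = proj G y"
  using graph_over by (auto simp: graph_over_def)

definition D :: nat where
  "D = (SOME D. degree_bound (space V) E D)"

lemma degree_bound: "degree_bound (space V) E D"
  unfolding D_def by (rule someI_ex) (use measurable_graph in \<open>auto simp: measurable_graph_def\<close>)

lemma finite_nbrs: "finite {y. (x, y) \<in> E}"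
proof (cases "x \<in> space V")
  case False
  then have "{y. (x, y) \<in> E} = {}" using edge_verts by auto
  then show ?thesis by simp
qed (use degree_bound in \<open>auto simp: degree_bound_def\<close>)

lemma region_space: "bounded_region E (space V) D"
  by unfold_locales (use sym_edges edge_verts finite_nbrs degree_bound in \<open>auto simp: degree_bound_def\<close>)

lemma region_fiber: "bounded_region E (Fib \<omega>) D"
proof -
  interpret bounded_region E "space V" D by (rule region_space)
  show ?thesis
    by unfold_locales (use symE fin deg_le edge_verts proj_edge in \<open>auto simp: vfiber_iff\<close>)
qed

text \<open>On \<open>count_space\<close> every function is measurable, so sums over a countable
  fibre can be interchanged with other integrals; fibre integrals are therefore moved there at
  once.\<close>

lemma nn_integral_fiber_count:
  assumes "f \<in> borel_measurable V"
  shows "(\<integral>\<^sup>+x. f x \<partial>fiber_count G \<omega>) = (\<integral>\<^sup>+x. f x \<partial>count_space (Fib \<omega>))"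
  unfolding fiber_count_def using assms
  by (intro nn_integral_distr) (auto simp: measurable_count_space_eq1 vfiber_iff)

lemma measurable_fiber_sum:
  assumes "f \<in> borel_measurable V"
  shows "(\<lambda>\<omega>. \<integral>\<^sup>+x. f x \<partial>count_space (Fib \<omega>)) \<in> borel_measurable \<Omega>"
  using graph_over assms by (simp add: graph_over_def nn_integral_fiber_count[OF assms, symmetric])

lemma measurable_fiber_sum_m:
  "f \<in> borel_measurable V \<Longrightarrow> (\<lambda>\<omega>. \<integral>\<^sup>+x. f x \<partial>count_space (Fib \<omega>)) \<in> borel_measurable m"
  using measurable_fiber_sum measurable_cong_sets[OF sets_m refl] by blast

sublocale fiber: kernel m "fiber_count G" V
proof
  fix B assume B: "B \<in> sets V"
  have "emeasure (fiber_count G \<omega>) B = (\<integral>\<^sup>+x. indicator B x \<partial>count_space (Fib \<omega>))" for \<omega>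
    using B nn_integral_fiber_count[of "indicator B"]
    by (subst nn_integral_indicator[symmetric]) (auto simp: fiber_count_def)
  then show "(\<lambda>\<omega>. emeasure (fiber_count G \<omega>) B) \<in> borel_measurable m"
    using B by (simp add: measurable_fiber_sum_m)
qed (simp add: fiber_count_def)

lemma space_M [simp]: "space M = space V"
  and sets_M [simp, measurable_cong]: "sets M = sets V"
  by (simp_all add: vertex_measure_def)

lemma nn_integral_M:
  assumes "f \<in> borel_measurable V"
  shows "(\<integral>\<^sup>+x. f x \<partial>M) = (\<integral>\<^sup>+\<omega>. \<integral>\<^sup>+x. f x \<partial>count_space (Fib \<omega>) \<partial>m)"
  unfolding vertex_measure_def fiber.nn_integral_mixture[OF assms] nn_integral_fiber_count[OF assms] ..

text \<open>Counting measure charges every point, so a property that holds almost everywhere for M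
  holds at every vertex of almost every fibre.\<close>

lemma AE_fiber:
  assumes "AE x in M. P x"
  shows "AE \<omega> in m. \<forall>x\<in>Fib \<omega>. P x"
proof -
  obtain Z where Z: "Z \<in> sets V" "{x \<in> space V. \<not> P x} \<subseteq> Z" "emeasure M Z = 0"
    using assms by (auto elim!: AE_E)
  have "(\<integral>\<^sup>+\<omega>. \<integral>\<^sup>+x. indicator Z x \<partial>count_space (Fib \<omega>) \<partial>m) = 0"
    using Z nn_integral_M[of "indicator Z"] by simp
  then have "AE \<omega> in m. (\<integral>\<^sup>+x. indicator Z x \<partial>count_space (Fib \<omega>)) = 0"
    using measurable_fiber_sum_m[of "indicator Z"] Z by (subst (asm) nn_integral_0_iff_AE) auto
  then show ?thesis
  proof (rule AE_mp, intro AE_I2 impI ballI)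
    fix \<omega> x
    assume "(\<integral>\<^sup>+x. indicator Z x \<partial>count_space (Fib \<omega>)) = 0" and x: "x \<in> Fib \<omega>"
    then have "x \<notin> Z"
      by (subst (asm) nn_integral_0_iff_AE) (auto simp: AE_count_space indicator_def split: if_splits)
    then show "P x" using Z x by (auto simp: vfiber_iff)
  qed
qed

lemma AE_M_proj:
  assumes "AE \<omega> in m. P \<omega>"
  shows "AE x in M. P (proj G x)"
proof -
  obtain Z where Z: "Z \<in> sets m" "{\<omega> \<in> space m. \<not> P \<omega>} \<subseteq> Z" "emeasure m Z = 0"
    using assms by (auto elim!: AE_E)
  have meas: "(\<lambda>x. indicator Z (proj G x)) \<in> borel_measurable V"
    using Z(1) sets_m by measurable
  have "(\<integral>\<^sup>+x. indicator Z (proj G x) \<partial>M) = (\<integral>\<^sup>+\<omega>. \<integral>\<^sup>+x. indicator Z (proj G x) \<partial>count_space (Fib \<omega>) \<partial>m)"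
    by (rule nn_integral_M[OF meas])
  also have "\<dots> = (\<integral>\<^sup>+\<omega>. 0 \<partial>m)"
  proof (rule nn_integral_cong_AE)
    have "AE \<omega> in m. \<omega> \<notin> Z" using Z by (intro AE_not_in) (auto simp: null_sets_def)
    then show "AE \<omega> in m. (\<integral>\<^sup>+x. indicator Z (proj G x) \<partial>count_space (Fib \<omega>)) = 0"
      by (rule AE_mp) (auto intro!: AE_I2 simp: nn_integral_0_iff_AE AE_count_space vfiber_iff)
  qed
  finally have "(\<integral>\<^sup>+x. indicator Z (proj G x) \<partial>M) = 0"
    by simp
  then have "AE x in M. indicator Z (proj G x) = (0::ennreal)"
    using meas by (subst (asm) nn_integral_0_iff_AE) (simp_all cong: measurable_cong_sets)
  then show ?thesis
  proof (rule AE_mp, intro AE_I2 impI)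
    fix x assume "x \<in> space M" "indicator Z (proj G x) = (0::ennreal)"
    then show "P (proj G x)"
      using Z(2) proj_units[of x] by (auto simp: indicator_def split: if_splits)
  qed
qed

section \<open>Measurability of neighbour sums and walk counts\<close>

abbreviation "CP \<equiv> connected_pairs V E"

lemma measurable_adjacency: "(\<lambda>p. ennreal (indicator E p)) \<in> borel_measurable CP"
proof -
  have "(indicator E :: _ \<Rightarrow> real) \<in> borel_measurable CP"
    using measurable_graph by (simp add: measurable_graph_def)
  then show ?thesis by (rule measurable_compose[OF _ measurable_ennreal])
qed

lemma measurable_kernel_prod:
  "a \<in> borel_measurable CP \<Longrightarrow> b \<in> borel_measurable CP \<Longrightarrow> kernel_prod E a b \<in> borel_measurable CP"
  using measurable_graph by (simp add: measurable_graph_def)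

lemma measurable_diagonal: "f \<in> borel_measurable CP \<Longrightarrow> (\<lambda>x. f (x, x)) \<in> borel_measurable V"
  by (rule measurable_compose[of "\<lambda>x. (x, x)" V CP])
     (auto simp: connected_pairs_def intro!: measurable_restrict_space2)

lemma space_CP: "space CP \<subseteq> space V \<times> space V"
  by (auto simp: connected_pairs_def space_restrict_space space_pair_measure)

lemma kernel_prod_adjacency:
  "kernel_prod E (\<lambda>p. ennreal (indicator E p)) b (x, z) = nbr_sum E (\<lambda>y. b (y, z)) x"
proof -
  have "(\<integral>\<^sup>+y. ennreal (indicator E (x, y)) * b (y, z) \<partial>count_space {y. (x, y) \<in> E\<^sup>*})
      = (\<Sum>y | (x, y) \<in> E. ennreal (indicator E (x, y)) * b (y, z))"
    using finite_nbrs by (intro nn_integral_count_space') auto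
  then show ?thesis
    by (simp add: kernel_prod_def nbr_sum_def)
qed

text \<open>Products of measurable kernels are the available source of measurability: f becomes a
  kernel depending on the first vertex alone, is multiplied by the adjacency matrix and then
  restricted to the diagonal.\<close>

lemma measurable_nbr_sum_ennreal:
  fixes f :: "'v \<Rightarrow> ennreal"
  assumes "f \<in> borel_measurable V"
  shows "nbr_sum E f \<in> borel_measurable V"
proof -
  have "(\<lambda>(y, z). f y) \<in> borel_measurable CP"
    unfolding connected_pairs_def split_def
    by (intro measurable_restrict_space1 measurable_compose[OF measurable_fst assms])
  then have "kernel_prod E (\<lambda>p. ennreal (indicator E p)) (\<lambda>(y, z). f y) \<in> borel_measurable CP"
    by (intro measurable_kernel_prod measurable_adjacency)
  then show ?thesis
    using measurable_diagonal by (fastforce simp: kernel_prod_adjacency)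
qed

lemma measurable_nbr_sum_real:
  fixes f :: "'v \<Rightarrow> real"
  assumes [measurable]: "f \<in> borel_measurable V"
  shows "nbr_sum E f \<in> borel_measurable V"
proof -
  have eq: "nbr_sum E h x = enn2real (nbr_sum E (\<lambda>y. ennreal (h y)) x)" if "\<And>y. 0 \<le> h y" for h x
    using that by (simp add: nbr_sum_def sum_nonneg)
  have "nbr_sum E f x = nbr_sum E (\<lambda>y. max 0 (f y)) x - nbr_sum E (\<lambda>y. max 0 (- f y)) x" for x
    unfolding nbr_sum_def sum_subtractf[symmetric] by (rule sum.cong) auto
  also have "\<dots> x = enn2real (nbr_sum E (\<lambda>y. ennreal (max 0 (f y))) x)
      - enn2real (nbr_sum E (\<lambda>y. ennreal (max 0 (- f y))) x)" for x
    by (subst (1 2) eq) auto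
  finally have "nbr_sum E f = (\<lambda>x. enn2real (nbr_sum E (\<lambda>y. ennreal (max 0 (f y))) x)
      - enn2real (nbr_sum E (\<lambda>y. ennreal (max 0 (- f y))) x))"
    by auto
  moreover have "nbr_sum E (\<lambda>y. ennreal (max 0 (f y))) \<in> borel_measurable V"
    "nbr_sum E (\<lambda>y. ennreal (max 0 (- f y))) \<in> borel_measurable V"
    by (auto intro!: measurable_nbr_sum_ennreal)
  ultimately show ?thesis by simp
qed

lemma measurable_nbr_sum:
  fixes f :: "'v \<Rightarrow> complex"
  assumes [measurable]: "f \<in> borel_measurable V"
  shows "nbr_sum E f \<in> borel_measurable V"
proof -
  have "nbr_sum E f = (\<lambda>x. Complex (nbr_sum E (\<lambda>y. Re (f y)) x) (nbr_sum E (\<lambda>y. Im (f y)) x))"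
    by (auto simp: nbr_sum_def complex_eq_iff)
  moreover have "nbr_sum E (\<lambda>y. Re (f y)) \<in> borel_measurable V" "nbr_sum E (\<lambda>y. Im (f y)) \<in> borel_measurable V"
    by (auto intro!: measurable_nbr_sum_real)
  ultimately show ?thesis
    by (simp add: borel_measurable_complex_iff)
qed

lemma measurable_nbr_sum_funpow:
  fixes f :: "'v \<Rightarrow> complex"
  assumes "f \<in> borel_measurable V"
  shows "(nbr_sum E ^^ k) f \<in> borel_measurable V"
  by (induction k) (auto intro: assms measurable_nbr_sum)

text \<open>The kernel induction starts at exponent 1, with the adjacency matrix; exponent 0 would
  ask for measurability of the diagonal among the connected pairs. On the diagonal itself exponent 0
  gives the constant 1.\<close>

lemma measurable_walks: "(\<lambda>x. walks E k x x) \<in> measurable V (count_space UNIV)"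
proof -
  have "(\<lambda>x. ennreal (walks E k x x)) \<in> borel_measurable V"
  proof (cases k)
    case (Suc j)
    have "(\<lambda>(x, z). ennreal (walks E (Suc j) x z)) \<in> borel_measurable CP" for j
    proof (induction j)
      case 0
      have "ennreal (walks E (Suc 0) x z) = ennreal (indicator E (x, z))" if "(x, z) \<in> space CP" for x z
        using bounded_region.walks_one[OF region_space, of x z] that space_CP
        by (auto simp: indicator_def simp del: walks.simps)
      then show ?case
        using measurable_adjacency by (subst measurable_cong[of _ _ "\<lambda>p. ennreal (indicator E p)"]) auto
    next
      case (Suc j)
      have "ennreal (walks E (Suc (Suc j)) x z) = nbr_sum E (\<lambda>y. ennreal (walks E (Suc j) y z)) x" for x z
        unfolding walks.simps(2)[of E "Suc j"] nbr_sum_def of_nat_sum by (rule sum_ennreal[symmetric]) simp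
      then have "(\<lambda>(x, z). ennreal (walks E (Suc (Suc j)) x z)) =
          kernel_prod E (\<lambda>p. ennreal (indicator E p)) (\<lambda>(x, z). ennreal (walks E (Suc j) x z))"
        by (simp only: fun_eq_iff split_paired_All kernel_prod_adjacency prod.case) simp
      then show ?case
        using measurable_kernel_prod[OF measurable_adjacency Suc] by simp
    qed
    from measurable_diagonal[OF this] show ?thesis
      unfolding Suc by (simp del: walks.simps)
  qed simp
  then have "(\<lambda>x. nat \<lfloor>enn2real (ennreal (walks E k x x))\<rfloor>) \<in> measurable V (count_space UNIV)"
    by measurable
  then show ?thesis by simp
qed

lemma measurable_kern: "(\<lambda>x. kern E p x x) \<in> borel_measurable V"
  unfolding kern_def using measurable_walks by measurable

lemma measurable_vdegree: "vdegree E \<in> measurable V (count_space UNIV)"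
proof -
  have "(\<lambda>x. nat \<lfloor>nbr_sum E (\<lambda>_. 1::real) x\<rfloor>) \<in> measurable V (count_space UNIV)"
    using measurable_nbr_sum_real[of "\<lambda>_. 1"] by measurable
  then show ?thesis by (simp add: nbr_sum_def vdegree_def[abs_def])
qed

end

section \<open>Mass transport\<close>

context measured_graph
begin

text \<open>This is not among the clauses of \<open>is_groupoid\<close>. With h the inverse of g and
  k that of h, associativity gives g = g (h k) = (g h) k = k.\<close>

lemma ginv_ginv:
  assumes g: "g \<in> space (arrows \<G>)"
  shows "ginv \<G> (ginv \<G> g) = g"
proof -
  define h where "h = ginv \<G> g"
  define k where "k = ginv \<G> h"
  have h: "h \<in> space (arrows \<G>)" "rng \<G> h = src \<G> g" "src \<G> h = rng \<G> g"
    using groupoid_closed[OF g] by (auto simp: h_def)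
  have k: "k \<in> space (arrows \<G>)" "rng \<G> k = src \<G> h"
    using groupoid_closed[OF h(1)] by (auto simp: k_def)
  have "g = gmul \<G> g (src \<G> g)"
    using is_groupoid g by (simp add: is_groupoid_def)
  also have "src \<G> g = gmul \<G> h k"
    using h(2) by (simp add: rng_def k_def)
  also have "gmul \<G> g (gmul \<G> h k) = gmul \<G> (gmul \<G> g h) k"
    using is_groupoid g h k by (simp add: is_groupoid_def)
  also have "gmul \<G> g h = rng \<G> k"
    using k(2) h(3) by (simp add: rng_def h_def)
  also have "gmul \<G> (rng \<G> k) k = k"
    using is_groupoid k(1) unfolding is_groupoid_def by blast
  finally show ?thesis by (simp add: k_def h_def)
qed

lemma
  assumes g: "g \<in> space (arrows \<G>)"
  shows act_bij: "bij_betw (act G g) (Fib (src \<G> g)) (Fib (rng \<G> g))"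
    and act_inv_bij: "bij_betw (act G (ginv \<G> g)) (Fib (rng \<G> g)) (Fib (src \<G> g))"
    and act_inv_act: "x \<in> Fib (src \<G> g) \<Longrightarrow> act G (ginv \<G> g) (act G g x) = x"
    and act_act_inv: "x \<in> Fib (rng \<G> g) \<Longrightarrow> act G g (act G (ginv \<G> g) x) = x"
    and act_edge: "x \<in> Fib (src \<G> g) \<Longrightarrow> y \<in> Fib (src \<G> g) \<Longrightarrow>
      (act G g x, act G g y) \<in> E \<longleftrightarrow> (x, y) \<in> E"
proof -
  have 1: "\<And>g. g \<in> space (arrows \<G>) \<Longrightarrow> bij_betw (act G g) (Fib (src \<G> g)) (Fib (rng \<G> g))"
    "\<And>g x. g \<in> space (arrows \<G>) \<Longrightarrow> x \<in> Fib (src \<G> g) \<Longrightarrow> act G (ginv \<G> g) (act G g x) = x"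
    using graph_over by (auto simp: graph_over_def)
  show "bij_betw (act G g) (Fib (src \<G> g)) (Fib (rng \<G> g))"
    and "x \<in> Fib (src \<G> g) \<Longrightarrow> act G (ginv \<G> g) (act G g x) = x"
    using 1 g by auto
  show "bij_betw (act G (ginv \<G> g)) (Fib (rng \<G> g)) (Fib (src \<G> g))"
    using 1(1)[of "ginv \<G> g"] groupoid_closed[OF g] by simp
  show "x \<in> Fib (rng \<G> g) \<Longrightarrow> act G g (act G (ginv \<G> g) x) = x"
    using 1(2)[of "ginv \<G> g" x] groupoid_closed[OF g] ginv_ginv[OF g] by simp
  show "x \<in> Fib (src \<G> g) \<Longrightarrow> y \<in> Fib (src \<G> g) \<Longrightarrow>
      (act G g x, act G g y) \<in> E \<longleftrightarrow> (x, y) \<in> E"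
    using graph_over g by (auto simp: graph_over_def)
qed

lemma measurable_groupoid_maps [measurable]:
  "ginv \<G> \<in> measurable (arrows \<G>) (arrows \<G>)"
  "rng \<G> \<in> measurable (arrows \<G>) \<Omega>"
  "src \<G> \<in> measurable (arrows \<G>) \<Omega>"
  using measurable_groupoid by (auto simp: measurable_groupoid_def)

lemma unit_singleton: "\<omega> \<in> units \<G> \<Longrightarrow> {\<omega>} \<in> sets \<Omega>"
  using measurable_groupoid by (auto simp: measurable_groupoid_def)

lemma rfiber_sets: "\<omega> \<in> units \<G> \<Longrightarrow> rfiber \<G> \<omega> \<in> sets (arrows \<G>)"
proof -
  assume "\<omega> \<in> units \<G>"
  then have "rng \<G> -` {\<omega>} \<inter> space (arrows \<G>) \<in> sets (arrows \<G>)"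
    using unit_singleton by (intro measurable_sets[of _ _ \<Omega>]) auto
  moreover have "rng \<G> -` {\<omega>} \<inter> space (arrows \<G>) = rfiber \<G> \<omega>"
    by (auto simp: rfiber_def)
  ultimately show ?thesis by simp
qed

lemma sets_nu: "\<omega> \<in> units \<G> \<Longrightarrow> sets (\<nu> \<omega>) = sets (arrows \<G>)"
  using transversal by (simp add: transversal_function_def)

lemma AE_nu: "\<omega> \<in> units \<G> \<Longrightarrow> AE g in \<nu> \<omega>. g \<in> rfiber \<G> \<omega>"
  using transversal sets_nu[of \<omega>] sets_eq_imp_space_eq[OF sets_nu[of \<omega>]] rfiber_sets[of \<omega>]
  by (intro AE_I[of _ _ "space (arrows \<G>) - rfiber \<G> \<omega>"]) (auto simp: transversal_function_def)

sublocale tv: kernel m \<nu> "arrows \<G>"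
proof
  fix B assume B: "B \<in> sets (arrows \<G>)"
  then have "(\<lambda>\<omega>. \<integral>\<^sup>+g. indicator B g \<partial>\<nu> \<omega>) \<in> borel_measurable \<Omega>"
    using transversal by (simp add: transversal_function_def)
  then have "(\<lambda>\<omega>. \<integral>\<^sup>+g. indicator B g \<partial>\<nu> \<omega>) \<in> borel_measurable m"
    using measurable_cong_sets[OF sets_m refl] by blast
  moreover have "(\<integral>\<^sup>+g. indicator B g \<partial>\<nu> \<omega>) = emeasure (\<nu> \<omega>) B" if "\<omega> \<in> space m" for \<omega>
    using B that sets_nu[of \<omega>] by (intro nn_integral_indicator) simp
  ultimately show "(\<lambda>\<omega>. emeasure (\<nu> \<omega>) B) \<in> borel_measurable m"
    by (rule measurable_cong[THEN iffD1, rotated])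
qed (simp add: sets_nu)

abbreviation "averaging \<equiv> averaging_function \<G> \<nu> G"

lemma averaging_measurable: "averaging u \<Longrightarrow> u \<in> borel_measurable V"
  by (simp add: averaging_function_def)

lemma averaging_integral:
  "averaging u \<Longrightarrow> x \<in> Fib \<omega> \<Longrightarrow>
    (\<integral>\<^sup>+g. u (act G (ginv \<G> g) x) * indicator (rfiber \<G> \<omega>) g \<partial>\<nu> \<omega>) = 1"
  by (auto simp: averaging_function_def vfiber_iff)

text \<open>A countable base separates units, so the complement of the relation is a countable
  union: over the base sets X, the pairs for which exactly one of the two units lies in X.\<close>

lemma rel_sets: "{p \<in> space (arrows \<G> \<Otimes>\<^sub>M V). rng \<G> (fst p) = proj G (snd p)} \<in> sets (arrows \<G> \<Otimes>\<^sub>M V)"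
proof -
  obtain B where B: "countable B" "B \<subseteq> sets m" "sets m = sigma_sets (space m) B"
    using measure_graph by (auto simp: measure_graph_def finite_countable_base_def)
  \<comment> \<open>Units that agree on every base set agree on the whole generated
    \<sigma>-algebra, and this contains singletons.\<close>
  have sep: "a = b" if "a \<in> units \<G>" "b \<in> units \<G>" "\<forall>X\<in>B. a \<in> X \<longleftrightarrow> b \<in> X" for a b
  proof -
    have "a \<in> X \<longleftrightarrow> b \<in> X" if "X \<in> sigma_sets (space m) B" for X
      using that by induction (use \<open>\<forall>X\<in>B. _\<close> \<open>a \<in> units \<G>\<close> \<open>b \<in> units \<G>\<close> in auto)
    moreover have "{a} \<in> sigma_sets (space m) B"
      using unit_singleton[OF that(1)] sets_m B(3) by simp
    ultimately show "a = b" by blast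
  qed
  let ?P = "arrows \<G> \<Otimes>\<^sub>M V"
  have X: "{p \<in> space ?P. \<not> (rng \<G> (fst p) \<in> X \<longleftrightarrow> proj G (snd p) \<in> X)} \<in> sets ?P" if "X \<in> B" for X
  proof -
    have [measurable]: "X \<in> sets \<Omega>" using that B sets_m by auto
    show ?thesis by measurable
  qed
  have "(\<Union>X\<in>B. {p \<in> space ?P. \<not> (rng \<G> (fst p) \<in> X \<longleftrightarrow> proj G (snd p) \<in> X)}) \<in> sets ?P"
    using B(1) X by (intro sets.countable_UN') auto
  then have "space ?P - (\<Union>X\<in>B. {p \<in> space ?P. \<not> (rng \<G> (fst p) \<in> X \<longleftrightarrow> proj G (snd p) \<in> X)}) \<in> sets ?P"
    by (rule sets.compl_sets)
  also have "space ?P - (\<Union>X\<in>B. {p \<in> space ?P. \<not> (rng \<G> (fst p) \<in> X \<longleftrightarrow> proj G (snd p) \<in> X)}) =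
      {p \<in> space ?P. rng \<G> (fst p) = proj G (snd p)}"
    using sep groupoid_closed proj_units by (auto simp: space_pair_measure)
  finally show ?thesis .
qed

text \<open>The action is measurable only on composable pairs. These form a measurable set by
  \<open>rel_sets\<close>, so extension by 0 gives a function on the full product.\<close>

lemma measurable_act_inv:
  fixes F :: "'v \<Rightarrow> ennreal"
  assumes F: "F \<in> borel_measurable V"
  shows "(\<lambda>p. if rng \<G> (fst p) = proj G (snd p) then F (act G (ginv \<G> (fst p)) (snd p)) else 0)
    \<in> borel_measurable (arrows \<G> \<Otimes>\<^sub>M V)"
proof -
  let ?P = "arrows \<G> \<Otimes>\<^sub>M V"
  let ?S = "{p \<in> space ?P. rng \<G> (fst p) = proj G (snd p)}"
  let ?T = "{(g, x). src \<G> g = proj G x}"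
  have "(\<lambda>p. (ginv \<G> (fst p), snd p)) \<in> measurable (restrict_space ?P ?S) (restrict_space ?P ?T)"
  proof (rule measurable_restrict_space2)
    show "(\<lambda>p. (ginv \<G> (fst p), snd p)) \<in> space (restrict_space ?P ?S) \<rightarrow> ?T"
      by (auto simp: space_restrict_space space_pair_measure groupoid_closed)
    show "(\<lambda>p. (ginv \<G> (fst p), snd p)) \<in> measurable (restrict_space ?P ?S) ?P"
      by (rule measurable_restrict_space1) measurable
  qed
  moreover have "(\<lambda>(g, x). act G g x) \<in> measurable (restrict_space ?P ?T) V"
    using graph_over by (simp add: graph_over_def)
  ultimately have "(\<lambda>p. (\<lambda>(g, x). act G g x) (ginv \<G> (fst p), snd p)) \<in> measurable (restrict_space ?P ?S) V"
    by (rule measurable_compose)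
  then have "(\<lambda>p. F (act G (ginv \<G> (fst p)) (snd p))) \<in> borel_measurable (restrict_space ?P ?S)"
    using F by (intro measurable_compose[OF _ F]) simp
  then have "(\<lambda>p. if p \<in> ?S then F (act G (ginv \<G> (fst p)) (snd p)) else 0) \<in> borel_measurable ?P"
    using rel_sets by (subst measurable_If_restrict_space_iff) auto
  then show ?thesis
    by (rule measurable_cong[THEN iffD1, rotated]) auto
qed

lemma measurable_act_inv_fixed:
  fixes F :: "'v \<Rightarrow> ennreal"
  assumes F: "F \<in> borel_measurable V" and x: "x \<in> Fib \<omega>"
  shows "(\<lambda>g. F (act G (ginv \<G> g) x) * indicator (rfiber \<G> \<omega>) g) \<in> borel_measurable (arrows \<G>)"
proof -
  have x': "x \<in> space V" "proj G x = \<omega>" using x by (auto simp: vfiber_iff)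
  have "(\<lambda>g. (g, x)) \<in> measurable (arrows \<G>) (arrows \<G> \<Otimes>\<^sub>M V)"
    using x' by measurable
  from measurable_compose[OF this measurable_act_inv[OF F]] show ?thesis
    by (rule measurable_cong[THEN iffD1, rotated]) (auto simp: x' rfiber_def indicator_def)
qed

text \<open>The counting measures on the fibers need not form an s-finite kernel. Weighted by a positive \<open>v\<close>
  and normalised they become a subprobability kernel on the units of finite \<open>v\<close>-mass, which are
  almost all units if \<open>v\<close> lies below an integrable averaging function. The value \<open>\<infinity>\<close> of \<open>vnorm\<close>
  turns the kernel into the null measure elsewhere.\<close>

definition vmass :: "('v \<Rightarrow> ennreal) \<Rightarrow> 'g \<Rightarrow> ennreal" where
  "vmass v \<omega> = (\<integral>\<^sup>+y. v y \<partial>count_space (Fib \<omega>))"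

definition vnorm :: "('v \<Rightarrow> ennreal) \<Rightarrow> 'g \<Rightarrow> ennreal" where
  "vnorm v \<omega> = (if 0 < vmass v \<omega> \<and> vmass v \<omega> < \<infinity> then vmass v \<omega> else \<infinity>)"

definition vkernel :: "('v \<Rightarrow> ennreal) \<Rightarrow> 'g \<Rightarrow> 'v measure" where
  "vkernel v \<omega> = density (fiber_count G \<omega>) (\<lambda>y. v y / vnorm v \<omega>)"

context
  fixes v :: "'v \<Rightarrow> ennreal"
  assumes v: "v \<in> borel_measurable V" "\<And>x. x \<in> space V \<Longrightarrow> 0 < v x" "\<And>x. v x \<le> 1"
begin

lemma measurable_vmass [measurable]: "vmass v \<in> borel_measurable \<Omega>"
  unfolding vmass_def[abs_def] by (rule measurable_fiber_sum[OF v(1)])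

lemma measurable_vnorm [measurable]: "vnorm v \<in> borel_measurable \<Omega>"
  unfolding vnorm_def[abs_def] by measurable

lemma sets_fiber_count [simp, measurable_cong]: "sets (fiber_count G \<omega>) = sets V"
  by (simp add: fiber_count_def)

lemma emeasure_vkernel:
  assumes "B \<in> sets V"
  shows "emeasure (vkernel v \<omega>) B = (\<integral>\<^sup>+y. v y * indicator B y \<partial>count_space (Fib \<omega>)) / vnorm v \<omega>"
proof -
  note [measurable] = v(1) assms
  have "emeasure (vkernel v \<omega>) B = (\<integral>\<^sup>+y. v y / vnorm v \<omega> * indicator B y \<partial>fiber_count G \<omega>)"
    unfolding vkernel_def by (rule emeasure_density) (simp_all add: assms)
  also have "\<dots> = (\<integral>\<^sup>+y. v y * indicator B y / vnorm v \<omega> \<partial>fiber_count G \<omega>)"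
    by (intro nn_integral_cong) (simp add: ennreal_times_divide mult.commute)
  also have "\<dots> = (\<integral>\<^sup>+y. v y * indicator B y / vnorm v \<omega> \<partial>count_space (Fib \<omega>))"
    by (rule nn_integral_fiber_count) measurable
  also have "\<dots> = (\<integral>\<^sup>+y. v y * indicator B y \<partial>count_space (Fib \<omega>)) / vnorm v \<omega>"
    by (rule nn_integral_divide) simp
  finally show ?thesis .
qed

lemma measurable_vkernel: "vkernel v \<in> measurable \<Omega> (subprob_algebra V)"
proof (rule measurable_subprob_algebra)
  fix \<omega>
  show "sets (vkernel v \<omega>) = sets V"
    by (simp add: vkernel_def)
  have "emeasure (vkernel v \<omega>) (space V) = vmass v \<omega> / vnorm v \<omega>"
  proof -
    have "(\<integral>\<^sup>+y. v y * indicator (space V) y \<partial>count_space (Fib \<omega>)) = vmass v \<omega>"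
      unfolding vmass_def by (intro nn_integral_cong) (auto simp: vfiber_iff)
    then show ?thesis by (simp add: emeasure_vkernel)
  qed
  also have "\<dots> \<le> 1"
    by (auto simp: vnorm_def ennreal_divide_self)
  finally show "subprob_space (vkernel v \<omega>)"
    using graph by (intro subprob_spaceI) (auto simp: vkernel_def graph_def fiber_count_def)
next
  fix B assume B [measurable]: "B \<in> sets V"
  have "(\<lambda>\<omega>. \<integral>\<^sup>+y. v y * indicator B y \<partial>count_space (Fib \<omega>)) \<in> borel_measurable \<Omega>"
    by (intro measurable_fiber_sum borel_measurable_times_ennreal v(1) borel_measurable_indicator B)
  then show "(\<lambda>\<omega>. emeasure (vkernel v \<omega>) B) \<in> borel_measurable \<Omega>"
    unfolding emeasure_vkernel[OF B] by measurable
qed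

text \<open>The summand varies with the arrow, so measurability in the unit for each fixed function
  is not enough. Dividing H by v and integrating against the subprobability kernel brings in joint
  measurability; multiplying by the mass restores the plain sum.\<close>

lemma measurable_arrow_sum:
  assumes H: "(\<lambda>p. H (fst p) (snd p)) \<in> borel_measurable (arrows \<G> \<Otimes>\<^sub>M V)"
  shows "(\<lambda>g. if vmass v (rng \<G> g) < \<infinity> then \<integral>\<^sup>+y. H g y \<partial>count_space (Fib (rng \<G> g)) else 0)
    \<in> borel_measurable (arrows \<G>)"
proof -
  note [measurable] = v(1)
  have k: "(\<lambda>g. vkernel v (rng \<G> g)) \<in> measurable (arrows \<G>) (subprob_algebra V)"
    by (rule measurable_compose[OF _ measurable_vkernel]) measurable
  have "(\<lambda>(g, y). H g y / v y) \<in> borel_measurable (arrows \<G> \<Otimes>\<^sub>M V)"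
    unfolding split_def using H by measurable
  from nn_integral_measurable_subprob_algebra2[OF this k]
  have "(\<lambda>g. if vmass v (rng \<G> g) < \<infinity> then (\<integral>\<^sup>+y. H g y / v y \<partial>vkernel v (rng \<G> g)) * vmass v (rng \<G> g) else 0)
      \<in> borel_measurable (arrows \<G>)"
    by measurable
  moreover have "(\<integral>\<^sup>+y. H g y / v y \<partial>vkernel v (rng \<G> g)) * vmass v (rng \<G> g) =
      (\<integral>\<^sup>+y. H g y \<partial>count_space (Fib (rng \<G> g)))"
    if g: "g \<in> space (arrows \<G>)" and fin: "vmass v (rng \<G> g) < \<infinity>" for g
  \<comment> \<open>Mass 0 means an empty fibre, since v is positive.\<close>
  proof (cases "vmass v (rng \<G> g) = 0")
    case True
    then have "\<forall>x\<in>Fib (rng \<G> g). v x = 0"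
      unfolding vmass_def by (subst (asm) nn_integral_0_iff_AE) (auto simp: AE_count_space)
    then have "Fib (rng \<G> g) = {}"
      using v(2) vfiber_iff by (metis equals0I less_irrefl)
    then show ?thesis using True by (simp add: nn_integral_empty)
  next
    case False
    let ?\<omega> = "rng \<G> g" let ?c = "vmass v (rng \<G> g)"
    have c: "vnorm v ?\<omega> = ?c" "0 < ?c" "?c < \<infinity>"
      using False fin by (auto simp: vnorm_def zero_less_iff_neq_zero)
    have Hg [measurable]: "H g \<in> borel_measurable V"
      using measurable_compose[OF measurable_Pair1'[OF g] H] by simp
    have "(\<integral>\<^sup>+y. H g y / v y \<partial>vkernel v ?\<omega>) = (\<integral>\<^sup>+y. v y / ?c * (H g y / v y) \<partial>fiber_count G ?\<omega>)"
      unfolding vkernel_def c(1) by (rule nn_integral_density) measurable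
    also have "\<dots> = (\<integral>\<^sup>+y. v y / ?c * (H g y / v y) \<partial>count_space (Fib ?\<omega>))"
      by (rule nn_integral_fiber_count) measurable
    also have "\<dots> = (\<integral>\<^sup>+y. H g y / ?c \<partial>count_space (Fib ?\<omega>))"
    proof (rule nn_integral_cong)
      fix y assume "y \<in> space (count_space (Fib ?\<omega>))"
      then have vy: "0 < v y" "v y < \<infinity>"
        using v(2)[of y] v(3)[of y] by (auto simp: vfiber_iff less_top intro: le_less_trans)
      have "v y / ?c * (H g y / v y) = H g y / ?c * (v y / v y)"
        by (simp add: divide_ennreal_def ac_simps)
      then show "v y / ?c * (H g y / v y) = H g y / ?c"
        using vy by (simp add: ennreal_divide_self)
    qed
    also have "\<dots> = (\<integral>\<^sup>+y. H g y \<partial>count_space (Fib ?\<omega>)) / ?c"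
      by (rule nn_integral_divide) simp
    finally show ?thesis
      using c by (simp add: ennreal_divide_times ennreal_times_divide[symmetric] ennreal_divide_self)
  qed
  ultimately show ?thesis
    by (subst measurable_cong) auto
qed

end

lemma finite_averaging:
  obtains u where "averaging u" "\<And>x. x \<in> space V \<Longrightarrow> 0 < u x" "(\<integral>\<^sup>+x. u x \<partial>M) < \<infinity>"
  using measure_graph by (auto simp: measure_graph_def)

lemma measurable_act_inv_nu:
  fixes F :: "'v \<Rightarrow> ennreal"
  assumes "F \<in> borel_measurable V" "\<omega> \<in> units \<G>" "x \<in> Fib \<omega>"
  shows "(\<lambda>g. F (act G (ginv \<G> g) x) * indicator (rfiber \<G> \<omega>) g) \<in> borel_measurable (\<nu> \<omega>)"
    "(\<lambda>g. c * (F (act G (ginv \<G> g) x) * indicator (rfiber \<G> \<omega>) g)) \<in> borel_measurable (\<nu> \<omega>)"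
proof -
  show *: "(\<lambda>g. F (act G (ginv \<G> g) x) * indicator (rfiber \<G> \<omega>) g) \<in> borel_measurable (\<nu> \<omega>)"
    using measurable_act_inv_fixed[OF assms(1,3)] measurable_cong_sets[OF sets_nu[OF assms(2)] refl] by blast
  show "(\<lambda>g. c * (F (act G (ginv \<G> g) x) * indicator (rfiber \<G> \<omega>) g)) \<in> borel_measurable (\<nu> \<omega>)"
    by (rule borel_measurable_times_ennreal[OF borel_measurable_const *])
qed

text \<open>Insert the integral of u' (g^-1 y) over the arrows g into the fibre with y; it equals 1.
  The left side becomes the integral over arrows of a function \<Phi>, and invariance of m replaces
  \<Phi> (g) by \<Phi> (g^-1). After the fibre variables are moved along g, the weights have changed
  roles: now u (g^-1 x) integrates to 1 and u' y remains.\<close>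

lemma mass_transport:
  fixes k :: "'v \<Rightarrow> 'v \<Rightarrow> ennreal"
  assumes u: "averaging u" and u': "averaging u'"
    and inv: "\<And>g x y. g \<in> space (arrows \<G>) \<Longrightarrow> x \<in> Fib (src \<G> g) \<Longrightarrow> y \<in> Fib (src \<G> g) \<Longrightarrow>
      k (act G g x) (act G g y) = k x y"
    and measW: "(\<lambda>y. \<integral>\<^sup>+x. u x * k x y \<partial>count_space (Fib (proj G y))) \<in> borel_measurable V"
    and meas1: "(\<lambda>x. \<integral>\<^sup>+y. k x y \<partial>count_space (Fib (proj G x))) \<in> borel_measurable V"
    and meas2: "(\<lambda>y. \<integral>\<^sup>+x. k x y \<partial>count_space (Fib (proj G y))) \<in> borel_measurable V"
  shows "(\<integral>\<^sup>+x. u x * (\<integral>\<^sup>+y. k x y \<partial>count_space (Fib (proj G x))) \<partial>M) =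
    (\<integral>\<^sup>+y. u' y * (\<integral>\<^sup>+x. k x y \<partial>count_space (Fib (proj G y))) \<partial>M)"
proof -
  obtain u0 where u0: "averaging u0" "\<And>x. x \<in> space V \<Longrightarrow> 0 < u0 x" "(\<integral>\<^sup>+x. u0 x \<partial>M) < \<infinity>"
    by (rule finite_averaging) blast
  \<comment> \<open>Cutting off at 1 keeps v positive and makes it finite; lying below an integrable
    function, it has finite mass on almost every fibre.\<close>
  define v where "v = (\<lambda>x. min (u0 x) 1)"
  have v: "v \<in> borel_measurable V" "\<And>x. x \<in> space V \<Longrightarrow> 0 < v x" "\<And>x. v x \<le> 1"
    using averaging_measurable[OF u0(1)] u0(2) by (auto simp: v_def)
  have "(\<integral>\<^sup>+\<omega>. vmass v \<omega> \<partial>m) = (\<integral>\<^sup>+x. v x \<partial>M)"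
    by (subst nn_integral_M[OF v(1)]) (simp add: vmass_def[abs_def])
  also have "\<dots> \<le> (\<integral>\<^sup>+x. u0 x \<partial>M)"
    by (intro nn_integral_mono) (simp add: v_def)
  finally have "(\<integral>\<^sup>+\<omega>. vmass v \<omega> \<partial>m) \<noteq> \<infinity>"
    using u0(3) by (simp add: top_unique less_top)
  then have fin: "AE \<omega> in m. vmass v \<omega> < \<infinity>"
    using measurable_vmass[OF v] measurable_cong_sets[OF sets_m refl]
    by (intro AE_mp[OF nn_integral_PInf_AE AE_I2]) (auto simp: less_top)
  define W where "W y = (\<integral>\<^sup>+x. u x * k x y \<partial>count_space (Fib (proj G y)))" for y
  have W: "W \<in> borel_measurable V"
    unfolding W_def[abs_def] by (rule measW)
  note meas_u = averaging_measurable[OF u] and meas_u' = averaging_measurable[OF u']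
  define H where "H g y = (if rng \<G> g = proj G y then W y * u' (act G (ginv \<G> g) y) else 0)" for g y
  have H: "(\<lambda>p. H (fst p) (snd p)) \<in> borel_measurable (arrows \<G> \<Otimes>\<^sub>M V)"
  proof -
    have "(\<lambda>p. W (snd p) * (if rng \<G> (fst p) = proj G (snd p) then u' (act G (ginv \<G> (fst p)) (snd p)) else 0))
        \<in> borel_measurable (arrows \<G> \<Otimes>\<^sub>M V)"
      using measurable_compose[OF measurable_snd W] measurable_act_inv[OF meas_u']
      by (rule borel_measurable_times_ennreal)
    then show ?thesis
      by (rule measurable_cong[THEN iffD1, rotated]) (simp add: H_def)
  qed
  define \<Phi> where "\<Phi> g = (\<integral>\<^sup>+y. H g y \<partial>count_space (Fib (rng \<G> g)))" for g
  \<comment> \<open>Measurability is known for the cut-off function only. It differs from \<Phi>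
    just on arrows whose range has infinite mass.\<close>
  define \<Phi>' where "\<Phi>' g = (if vmass v (rng \<G> g) < \<infinity> then \<Phi> g else 0)" for g
  have \<Phi>': "\<Phi>' \<in> borel_measurable (arrows \<G>)"
    unfolding \<Phi>'_def[abs_def] \<Phi>_def by (rule measurable_arrow_sum[OF v H])
  have left: "(\<integral>\<^sup>+x. u x * (\<integral>\<^sup>+y. k x y \<partial>count_space (Fib \<omega>)) \<partial>count_space (Fib \<omega>)) = (\<integral>\<^sup>+g. \<Phi> g \<partial>\<nu> \<omega>)"
    if \<omega>: "\<omega> \<in> units \<G>" for \<omega>
  proof -
    let ?C = "count_space (Fib \<omega>)"
    have "(\<integral>\<^sup>+x. u x * (\<integral>\<^sup>+y. k x y \<partial>?C) \<partial>?C) = (\<integral>\<^sup>+x. \<integral>\<^sup>+y. u x * k x y \<partial>?C \<partial>?C)"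
      by (intro nn_integral_cong nn_integral_cmult[symmetric]) simp
    also have "\<dots> = (\<integral>\<^sup>+y. \<integral>\<^sup>+x. u x * k x y \<partial>?C \<partial>?C)"
      by (rule nn_integral_count_space_nn_integral[OF countable_vfiber[OF \<omega>]]) simp
    also have "\<dots> = (\<integral>\<^sup>+y. W y * (\<integral>\<^sup>+g. u' (act G (ginv \<G> g) y) * indicator (rfiber \<G> \<omega>) g \<partial>\<nu> \<omega>) \<partial>?C)"
      using averaging_integral[OF u'] by (intro nn_integral_cong) (auto simp: W_def vfiber_iff)
    also have "\<dots> = (\<integral>\<^sup>+y. \<integral>\<^sup>+g. W y * (u' (act G (ginv \<G> g) y) * indicator (rfiber \<G> \<omega>) g) \<partial>\<nu> \<omega> \<partial>?C)"
      using measurable_act_inv_nu[OF meas_u' \<omega>]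
      by (intro nn_integral_cong nn_integral_cmult[symmetric]) simp
    also have "\<dots> = (\<integral>\<^sup>+g. \<integral>\<^sup>+y. W y * (u' (act G (ginv \<G> g) y) * indicator (rfiber \<G> \<omega>) g) \<partial>?C \<partial>\<nu> \<omega>)"
      using measurable_act_inv_nu[OF meas_u' \<omega>]
      by (intro nn_integral_count_space_nn_integral[OF countable_vfiber[OF \<omega>], symmetric])
    also have "\<dots> = (\<integral>\<^sup>+g. \<Phi> g \<partial>\<nu> \<omega>)"
    proof (rule nn_integral_cong_AE, rule AE_mp[OF AE_nu[OF \<omega>] AE_I2], rule impI)
      fix g assume g: "g \<in> rfiber \<G> \<omega>"
      then show "(\<integral>\<^sup>+y. W y * (u' (act G (ginv \<G> g) y) * indicator (rfiber \<G> \<omega>) g) \<partial>?C) = \<Phi> g"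
        unfolding \<Phi>_def by (auto simp: rfiber_def H_def vfiber_iff intro!: nn_integral_cong)
    qed
    finally show ?thesis .
  qed
  have right: "(\<integral>\<^sup>+g. \<Phi> (ginv \<G> g) \<partial>\<nu> \<omega>) =
      (\<integral>\<^sup>+y. u' y * (\<integral>\<^sup>+x. k x y \<partial>count_space (Fib \<omega>)) \<partial>count_space (Fib \<omega>))"
    if \<omega>: "\<omega> \<in> units \<G>" for \<omega>
  proof -
    let ?C = "count_space (Fib \<omega>)"
    have \<Phi>_inv: "\<Phi> (ginv \<G> g) = (\<integral>\<^sup>+y. u' y * (W (act G (ginv \<G> g) y) * indicator (rfiber \<G> \<omega>) g) \<partial>?C)"
      if "g \<in> rfiber \<G> \<omega>" for g
    proof -
      have g: "g \<in> space (arrows \<G>)" "rng \<G> g = \<omega>" using that by (auto simp: rfiber_def)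
      have "\<Phi> (ginv \<G> g) = (\<integral>\<^sup>+y. W y * u' (act G g y) \<partial>count_space (Fib (src \<G> g)))"
        unfolding \<Phi>_def using groupoid_closed[OF g(1)] ginv_ginv[OF g(1)]
        by (auto simp: H_def vfiber_iff intro!: nn_integral_cong)
      also have "\<dots> = (\<integral>\<^sup>+y. W (act G (ginv \<G> g) y) * u' (act G g (act G (ginv \<G> g) y)) \<partial>count_space (Fib (rng \<G> g)))"
        by (rule nn_integral_bij_count_space[OF act_inv_bij[OF g(1)], symmetric])
      also have "\<dots> = (\<integral>\<^sup>+y. u' y * (W (act G (ginv \<G> g) y) * indicator (rfiber \<G> \<omega>) g) \<partial>?C)"
        using act_act_inv[OF g(1)] g that by (auto simp: mult.commute intro!: nn_integral_cong)
      finally show ?thesis .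
    qed
    \<comment> \<open>W is not invariant: moving y by g^-1 preserves k but displaces the weight u.
      Exactly this displaced weight integrates to 1 over the arrows.\<close>
    have W_inv: "W (act G (ginv \<G> g) y) = (\<integral>\<^sup>+x. k x y * u (act G (ginv \<G> g) x) \<partial>?C)"
      if "g \<in> rfiber \<G> \<omega>" "y \<in> Fib \<omega>" for g y
    proof -
      have g: "g \<in> space (arrows \<G>)" "rng \<G> g = \<omega>" using that by (auto simp: rfiber_def)
      note bij = act_inv_bij[OF g(1)]
      have y: "act G (ginv \<G> g) y \<in> Fib (src \<G> g)"
        using bij_betwE[OF bij] that(2) g by auto
      have "W (act G (ginv \<G> g) y) = (\<integral>\<^sup>+x. u x * k x (act G (ginv \<G> g) y) \<partial>count_space (Fib (src \<G> g)))"
        unfolding W_def using y by (simp add: vfiber_iff)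
      also have "\<dots> = (\<integral>\<^sup>+x. u (act G (ginv \<G> g) x) * k (act G (ginv \<G> g) x) (act G (ginv \<G> g) y)
          \<partial>count_space (Fib (rng \<G> g)))"
        by (rule nn_integral_bij_count_space[OF bij, symmetric])
      also have "\<dots> = (\<integral>\<^sup>+x. k x y * u (act G (ginv \<G> g) x) \<partial>?C)"
        unfolding g(2)
      proof (rule nn_integral_cong)
        fix x assume "x \<in> space ?C"
        then have x: "x \<in> Fib \<omega>" by simp
        then have "act G (ginv \<G> g) x \<in> Fib (src \<G> g)"
          using bij_betwE[OF bij] g by auto
        from inv[OF g(1) this y]
        have "k (act G (ginv \<G> g) x) (act G (ginv \<G> g) y) = k x y"
          using act_act_inv[OF g(1)] x that(2) g(2) by simp
        then show "u (act G (ginv \<G> g) x) * k (act G (ginv \<G> g) x) (act G (ginv \<G> g) y) =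
            k x y * u (act G (ginv \<G> g) x)"
          by (simp add: mult.commute)
      qed
      finally show ?thesis .
    qed
    have "(\<integral>\<^sup>+g. \<Phi> (ginv \<G> g) \<partial>\<nu> \<omega>) =
        (\<integral>\<^sup>+g. \<integral>\<^sup>+y. u' y * (W (act G (ginv \<G> g) y) * indicator (rfiber \<G> \<omega>) g) \<partial>?C \<partial>\<nu> \<omega>)"
      using \<Phi>_inv by (intro nn_integral_cong_AE AE_mp[OF AE_nu[OF \<omega>] AE_I2]) auto
    also have "\<dots> = (\<integral>\<^sup>+y. \<integral>\<^sup>+g. u' y * (W (act G (ginv \<G> g) y) * indicator (rfiber \<G> \<omega>) g) \<partial>\<nu> \<omega> \<partial>?C)"
      using measurable_act_inv_nu[OF W \<omega>]
      by (intro nn_integral_count_space_nn_integral[OF countable_vfiber[OF \<omega>]])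
    also have "\<dots> = (\<integral>\<^sup>+y. u' y * (\<integral>\<^sup>+g. W (act G (ginv \<G> g) y) * indicator (rfiber \<G> \<omega>) g \<partial>\<nu> \<omega>) \<partial>?C)"
      using measurable_act_inv_nu[OF W \<omega>]
      by (intro nn_integral_cong nn_integral_cmult) simp
    also have "\<dots> = (\<integral>\<^sup>+y. u' y * (\<integral>\<^sup>+x. k x y \<partial>?C) \<partial>?C)"
    proof (rule nn_integral_cong)
      fix y assume "y \<in> space ?C"
      then have y: "y \<in> Fib \<omega>" by simp
      have "(\<integral>\<^sup>+g. W (act G (ginv \<G> g) y) * indicator (rfiber \<G> \<omega>) g \<partial>\<nu> \<omega>) =
          (\<integral>\<^sup>+g. \<integral>\<^sup>+x. k x y * (u (act G (ginv \<G> g) x) * indicator (rfiber \<G> \<omega>) g) \<partial>?C \<partial>\<nu> \<omega>)"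
        using W_inv[OF _ y] by (intro nn_integral_cong_AE AE_mp[OF AE_nu[OF \<omega>] AE_I2]) auto
      also have "\<dots> = (\<integral>\<^sup>+x. \<integral>\<^sup>+g. k x y * (u (act G (ginv \<G> g) x) * indicator (rfiber \<G> \<omega>) g) \<partial>\<nu> \<omega> \<partial>?C)"
        using measurable_act_inv_nu[OF meas_u \<omega>]
        by (intro nn_integral_count_space_nn_integral[OF countable_vfiber[OF \<omega>]])
      also have "\<dots> = (\<integral>\<^sup>+x. k x y * (\<integral>\<^sup>+g. u (act G (ginv \<G> g) x) * indicator (rfiber \<G> \<omega>) g \<partial>\<nu> \<omega>) \<partial>?C)"
        using measurable_act_inv_nu[OF meas_u \<omega>]
        by (intro nn_integral_cong nn_integral_cmult) simp
      also have "\<dots> = (\<integral>\<^sup>+x. k x y \<partial>?C)"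
        using averaging_integral[OF u] by (intro nn_integral_cong) auto
      finally show "u' y * (\<integral>\<^sup>+g. W (act G (ginv \<G> g) y) * indicator (rfiber \<G> \<omega>) g \<partial>\<nu> \<omega>) =
          u' y * (\<integral>\<^sup>+x. k x y \<partial>?C)"
        by simp
    qed
    finally show ?thesis .
  qed
  let ?N = "mixture m \<nu> (arrows \<G>)"
  have distr: "distr ?N (arrows \<G>) (ginv \<G>) = ?N"
    using invariant by (simp add: invariant_measure_def)
  have ginv_N: "ginv \<G> \<in> measurable ?N (arrows \<G>)"
    by (simp add: measurable_groupoid_maps cong: measurable_cong_sets)
  have AE_rng: "AE g in ?N. vmass v (rng \<G> g) < \<infinity>"
  proof -
    let ?B = "{g \<in> space (arrows \<G>). \<not> vmass v (rng \<G> g) < \<infinity>}"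
    have "AE g in ?N. g \<notin> ?B"
    proof (rule tv.AE_mixtureI)
      show "AE \<omega> in m. AE g in \<nu> \<omega>. g \<notin> ?B"
      proof (rule AE_mp[OF fin AE_I2], rule impI)
        fix \<omega> assume "\<omega> \<in> space m" "vmass v \<omega> < \<infinity>"
        then show "AE g in \<nu> \<omega>. g \<notin> ?B"
          by (intro AE_mp[OF AE_nu AE_I2]) (auto simp: rfiber_def)
      qed
      have [measurable]: "vmass v \<in> borel_measurable \<Omega>" by (rule measurable_vmass[OF v])
      show "?B \<in> sets (arrows \<G>)" by measurable
    qed
    then show ?thesis
      by (rule AE_mp[OF _ AE_I2]) auto
  qed
  \<comment> \<open>Inversion exchanges range and source and preserves the measure on arrows, so the
    cut-off can also be removed after inversion.\<close>
  have AE_src: "AE g in ?N. vmass v (src \<G> g) < \<infinity>"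
  proof -
    have [measurable]: "vmass v \<in> borel_measurable \<Omega>" by (rule measurable_vmass[OF v])
    have "AE g in distr ?N (arrows \<G>) (ginv \<G>). vmass v (rng \<G> g) < \<infinity>"
      unfolding distr by (rule AE_rng)
    then have "AE g in ?N. vmass v (rng \<G> (ginv \<G> g)) < \<infinity>"
      by (subst (asm) AE_distr_iff[OF ginv_N]) measurable
    then show ?thesis
      by (rule AE_mp[OF _ AE_I2]) (simp add: groupoid_closed)
  qed
  have "(\<integral>\<^sup>+x. u x * (\<integral>\<^sup>+y. k x y \<partial>count_space (Fib (proj G x))) \<partial>M) =
      (\<integral>\<^sup>+\<omega>. \<integral>\<^sup>+x. u x * (\<integral>\<^sup>+y. k x y \<partial>count_space (Fib (proj G x))) \<partial>count_space (Fib \<omega>) \<partial>m)"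
    using meas_u meas1 by (intro nn_integral_M borel_measurable_times_ennreal)
  also have "\<dots> = (\<integral>\<^sup>+\<omega>. \<integral>\<^sup>+x. u x * (\<integral>\<^sup>+y. k x y \<partial>count_space (Fib \<omega>)) \<partial>count_space (Fib \<omega>) \<partial>m)"
    by (intro nn_integral_cong) (simp add: vfiber_iff)
  also have "\<dots> = (\<integral>\<^sup>+\<omega>. \<integral>\<^sup>+g. \<Phi> g \<partial>\<nu> \<omega> \<partial>m)"
    by (intro nn_integral_cong left) simp
  also have "\<dots> = (\<integral>\<^sup>+\<omega>. \<integral>\<^sup>+g. \<Phi>' g \<partial>\<nu> \<omega> \<partial>m)"
  proof (rule nn_integral_cong_AE, rule AE_mp[OF fin AE_I2], rule impI)
    fix \<omega> assume "\<omega> \<in> space m" "vmass v \<omega> < \<infinity>"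
    then show "(\<integral>\<^sup>+g. \<Phi> g \<partial>\<nu> \<omega>) = (\<integral>\<^sup>+g. \<Phi>' g \<partial>\<nu> \<omega>)"
      by (intro nn_integral_cong_AE AE_mp[OF AE_nu AE_I2]) (auto simp: \<Phi>'_def rfiber_def)
  qed
  also have "\<dots> = (\<integral>\<^sup>+g. \<Phi>' g \<partial>?N)"
    by (rule tv.nn_integral_mixture[OF \<Phi>', symmetric])
  also have "\<dots> = (\<integral>\<^sup>+g. \<Phi>' g \<partial>distr ?N (arrows \<G>) (ginv \<G>))"
    unfolding distr ..
  also have "\<dots> = (\<integral>\<^sup>+g. \<Phi>' (ginv \<G> g) \<partial>?N)"
    by (rule nn_integral_distr[OF ginv_N]) (simp add: \<Phi>')
  also have "\<dots> = (\<integral>\<^sup>+\<omega>. \<integral>\<^sup>+g. \<Phi>' (ginv \<G> g) \<partial>\<nu> \<omega> \<partial>m)"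
    by (rule tv.nn_integral_mixture) (rule measurable_compose[OF measurable_groupoid_maps(1) \<Phi>'])
  also have "\<dots> = (\<integral>\<^sup>+\<omega>. \<integral>\<^sup>+g. \<Phi> (ginv \<G> g) \<partial>\<nu> \<omega> \<partial>m)"
  proof (rule nn_integral_cong_AE, rule AE_mp[OF tv.AE_mixture[OF AE_src] AE_I2], rule impI)
    fix \<omega> assume \<omega>: "\<omega> \<in> space m" and ae: "AE g in \<nu> \<omega>. vmass v (src \<G> g) < \<infinity>"
    have sp: "space (\<nu> \<omega>) = space (arrows \<G>)"
      using \<omega> sets_eq_imp_space_eq[OF sets_nu] by simp
    show "(\<integral>\<^sup>+g. \<Phi>' (ginv \<G> g) \<partial>\<nu> \<omega>) = (\<integral>\<^sup>+g. \<Phi> (ginv \<G> g) \<partial>\<nu> \<omega>)"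
      by (intro nn_integral_cong_AE AE_mp[OF ae AE_I2]) (auto simp: \<Phi>'_def groupoid_closed sp)
  qed
  also have "\<dots> = (\<integral>\<^sup>+\<omega>. \<integral>\<^sup>+y. u' y * (\<integral>\<^sup>+x. k x y \<partial>count_space (Fib \<omega>)) \<partial>count_space (Fib \<omega>) \<partial>m)"
    by (intro nn_integral_cong right) simp
  also have "\<dots> = (\<integral>\<^sup>+\<omega>. \<integral>\<^sup>+y. u' y * (\<integral>\<^sup>+x. k x y \<partial>count_space (Fib (proj G y))) \<partial>count_space (Fib \<omega>) \<partial>m)"
    by (intro nn_integral_cong) (simp add: vfiber_iff)
  also have "\<dots> = (\<integral>\<^sup>+y. u' y * (\<integral>\<^sup>+x. k x y \<partial>count_space (Fib (proj G y))) \<partial>M)"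
    using meas_u' meas2 by (intro nn_integral_M[symmetric] borel_measurable_times_ennreal)
  finally show ?thesis .
qed

text \<open>Transport with the diagonal kernel exchanges u for any other averaging function, in
  particular for an integrable one.\<close>

lemma averaging_integral_finite:
  assumes u: "averaging u"
  shows "(\<integral>\<^sup>+x. u x \<partial>M) < \<infinity>"
proof -
  obtain u' where u': "averaging u'" "(\<integral>\<^sup>+x. u' x \<partial>M) < \<infinity>"
    by (rule finite_averaging) blast
  let ?k = "\<lambda>x y. of_bool (x = y) :: ennreal"
  have sum: "(\<integral>\<^sup>+y. f y * ?k y x \<partial>count_space (Fib (proj G x))) = f x"
    "(\<integral>\<^sup>+y. ?k x y \<partial>count_space (Fib (proj G x))) = 1" 
    "(\<integral>\<^sup>+y. ?k y x \<partial>count_space (Fib (proj G x))) = 1" if "x \<in> space V" for x f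
    using that by (subst nn_integral_count_space'[of "{x}"]; auto simp: vfiber_iff)+
  have "(\<integral>\<^sup>+x. u x * (\<integral>\<^sup>+y. ?k x y \<partial>count_space (Fib (proj G x))) \<partial>M) =
      (\<integral>\<^sup>+y. u' y * (\<integral>\<^sup>+x. ?k x y \<partial>count_space (Fib (proj G y))) \<partial>M)"
  proof (rule mass_transport[OF u u'(1)])
    fix g x y assume "g \<in> space (arrows \<G>)" "x \<in> Fib (src \<G> g)" "y \<in> Fib (src \<G> g)"
    then show "?k (act G g x) (act G g y) = ?k x y"
      using bij_betw_imp_inj_on[OF act_bij[of g]] by (auto simp: inj_on_def)
  next
    show "(\<lambda>y. \<integral>\<^sup>+x. u x * ?k x y \<partial>count_space (Fib (proj G y))) \<in> borel_measurable V"
      using averaging_measurable[OF u] by (subst measurable_cong[OF sum(1)])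
    show "(\<lambda>x. \<integral>\<^sup>+y. ?k x y \<partial>count_space (Fib (proj G x))) \<in> borel_measurable V"
      by (subst measurable_cong[OF sum(2)]) auto
    show "(\<lambda>y. \<integral>\<^sup>+x. ?k x y \<partial>count_space (Fib (proj G y))) \<in> borel_measurable V"
      by (subst measurable_cong[OF sum(3)]) auto
  qed
  moreover have "(\<integral>\<^sup>+x. w x * (\<integral>\<^sup>+y. ?k x y \<partial>count_space (Fib (proj G x))) \<partial>M) = (\<integral>\<^sup>+x. w x \<partial>M)"
    "(\<integral>\<^sup>+x. w x * (\<integral>\<^sup>+y. ?k y x \<partial>count_space (Fib (proj G x))) \<partial>M) = (\<integral>\<^sup>+x. w x \<partial>M)" for w
    using sum(2,3) by (auto intro!: nn_integral_cong)
  ultimately show ?thesis using u'(2) by simp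
qed

lemma nbrs_fiber: "(x, y) \<in> E \<Longrightarrow> x \<in> Fib \<omega> \<longleftrightarrow> y \<in> Fib \<omega>"
  using edge_verts proj_edge by (auto simp: vfiber_iff)

lemma nbr_sum_act:
  assumes g: "g \<in> space (arrows \<G>)" and x: "x \<in> Fib (src \<G> g)"
  shows "nbr_sum E f (act G g x) = nbr_sum E (\<lambda>y. f (act G g y)) x"
proof -
  note bij = act_bij[OF g]
  have "{z. (act G g x, z) \<in> E} = act G g ` {y. (x, y) \<in> E}"
  proof
    show "{z. (act G g x, z) \<in> E} \<subseteq> act G g ` {y. (x, y) \<in> E}"
    proof
      fix z assume "z \<in> {z. (act G g x, z) \<in> E}"
      then have z: "(act G g x, z) \<in> E" by simp
      have "act G g x \<in> Fib (rng \<G> g)" using bij x by (auto dest: bij_betwE)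
      then have "z \<in> Fib (rng \<G> g)" using nbrs_fiber[OF z] by simp
      then obtain y where "y \<in> Fib (src \<G> g)" "z = act G g y"
        using bij by (auto simp: bij_betw_def)
      then show "z \<in> act G g ` {y. (x, y) \<in> E}"
        using z act_edge[OF g x] by auto
    qed
    show "act G g ` {y. (x, y) \<in> E} \<subseteq> {z. (act G g x, z) \<in> E}"
      using act_edge[OF g x] nbrs_fiber x by auto
  qed
  moreover have "inj_on (act G g) {y. (x, y) \<in> E}"
    using bij_betw_imp_inj_on[OF bij] nbrs_fiber x by (auto intro: inj_on_subset)
  ultimately show ?thesis
    by (simp add: nbr_sum_def sum.reindex)
qed

lemma walks_act:
  assumes g: "g \<in> space (arrows \<G>)"
  shows "x \<in> Fib (src \<G> g) \<Longrightarrow> y \<in> Fib (src \<G> g) \<Longrightarrow>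
    walks E k (act G g x) (act G g y) = walks E k x y"
proof (induction k arbitrary: x)
  case 0
  then show ?case using bij_betw_imp_inj_on[OF act_bij[OF g]] by (auto simp: inj_on_def)
next
  case (Suc k)
  have "walks E k (act G g z) (act G g y) = walks E k z y" if "(x, z) \<in> E" for z
    using Suc nbrs_fiber[OF that] by auto
  then show ?case
    unfolding walks.simps nbr_sum_act[OF g Suc.prems(1)] unfolding nbr_sum_def
    by (intro sum.cong) auto
qed

lemma vdegree_act:
  assumes "g \<in> space (arrows \<G>)" "x \<in> Fib (src \<G> g)"
  shows "vdegree E (act G g x) = vdegree E x"
  using nbr_sum_act[OF assms, of "\<lambda>_. 1::nat"] by (simp add: nbr_sum_def vdegree_def)

text \<open>The transported mass from x to y is F y along each edge: x sends out the neighbour sum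
  of F, and y receives F y once for each of its neighbours. With values in \<open>ennreal\<close>,
  integrability is no issue yet; the Laplacian appears after subtraction.\<close>

lemma nbr_sum_transport:
  fixes F :: "'v \<Rightarrow> ennreal"
  assumes u: "averaging u" and F: "F \<in> borel_measurable V"
    and inv: "\<And>g x. g \<in> space (arrows \<G>) \<Longrightarrow> x \<in> Fib (src \<G> g) \<Longrightarrow> F (act G g x) = F x"
  shows "(\<integral>\<^sup>+x. u x * nbr_sum E F x \<partial>M) = (\<integral>\<^sup>+x. u x * (of_nat (vdegree E x) * F x) \<partial>M)"
proof -
  let ?k = "\<lambda>x y. indicator E (x, y) * F y"
  have sum: "(\<integral>\<^sup>+y. h y \<partial>count_space (Fib (proj G x))) = nbr_sum E h x"
    if "x \<in> space V" "\<And>y. (x, y) \<notin> E \<Longrightarrow> h y = 0" for x and h :: "'v \<Rightarrow> ennreal"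
    unfolding nbr_sum_def
  proof (rule nn_integral_count_space')
    show "{y. (x, y) \<in> E} \<subseteq> Fib (proj G x)"
    proof
      fix y assume "y \<in> {y. (x, y) \<in> E}"
      then have "(x, y) \<in> E" by simp
      from edge_verts[OF this] proj_edge[OF this] show "y \<in> Fib (proj G x)"
        by (simp add: vfiber_iff)
    qed
  qed (use that finite_nbrs in auto)
  have sum1: "(\<integral>\<^sup>+y. ?k x y \<partial>count_space (Fib (proj G x))) = nbr_sum E F x" if "x \<in> space V" for x
    using that by (subst sum) (auto simp: nbr_sum_def)
  have sum2: "(\<integral>\<^sup>+y. ?k y x \<partial>count_space (Fib (proj G x))) = of_nat (vdegree E x) * F x" if "x \<in> space V" for x
    using that edge_sym by (subst sum) (auto simp: nbr_sum_def vdegree_def)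
  have sum3: "(\<integral>\<^sup>+y. u y * ?k y x \<partial>count_space (Fib (proj G x))) = nbr_sum E u x * F x" if "x \<in> space V" for x
    using that edge_sym by (subst sum) (auto simp: nbr_sum_def sum_distrib_right)
  have vd: "(\<lambda>x. of_nat (vdegree E x) :: ennreal) \<in> borel_measurable V"
    by (rule measurable_compose[OF measurable_vdegree]) simp
  have "(\<integral>\<^sup>+x. u x * (\<integral>\<^sup>+y. ?k x y \<partial>count_space (Fib (proj G x))) \<partial>M) =
      (\<integral>\<^sup>+y. u y * (\<integral>\<^sup>+x. ?k x y \<partial>count_space (Fib (proj G y))) \<partial>M)"
  proof (rule mass_transport[OF u u])
    fix g x y assume "g \<in> space (arrows \<G>)" "x \<in> Fib (src \<G> g)" "y \<in> Fib (src \<G> g)"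
    then show "?k (act G g x) (act G g y) = ?k x y"
      using act_edge inv by (simp add: indicator_def)
  next
    show "(\<lambda>y. \<integral>\<^sup>+x. u x * ?k x y \<partial>count_space (Fib (proj G y))) \<in> borel_measurable V"
      by (subst measurable_cong[OF sum3], assumption)
        (rule borel_measurable_times_ennreal[OF measurable_nbr_sum_ennreal[OF averaging_measurable[OF u]] F])
    show "(\<lambda>x. \<integral>\<^sup>+y. ?k x y \<partial>count_space (Fib (proj G x))) \<in> borel_measurable V"
      by (subst measurable_cong[OF sum1]) (auto intro!: measurable_nbr_sum_ennreal F)
    show "(\<lambda>y. \<integral>\<^sup>+x. ?k x y \<partial>count_space (Fib (proj G y))) \<in> borel_measurable V"
      by (subst measurable_cong[OF sum2]) (auto intro!: borel_measurable_times_ennreal F vd)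
  qed
  moreover have "(\<integral>\<^sup>+x. u x * (\<integral>\<^sup>+y. ?k x y \<partial>count_space (Fib (proj G x))) \<partial>M) = (\<integral>\<^sup>+x. u x * nbr_sum E F x \<partial>M)"
    using sum1 by (intro nn_integral_cong) simp
  moreover have "(\<integral>\<^sup>+x. u x * (\<integral>\<^sup>+y. ?k y x \<partial>count_space (Fib (proj G x))) \<partial>M) =
      (\<integral>\<^sup>+x. u x * (of_nat (vdegree E x) * F x) \<partial>M)"
    using sum2 by (intro nn_integral_cong) simp
  ultimately show ?thesis by simp
qed

end

section \<open>The von Neumann algebra and its trace\<close>

context measured_graph
begin

lemma adjacency_operator_eq: "adjacency_operator G \<omega> = adj_op E (Fib \<omega>)"
  by (auto simp: adjacency_operator_def adj_op_def nbr_sum_def fun_eq_iff)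

text \<open>Replaces the fibrewise powers by one function on all vertices, whose measurability is
  known.\<close>

lemma adj_op_funpow_restrict:
  "x \<in> Fib \<omega> \<Longrightarrow> (adj_op E (Fib \<omega>) ^^ k) (ell2_restrict (Fib \<omega>) f) x = (nbr_sum E ^^ k) f x"
proof (induction k arbitrary: x)
  case 0
  then show ?case by (simp add: ell2_restrict_def)
next
  case (Suc k)
  then show ?case
    using nbrs_fiber[of x] by (auto simp: adj_op_def nbr_sum_def intro!: sum.cong)
qed

lemma adj_op_funpow_act:
  assumes g: "g \<in> space (arrows \<G>)"
    and f': "f' = (\<lambda>x. if x \<in> Fib (src \<G> g) then f (act G g x) else 0)"
  shows "y \<in> Fib (src \<G> g) \<Longrightarrow>
    (adj_op E (Fib (src \<G> g)) ^^ k) f' y = (adj_op E (Fib (rng \<G> g)) ^^ k) f (act G g y)"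
proof (induction k arbitrary: y)
  case 0
  then show ?case by (simp add: f')
next
  case (Suc k)
  have gy: "act G g y \<in> Fib (rng \<G> g)"
    using act_bij[OF g] Suc.prems by (auto dest: bij_betwE)
  have IH: "(adj_op E (Fib (src \<G> g)) ^^ k) f' z = (adj_op E (Fib (rng \<G> g)) ^^ k) f (act G g z)"
    if "(y, z) \<in> E" for z
    using Suc nbrs_fiber[OF that] by auto
  have "(adj_op E (Fib (src \<G> g)) ^^ Suc k) f' y = nbr_sum E ((adj_op E (Fib (src \<G> g)) ^^ k) f') y"
    using Suc.prems by (simp add: adj_op_def)
  also have "\<dots> = nbr_sum E (\<lambda>z. (adj_op E (Fib (rng \<G> g)) ^^ k) f (act G g z)) y"
    unfolding nbr_sum_def using IH by (intro sum.cong) auto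
  also have "\<dots> = nbr_sum E ((adj_op E (Fib (rng \<G> g)) ^^ k) f) (act G g y)"
    by (rule nbr_sum_act[OF g Suc.prems, symmetric])
  also have "\<dots> = (adj_op E (Fib (rng \<G> g)) ^^ Suc k) f (act G g y)"
    using gy by (simp add: adj_op_def)
  finally show ?case .
qed

text \<open>Translation is unitary, so its adjoint is composition with the action of g. The
  uniqueness demanded by \<open>THE\<close> is tested on point masses.\<close>

lemma adjoint_translation:
  assumes g: "g \<in> space (arrows \<G>)" and f: "f \<in> ell2 (Fib (rng \<G> g))"
  shows "operator_adjoint (Fib (src \<G> g)) (Fib (rng \<G> g)) (translation \<G> G g) f =
    (\<lambda>x. if x \<in> Fib (src \<G> g) then f (act G g x) else 0)" (is "_ = ?h")
  unfolding operator_adjoint_def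
proof (rule the_equality)
  let ?S = "Fib (src \<G> g)" and ?S' = "Fib (rng \<G> g)"
  note bij = act_bij[OF g]
  have "(\<lambda>x. (norm (f (act G g x)))\<^sup>2) summable_on ?S"
    using f summable_on_reindex_bij_betw[OF bij, of "\<lambda>x. (norm (f x))\<^sup>2"] by (simp add: ell2_def)
  then have h: "?h \<in> ell2 ?S"
    by (auto simp: ell2_def cong: summable_on_cong)
  have inner: "ell2_inner ?S k ?h = ell2_inner ?S' (translation \<G> G g k) f" for k
  proof -
    have "ell2_inner ?S' (translation \<G> G g k) f
        = (\<Sum>\<^sub>\<infinity>x\<in>?S'. cnj (k (act G (ginv \<G> g) x)) * f x)"
      unfolding ell2_inner_def by (intro infsum_cong) (simp add: translation_def)
    also have "\<dots> = (\<Sum>\<^sub>\<infinity>x\<in>?S. cnj (k (act G (ginv \<G> g) (act G g x))) * f (act G g x))"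
      by (rule infsum_reindex_bij_betw[OF bij, symmetric])
    also have "\<dots> = ell2_inner ?S k ?h"
      unfolding ell2_inner_def by (intro infsum_cong) (simp add: act_inv_act[OF g])
    finally show ?thesis ..
  qed
  show "?h \<in> ell2 ?S \<and> (\<forall>k\<in>ell2 ?S. ell2_inner ?S k ?h = ell2_inner ?S' (translation \<G> G g k) f)"
    using h inner by blast
  fix h' assume h': "h' \<in> ell2 ?S \<and>
    (\<forall>k\<in>ell2 ?S. ell2_inner ?S k h' = ell2_inner ?S' (translation \<G> G g k) f)"
  show "h' = ?h"
  proof
    fix x
    show "h' x = ?h x"
    proof (cases "x \<in> ?S")
      case True
      then have "ell2_inner ?S (ell2_delta x) h' = ell2_inner ?S (ell2_delta x) ?h"
        using h' inner ell2_delta_mem[OF True] by simp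
      then show ?thesis using True by (simp only: ell2_inner_delta)
    next
      case False
      then show ?thesis using h' ell2_outside by auto
    qed
  qed
qed

lemma measurable_real_fiber_sum:
  assumes [measurable]: "f \<in> borel_measurable V"
  shows "(\<lambda>\<omega>. real_fiber_sum (Fib \<omega>) f) \<in> borel_measurable \<Omega>"
proof -
  have [measurable]: "(\<lambda>\<omega>. \<integral>\<^sup>+x. ennreal (f x) \<partial>count_space (Fib \<omega>)) \<in> borel_measurable \<Omega>"
    "(\<lambda>\<omega>. \<integral>\<^sup>+x. ennreal (- f x) \<partial>count_space (Fib \<omega>)) \<in> borel_measurable \<Omega>"
    by (auto intro!: measurable_fiber_sum)
  show ?thesis unfolding real_fiber_sum_def by measurable
qed

text \<open>The resolvent series converges only over regular fibers, so it is cut off outside a set \<open>W\<close> of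
  units; equivariance forces \<open>W\<close> to be invariant.\<close>

definition series_family :: "'g set \<Rightarrow> (nat \<Rightarrow> complex) \<Rightarrow> ('g, 'v) op_family" where
  "series_family W a \<omega> = (if \<omega> \<in> W then series_op E (Fib \<omega>) a else (\<lambda>f x. 0))"

lemma ell2_restrict_mem_iff:
  "ell2_restrict S f \<in> ell2 S \<longleftrightarrow> (\<integral>\<^sup>+x. ennreal ((norm (f x))\<^sup>2) \<partial>count_space S) < \<infinity>"
proof -
  have "ell2_restrict S f \<in> ell2 S \<longleftrightarrow> (\<lambda>x. (norm (f x))\<^sup>2) summable_on S"
    by (auto simp: ell2_def ell2_restrict_def cong: summable_on_cong)
  then show ?thesis
    by (simp add: nonneg_summable_on_iff_nn_integral)
qed

text \<open>Square summability of the two restrictions cuts out a measurable set of units. On its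
  part in \<open>W\<close> the coefficient is the fibre sum of one measurable function F; elsewhere
  it is 0.\<close>

lemma measurable_matrix_coefficient:
  assumes W: "W \<in> sets \<Omega>" and d: "\<And>\<omega>. \<omega> \<in> W \<Longrightarrow> bounded_region E (Fib \<omega>) d"
    and a: "summable (\<lambda>k. norm (a k) * d ^ k)"
    and f [measurable]: "f \<in> borel_measurable V" and h [measurable]: "h \<in> borel_measurable V"
  shows "matrix_coefficient G (series_family W a) h f \<in> borel_measurable \<Omega>"
proof -
  define F where "F x = cnj (h x) * (\<Sum>k. a k * (nbr_sum E ^^ k) f x)" for x
  have [measurable]: "(nbr_sum E ^^ k) f \<in> borel_measurable V" for k
    by (rule measurable_nbr_sum_funpow[OF f])
  have F [measurable]: "F \<in> borel_measurable V"
    unfolding F_def[abs_def]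
    by (intro borel_measurable_times borel_measurable_suminf borel_measurable_const
      measurable_compose[OF h borel_measurable_continuous_onI] continuous_intros) fact
  let ?fin = "\<lambda>f \<omega>. (\<integral>\<^sup>+x. ennreal ((norm (f x :: complex))\<^sup>2) \<partial>count_space (Fib \<omega>)) < \<infinity>"
  have eq: "matrix_coefficient G (series_family W a) h f \<omega> =
      (if \<omega> \<in> W \<and> ?fin h \<omega> \<and> ?fin f \<omega>
       then Complex (real_fiber_sum (Fib \<omega>) (\<lambda>x. Re (F x))) (real_fiber_sum (Fib \<omega>) (\<lambda>x. Im (F x))) else 0)" for \<omega>
  proof (cases "\<omega> \<in> W \<and> ?fin h \<omega> \<and> ?fin f \<omega>")
    case False
    then show ?thesis
      by (auto simp: matrix_coefficient_def ell2_restrict_mem_iff series_family_def ell2_inner_def)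
  next
    case True
    interpret bounded_region E "Fib \<omega>" d using d True by blast
    let ?f = "ell2_restrict (Fib \<omega>) f" and ?h = "ell2_restrict (Fib \<omega>) h"
    have mem: "?f \<in> ell2 (Fib \<omega>)" "?h \<in> ell2 (Fib \<omega>)"
      using True by (auto simp: ell2_restrict_mem_iff)
    have eq: "cnj (?h x) * series_op E (Fib \<omega>) a ?f x = F x" if "x \<in> Fib \<omega>" for x
      using that by (simp add: F_def series_op_def adj_op_funpow_restrict ell2_restrict_def[of _ h])
    have "(\<lambda>x. norm (cnj (?h x) * series_op E (Fib \<omega>) a ?f x)) summable_on Fib \<omega>"
      using ell2_inner_summable[OF series_op_ell2(1)[OF a mem(1)] mem(2)] .
    then have "(\<lambda>x. norm (F x)) summable_on Fib \<omega>"
      using eq by (simp cong: summable_on_cong)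
    moreover have "matrix_coefficient G (series_family W a) h f \<omega> = infsum F (Fib \<omega>)"
      using mem True eq by (simp add: matrix_coefficient_def series_family_def ell2_inner_def cong: infsum_cong)
    ultimately show ?thesis
      using True by (simp add: infsum_eq_complex_fiber_sum)
  qed
  have [measurable]: "(\<lambda>\<omega>. real_fiber_sum (Fib \<omega>) (\<lambda>x. Re (F x))) \<in> borel_measurable \<Omega>"
    "(\<lambda>\<omega>. real_fiber_sum (Fib \<omega>) (\<lambda>x. Im (F x))) \<in> borel_measurable \<Omega>"
    by (auto intro!: measurable_real_fiber_sum)
  have [measurable]: "(\<lambda>\<omega>. \<integral>\<^sup>+x. ennreal ((norm (f x))\<^sup>2) \<partial>count_space (Fib \<omega>)) \<in> borel_measurable \<Omega>"
    if [measurable]: "f \<in> borel_measurable V" for f :: "'v \<Rightarrow> complex"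
    by (rule measurable_fiber_sum) measurable
  have [measurable]: "(\<lambda>\<omega>. Complex (real_fiber_sum (Fib \<omega>) (\<lambda>x. Re (F x)))
      (real_fiber_sum (Fib \<omega>) (\<lambda>x. Im (F x)))) \<in> borel_measurable \<Omega>"
    by (simp add: borel_measurable_complex_iff)
  note [measurable] = W
  show ?thesis
    unfolding eq[abs_def] by measurable
qed

text \<open>Arrows act by graph isomorphisms, so they intertwine all powers of the adjacency
  operators of two fibres; invariance of \<open>W\<close> makes the cut-off compatible with
  this.\<close>

lemma series_family_mem:
  assumes W: "W \<in> sets \<Omega>" and d: "\<And>\<omega>. \<omega> \<in> W \<Longrightarrow> bounded_region E (Fib \<omega>) d"
    and inv: "\<And>g. g \<in> space (arrows \<G>) \<Longrightarrow> src \<G> g \<in> W \<longleftrightarrow> rng \<G> g \<in> W"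
    and a: "summable (\<lambda>k. norm (a k) * d ^ k)"
  shows "series_family W a \<in> vn_algebra \<G> m G"
  unfolding vn_algebra_def
proof (intro CollectI conjI ballI)
  have C: "0 \<le> (\<Sum>k. norm (a k) * d ^ k)"
    using a by (intro suminf_nonneg) auto
  show "bounded_operator (Fib \<omega>) (series_family W a \<omega>)" for \<omega>
  proof (cases "\<omega> \<in> W")
    case True
    then show ?thesis
      using bounded_region.bounded_operator_series_op[OF d a] by (simp add: series_family_def)
  next
    case False
    then show ?thesis
      using ell2_norm_nonneg[of "Fib \<omega>"]
      by (auto simp: series_family_def bounded_operator_def ell2_def ell2_norm_def intro!: exI[of _ 0])
  qed
  have "operator_norm (Fib \<omega>) (series_family W a \<omega>) \<le> (\<Sum>k. norm (a k) * d ^ k)" for \<omega>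
  proof (cases "\<omega> \<in> W")
    case True
    then show ?thesis
      using bounded_region.operator_norm_series_op[OF d a] by (simp add: series_family_def)
  next
    case False
    then have "operator_norm (Fib \<omega>) (series_family W a \<omega>) \<le> 0"
      by (intro operator_norm_zero) (simp add: series_family_def)
    then show ?thesis using C by simp
  qed
  then show "\<exists>C. AE \<omega> in m. operator_norm (Fib \<omega>) (series_family W a \<omega>) \<le> C"
    by (intro exI AE_I2)
next
  fix f h assume "f \<in> square_integrable m G" "h \<in> square_integrable m G"
  then show "matrix_coefficient G (series_family W a) h f \<in> borel_measurable \<Omega>"
    using measurable_cong_sets[OF sets_M refl, of borel]
    by (intro measurable_matrix_coefficient[OF W d a]) (auto simp: square_integrable_def)
next
  fix g f assume g: "g \<in> space (arrows \<G>)" and f: "f \<in> ell2 (Fib (rng \<G> g))"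
  let ?f' = "\<lambda>x. if x \<in> Fib (src \<G> g) then f (act G g x) else 0"
  have "series_family W a (rng \<G> g) f x = translation \<G> G g (series_family W a (src \<G> g) ?f') x" for x
  proof (cases "rng \<G> g \<in> W \<and> x \<in> Fib (rng \<G> g)")
    case True
    have y: "act G (ginv \<G> g) x \<in> Fib (src \<G> g)"
      using act_inv_bij[OF g] True by (auto dest: bij_betwE)
    show ?thesis
      using True inv[OF g] adj_op_funpow_act[OF g refl y, of _ f] act_act_inv[OF g]
      by (simp add: series_family_def series_op_def translation_def)
  next
    case False
    then show ?thesis
      using inv[OF g] adj_op_funpow_outside[where S = "Fib (rng \<G> g)" and f = f and x = x and E = E, OF ell2_outside[OF f]]
      by (auto simp: series_family_def series_op_def translation_def)
  qed
  then show "series_family W a (rng \<G> g) f = translation \<G> G g (series_family W a (src \<G> g)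
      (operator_adjoint (Fib (src \<G> g)) (Fib (rng \<G> g)) (translation \<G> G g) f))"
    unfolding adjoint_translation[OF g f] by (rule ext)
qed

text \<open>Families are functions on the whole type of arrows, but membership sees only their
  values at units.\<close>

lemma vn_algebra_cong:
  assumes "A \<in> vn_algebra \<G> m G" "\<And>\<omega>. \<omega> \<in> units \<G> \<Longrightarrow> A \<omega> = B \<omega>"
  shows "B \<in> vn_algebra \<G> m G"
proof -
  have "bounded_operator (Fib \<omega>) (B \<omega>)" if "\<omega> \<in> units \<G>" for \<omega>
    using that assms by (simp add: vn_algebra_def)
  moreover have "\<exists>C. AE \<omega> in m. operator_norm (Fib \<omega>) (B \<omega>) \<le> C"
  proof -
    obtain C where "AE \<omega> in m. operator_norm (Fib \<omega>) (A \<omega>) \<le> C"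
      using assms(1) by (auto simp: vn_algebra_def)
    then have "AE \<omega> in m. operator_norm (Fib \<omega>) (B \<omega>) \<le> C"
      by (rule AE_mp[OF _ AE_I2]) (simp add: assms(2))
    then show ?thesis ..
  qed
  moreover have "matrix_coefficient G B h f \<in> borel_measurable \<Omega>"
    if "f \<in> square_integrable m G" "h \<in> square_integrable m G" for f h
  proof -
    have "matrix_coefficient G A h f \<in> borel_measurable \<Omega>"
      using that assms(1) by (simp add: vn_algebra_def)
    then show ?thesis
      by (rule measurable_cong[THEN iffD1, rotated])
        (simp add: matrix_coefficient_def assms(2) Let_def)
  qed
  ultimately show ?thesis
    using assms groupoid_closed unfolding vn_algebra_def by auto
qed

lemma operator_poly_mem: "(\<lambda>\<omega>. operator_poly p (adjacency_operator G \<omega>)) \<in> vn_algebra \<G> m G"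
proof (rule vn_algebra_cong)
  show "series_family (units \<G>) (coeff p) \<in> vn_algebra \<G> m G"
  proof (rule series_family_mem[where d = D])
    show "units \<G> \<in> sets \<Omega>"
      using sets.top[of \<Omega>] by simp
    show "summable (\<lambda>k. norm (coeff p k) * D ^ k)"
      by (rule summable_finite[of "{..degree p}"]) (auto simp: coeff_eq_0)
  qed (auto simp: region_fiber groupoid_closed)
  have "operator_poly p T f x = (\<Sum>k. coeff p k * (T ^^ k) f x)" for T :: "'v operator" and f x
    unfolding operator_poly_def by (rule suminf_finite[symmetric]) (auto simp: coeff_eq_0)
  then show "series_family (units \<G>) (coeff p) \<omega> = operator_poly p (adjacency_operator G \<omega>)"
    if "\<omega> \<in> units \<G>" for \<omega>
    using that by (auto simp: series_family_def series_op_def adjacency_operator_eq fun_eq_iff)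
qed

lemma functional_calculus_poly:
  "has_functional_calculus \<G> m G (adjacency_operator G) (poly p)
    (\<lambda>\<omega>. operator_poly p (adjacency_operator G \<omega>))"
proof -
  let ?B = "\<lambda>\<omega>. operator_poly p (adjacency_operator G \<omega>)"
  have "vn_norm m G (family_diff ?B ?B) = 0"
  proof -
    have le: "operator_norm (Fib \<omega>) (family_diff ?B ?B \<omega>) \<le> 0" for \<omega>
      by (rule operator_norm_zero) (simp add: family_diff_def)
    then have "{C. 0 \<le> C \<and> (AE \<omega> in m. operator_norm (Fib \<omega>) (family_diff ?B ?B \<omega>) \<le> C)} = {0..}"
      using order_trans by (auto intro!: AE_I2)
    then show ?thesis
      by (simp add: vn_norm_def)
  qed
  then show ?thesis
    unfolding has_functional_calculus_def using operator_poly_mem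
    by (intro conjI exI[of _ "\<lambda>_. p"]) (auto intro: uniform_limit_const)
qed

lemma fiber_sum_nonneg_integral:
  fixes \<psi> :: "'v \<Rightarrow> real"
  assumes [measurable]: "\<psi> \<in> borel_measurable V" and fin: "(\<integral>\<^sup>+x. ennreal (\<psi> x) \<partial>M) < \<infinity>"
  defines "T \<equiv> \<lambda>\<omega>. \<integral>\<^sup>+x. ennreal (\<psi> x) \<partial>count_space (Fib \<omega>)"
  shows "integrable m (\<lambda>\<omega>. enn2real (T \<omega>))"
    "(\<integral>\<omega>. enn2real (T \<omega>) \<partial>m) = enn2real (\<integral>\<^sup>+x. ennreal (\<psi> x) \<partial>M)"
proof -
  have T [measurable]: "T \<in> borel_measurable m"
    unfolding T_def by (rule measurable_fiber_sum_m) measurable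
  have eq: "(\<integral>\<^sup>+\<omega>. T \<omega> \<partial>m) = (\<integral>\<^sup>+x. ennreal (\<psi> x) \<partial>M)"
    unfolding T_def by (rule nn_integral_M[symmetric]) measurable
  have "AE \<omega> in m. T \<omega> \<noteq> \<infinity>"
    using fin eq by (intro nn_integral_PInf_AE) auto
  then have "(\<integral>\<^sup>+\<omega>. ennreal (enn2real (T \<omega>)) \<partial>m) = (\<integral>\<^sup>+\<omega>. T \<omega> \<partial>m)"
    by (intro nn_integral_cong_AE) (auto simp: less_top)
  then have eq': "(\<integral>\<^sup>+\<omega>. ennreal (enn2real (T \<omega>)) \<partial>m) = (\<integral>\<^sup>+x. ennreal (\<psi> x) \<partial>M)"
    using eq by simp
  show "integrable m (\<lambda>\<omega>. enn2real (T \<omega>))"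
    using fin eq' by (intro integrableI_nonneg) auto
  show "(\<integral>\<omega>. enn2real (T \<omega>) \<partial>m) = enn2real (\<integral>\<^sup>+x. ennreal (\<psi> x) \<partial>M)"
    using eq' by (subst integral_eq_nn_integral) auto
qed

lemma real_fiber_sum_integral:
  fixes \<psi> :: "'v \<Rightarrow> real"
  assumes \<psi>: "integrable M \<psi>"
  shows "integrable m (\<lambda>\<omega>. real_fiber_sum (Fib \<omega>) \<psi>)"
    "(\<integral>\<omega>. real_fiber_sum (Fib \<omega>) \<psi> \<partial>m) = (\<integral>x. \<psi> x \<partial>M)"
proof -
  have meas [measurable]: "\<psi> \<in> borel_measurable V"
    using borel_measurable_integrable[OF \<psi>] measurable_cong_sets[OF sets_M refl] by blast
  have "(\<integral>\<^sup>+x. ennreal (\<psi> x) \<partial>M) < \<infinity>" "(\<integral>\<^sup>+x. ennreal (- \<psi> x) \<partial>M) < \<infinity>"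
    using \<psi> by (auto simp: real_integrable_def less_top)
  note 1 = fiber_sum_nonneg_integral[OF meas this(1)]
    and 2 = fiber_sum_nonneg_integral[of "\<lambda>x. - \<psi> x", OF _ this(2)]
  show "integrable m (\<lambda>\<omega>. real_fiber_sum (Fib \<omega>) \<psi>)"
    unfolding real_fiber_sum_def using 1(1) 2(1) by auto
  show "(\<integral>\<omega>. real_fiber_sum (Fib \<omega>) \<psi> \<partial>m) = (\<integral>x. \<psi> x \<partial>M)"
    unfolding real_fiber_sum_def real_lebesgue_integral_def[OF \<psi>] using 1 2
    by (subst Bochner_Integration.integral_diff) auto
qed

text \<open>Integrability of F makes almost every fibre sum absolutely convergent, and there
  \<open>infsum\<close> is given by the measurable \<open>real_fiber_sum\<close> of the real and
  imaginary parts.\<close>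

lemma fiber_sum_integral:
  fixes F :: "'v \<Rightarrow> complex"
  assumes F: "integrable M F"
  shows "(\<integral>\<omega>. (\<Sum>\<^sub>\<infinity>x\<in>Fib \<omega>. F x) \<partial>completion m) = (\<integral>x. F x \<partial>M)"
proof -
  let ?R = "\<lambda>\<omega>. real_fiber_sum (Fib \<omega>) (\<lambda>x. Re (F x))"
  let ?I = "\<lambda>\<omega>. real_fiber_sum (Fib \<omega>) (\<lambda>x. Im (F x))"
  note R = real_fiber_sum_integral[OF integrable_Re[OF F]]
    and I = real_fiber_sum_integral[OF integrable_Im[OF F]]
  have meas [measurable]: "F \<in> borel_measurable V"
    using borel_measurable_integrable[OF F] measurable_cong_sets[OF sets_M refl] by blast
  have fin: "(\<integral>\<^sup>+\<omega>. \<integral>\<^sup>+x. ennreal (norm (F x)) \<partial>count_space (Fib \<omega>) \<partial>m) < \<infinity>"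
    using F by (subst nn_integral_M[symmetric]) (auto simp: integrable_iff_bounded)
  have "AE \<omega> in m. (\<integral>\<^sup>+x. ennreal (norm (F x)) \<partial>count_space (Fib \<omega>)) \<noteq> \<infinity>"
    by (rule nn_integral_PInf_AE) (use fin in \<open>auto intro!: measurable_fiber_sum_m\<close>)
  then have "AE \<omega> in m. (\<Sum>\<^sub>\<infinity>x\<in>Fib \<omega>. F x) = complex_of_real (?R \<omega>) + \<i> * complex_of_real (?I \<omega>)"
    by (rule AE_mp[OF _ AE_I2])
      (auto simp: infsum_eq_complex_fiber_sum nonneg_summable_on_iff_nn_integral less_top complex_eq_iff)
  then have "(\<integral>\<omega>. (\<Sum>\<^sub>\<infinity>x\<in>Fib \<omega>. F x) \<partial>completion m) =
      (\<integral>\<omega>. complex_of_real (?R \<omega>) + \<i> * complex_of_real (?I \<omega>) \<partial>m)"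
    using R(1) I(1) by (intro integral_completion_cong) auto
  also have "\<dots> = complex_of_real (\<integral>\<omega>. ?R \<omega> \<partial>m) + \<i> * complex_of_real (\<integral>\<omega>. ?I \<omega> \<partial>m)"
    using R(1) I(1) by (simp add: integrable_of_real)
  also have "\<dots> = (\<integral>x. F x \<partial>M)"
    unfolding R(2) I(2) using integral_Re[OF F] integral_Im[OF F] by (simp add: complex_eq_iff)
  finally show ?thesis .
qed

lemma walks_bound: "walks E k x y \<le> max 1 D ^ k"
proof (cases "x \<in> space V")
  case True
  have "walks E k x y \<le> D ^ k" by (rule bounded_region.walks_le[OF region_space True])
  also have "\<dots> \<le> max 1 D ^ k" by (intro power_mono) auto
  finally show ?thesis .
next
  case False
  then have "{z. (x, z) \<in> E} = {}" using edge_verts by auto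
  then show ?thesis by (cases k) (auto simp: nbr_sum_def)
qed

section \<open>Trace and Laplacian with respect to the finite measure u dM\<close>

context
  fixes u :: "'v \<Rightarrow> ennreal"
  assumes u: "averaging u"
begin

abbreviation "umeasure \<equiv> density M u"

lemma meas_u [measurable]: "u \<in> borel_measurable V" "u \<in> borel_measurable M"
  using averaging_measurable[OF u] measurable_cong_sets[OF sets_M refl] by auto

lemma finite_measure_umeasure: "finite_measure umeasure"
proof (rule finite_measureI)
  have "emeasure umeasure (space umeasure) = (\<integral>\<^sup>+x. u x \<partial>M)"
    unfolding emeasure_density[OF meas_u(2) sets.top[of M]] space_density
    by (intro nn_integral_cong) simp
  then show "emeasure umeasure (space umeasure) \<noteq> \<infinity>"
    using averaging_integral_finite[OF u] by simp
qed

lemma integrable_umeasure: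
  fixes F :: "'v \<Rightarrow> complex"
  assumes "F \<in> borel_measurable V" "\<And>x. norm (F x) \<le> C"
  shows "integrable umeasure F"
proof -
  interpret finite_measure umeasure by (rule finite_measure_umeasure)
  show ?thesis
    using assms by (intro integrable_const_bound[where B = C]) (auto cong: measurable_cong_sets)
qed

lemma AE_u_finite: "AE x in M. ennreal (enn2real (u x)) = u x"
  using averaging_integral_finite[OF u] nn_integral_PInf_AE[OF meas_u(2)]
  by (auto simp: less_top)

text \<open>On the null set where u is infinite, the trace sees the value 0 of
  \<open>enn2real\<close>; as densities the two functions agree.\<close>

lemma density_real: "umeasure = density M (\<lambda>x. ennreal (enn2real (u x)))"
  using AE_u_finite by (intro density_cong) auto

lemma measurable_of_nat_walks: "(\<lambda>x. of_nat (walks E k x x)) \<in> borel_measurable V"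
  by (rule measurable_compose[OF measurable_walks]) simp

lemma integrable_walks: "integrable umeasure (\<lambda>x. of_nat (walks E k x x) :: complex)"
  by (rule integrable_umeasure[where C = "max 1 D ^ k"])
    (use measurable_of_nat_walks walks_bound[of k] in \<open>auto simp flip: of_nat_power of_nat_max\<close>)

lemma integrable_kern: "integrable umeasure (\<lambda>x. kern E p x x)"
  unfolding kern_def using integrable_walks by (intro Bochner_Integration.integrable_sum) simp

text \<open>At point masses p(A) has the diagonal entries \<open>kern E p x x\<close>, which turns
  the trace into an ordinary integral over vertices.\<close>

lemma vn_trace_poly:
  "vn_trace m G u (\<lambda>\<omega>. operator_poly p (adjacency_operator G \<omega>)) = (\<integral>x. kern E p x x \<partial>umeasure)"
proof -
  have "ell2_inner (Fib \<omega>) (ell2_delta x) (operator_poly p (adjacency_operator G \<omega>) (ell2_delta x)) = kern E p x x"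
    if "x \<in> Fib \<omega>" for x \<omega>
    using that bounded_region.adj_op_funpow_delta[OF region_fiber that]
    by (simp add: ell2_inner_delta operator_poly_def kern_def adjacency_operator_eq)
  then have "vn_trace m G u (\<lambda>\<omega>. operator_poly p (adjacency_operator G \<omega>)) =
      (\<integral>\<omega>. (\<Sum>\<^sub>\<infinity>x\<in>Fib \<omega>. complex_of_real (enn2real (u x)) * kern E p x x) \<partial>completion m)"
    unfolding vn_trace_def by (intro Bochner_Integration.integral_cong infsum_cong) auto
  also have "\<dots> = (\<integral>x. complex_of_real (enn2real (u x)) * kern E p x x \<partial>M)"
  proof (rule fiber_sum_integral)
    have "integrable (density M (\<lambda>x. ennreal (enn2real (u x)))) (\<lambda>x. kern E p x x)"
      using integrable_kern density_real by simp
    then show "integrable M (\<lambda>x. complex_of_real (enn2real (u x)) * kern E p x x)"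
      using measurable_kern[of p]
      by (subst (asm) integrable_density) (auto simp: scaleR_conv_of_real cong: measurable_cong_sets)
  qed
  also have "\<dots> = (\<integral>x. kern E p x x \<partial>density M (\<lambda>x. ennreal (enn2real (u x))))"
    using measurable_kern[of p]
    by (subst integral_density) (auto simp: scaleR_conv_of_real cong: measurable_cong_sets)
  finally show ?thesis
    using density_real by simp
qed

lemma vn_trace_id: "vn_trace m G u family_id = (\<integral>x. kern E 1 x x \<partial>umeasure)"
proof -
  have "family_id = (\<lambda>\<omega>. operator_poly 1 (adjacency_operator G \<omega>))"
    by (auto simp: family_id_def operator_poly_def fun_eq_iff)
  then show ?thesis using vn_trace_poly[of 1] by simp
qed

lemma integral_nbr_sum_walks:
  "(\<integral>x. of_nat (nbr_sum E (\<lambda>y. walks E k y y) x) \<partial>umeasure) = (\<integral>x. complex_of_nat (vdegree E x * walks E k x x) \<partial>umeasure)"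
  and integrable_nbr_sum_walks: "integrable umeasure (\<lambda>x. complex_of_nat (nbr_sum E (\<lambda>y. walks E k y y) x))"
  and integrable_vdegree_walks: "integrable umeasure (\<lambda>x. complex_of_nat (vdegree E x * walks E k x x))"
proof -
  let ?w = "\<lambda>x. walks E k x x"
  have real_w: "(\<lambda>x. of_nat (?w x) :: ennreal) \<in> borel_measurable V"
    by (rule measurable_compose[OF measurable_walks]) simp
  have nbr: "(\<lambda>x. of_nat (nbr_sum E ?w x) :: real) \<in> borel_measurable V"
    using measurable_nbr_sum_real[OF measurable_compose[OF measurable_walks, of real borel k]]
    by (simp add: nbr_sum_def[abs_def])
  have deg: "(\<lambda>x. of_nat (vdegree E x * ?w x) :: real) \<in> borel_measurable V"
    using measurable_vdegree measurable_walks[of k] by measurable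
  have vd: "vdegree E x \<le> D" for x
  proof (cases "x \<in> space V")
    case False
    then have "{y. (x, y) \<in> E} = {}" using edge_verts by auto
    then show ?thesis by (simp add: vdegree_def)
  qed (use bounded_region.deg_le[OF region_space] in \<open>simp add: vdegree_def\<close>)
  have b1: "real (vdegree E x * ?w x) \<le> real (D * max 1 D ^ k)" for x
    using mult_le_mono[OF vd walks_bound] by (simp only: of_nat_le_iff)
  have "nbr_sum E ?w x \<le> vdegree E x * max 1 D ^ k" for x
    unfolding nbr_sum_def vdegree_def using sum_bounded_above[of "{y. (x, y) \<in> E}" ?w "max 1 D ^ k"] walks_bound by simp
  then have b2: "real (nbr_sum E ?w x) \<le> real (D * max 1 D ^ k)" for x
    using mult_le_mono1[OF vd[of x], of "max 1 D ^ k"] order_trans of_nat_le_iff by blast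
  show i1: "integrable umeasure (\<lambda>x. complex_of_nat (nbr_sum E ?w x))"
  proof (rule integrable_umeasure)
    show "(\<lambda>x. complex_of_nat (nbr_sum E ?w x)) \<in> borel_measurable V"
      using measurable_compose[OF nbr borel_measurable_of_real] by simp
    show "norm (complex_of_nat (nbr_sum E ?w x)) \<le> real (D * max 1 D ^ k)" for x
      unfolding norm_of_nat by (rule b2)
  qed
  show i2: "integrable umeasure (\<lambda>x. complex_of_nat (vdegree E x * ?w x))"
  proof (rule integrable_umeasure)
    show "(\<lambda>x. complex_of_nat (vdegree E x * ?w x)) \<in> borel_measurable V"
      using measurable_compose[OF deg borel_measurable_of_real] by simp
    show "norm (complex_of_nat (vdegree E x * ?w x)) \<le> real (D * max 1 D ^ k)" for x
      unfolding norm_of_nat by (rule b1)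
  qed
  have nn: "(\<integral>x. real (n x) \<partial>umeasure) = enn2real (\<integral>\<^sup>+x. u x * of_nat (n x) \<partial>M)"
    if "(\<lambda>x. real (n x)) \<in> borel_measurable V" for n
  proof -
    have "(\<integral>\<^sup>+x. ennreal (real (n x)) \<partial>umeasure) = (\<integral>\<^sup>+x. u x * ennreal (real (n x)) \<partial>M)"
      using that by (intro nn_integral_density) (auto cong: measurable_cong_sets)
    then show ?thesis
      using that by (subst integral_eq_nn_integral) (auto simp: ennreal_of_nat_eq_real_of_nat cong: measurable_cong_sets)
  qed
  have "(\<integral>\<^sup>+x. u x * nbr_sum E (\<lambda>x. of_nat (?w x)) x \<partial>M) = (\<integral>\<^sup>+x. u x * (of_nat (vdegree E x) * of_nat (?w x)) \<partial>M)"
    by (rule nbr_sum_transport[OF u real_w]) (simp add: walks_act)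
  then have "(\<integral>x. real (nbr_sum E ?w x) \<partial>umeasure) = (\<integral>x. real (vdegree E x * ?w x) \<partial>umeasure)"
    unfolding nn[OF nbr] nn[OF deg] by (simp add: nbr_sum_def)
  then have "complex_of_real (\<integral>x. real (nbr_sum E ?w x) \<partial>umeasure) = complex_of_real (\<integral>x. real (vdegree E x * ?w x) \<partial>umeasure)"
    by simp
  then show "(\<integral>x. of_nat (nbr_sum E ?w x) \<partial>umeasure) = (\<integral>x. complex_of_nat (vdegree E x * ?w x) \<partial>umeasure)"
    unfolding integral_complex_of_real[symmetric] by simp
qed

text \<open>Transport applies to non-negative functions, while kernels have complex coefficients.
  Expanded into walk counts, each term is covered and the coefficients enter linearly.\<close>

lemma integral_laplacian_kern:
  "(\<integral>x. (\<Sum>y | (x, y) \<in> E. kern E q y y - kern E q x x) \<partial>umeasure) = 0"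
  and integrable_laplacian_kern: "integrable umeasure (\<lambda>x. \<Sum>y | (x, y) \<in> E. kern E q y y - kern E q x x)"
proof -
  let ?w = "\<lambda>k x. walks E k x x"
  let ?\<Delta> = "\<lambda>k x. complex_of_nat (nbr_sum E (?w k) x) - complex_of_nat (vdegree E x * ?w k x)"
  have eq: "(\<Sum>y | (x, y) \<in> E. kern E q y y - kern E q x x) = (\<Sum>k\<le>degree q. coeff q k * ?\<Delta> k x)" for x
  proof -
    have "(\<Sum>y | (x, y) \<in> E. kern E q y y) = (\<Sum>k\<le>degree q. coeff q k * complex_of_nat (nbr_sum E (?w k) x))"
      unfolding kern_def nbr_sum_def of_nat_sum sum_distrib_left by (rule sum.swap)
    moreover have "(\<Sum>y | (x, y) \<in> E. kern E q x x) = (\<Sum>k\<le>degree q. coeff q k * complex_of_nat (vdegree E x * ?w k x))"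
      by (simp add: kern_def vdegree_def sum_distrib_left mult.left_commute)
    ultimately show ?thesis
      by (simp add: sum_subtractf right_diff_distrib)
  qed
  have i: "integrable umeasure (\<lambda>x. coeff q k * ?\<Delta> k x)" for k
    by (intro integrable_mult_right Bochner_Integration.integrable_diff integrable_nbr_sum_walks integrable_vdegree_walks)
  show "integrable umeasure (\<lambda>x. \<Sum>y | (x, y) \<in> E. kern E q y y - kern E q x x)"
    unfolding eq by (intro Bochner_Integration.integrable_sum i)
  have zero: "(\<integral>x. coeff q k * ?\<Delta> k x \<partial>umeasure) = 0" for k
    by (simp only: integral_mult_right_zero Bochner_Integration.integral_diff[OF integrable_nbr_sum_walks integrable_vdegree_walks]
        integral_nbr_sum_walks diff_self mult_zero_right)
  show "(\<integral>x. (\<Sum>y | (x, y) \<in> E. kern E q y y - kern E q x x) \<partial>umeasure) = 0"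
    unfolding eq by (subst Bochner_Integration.integral_sum[OF i]) (simp only: zero sum.neutral_const)
qed

end

end

section \<open>The spectral measure and the zeta function\<close>

text \<open>With d = r + 1, R solves t^2 = d t + d. Beyond R one has t^2 > d t + d, whereas the
  quadratic equation bounds |\<alpha>|^2 by d |\<alpha>| + r, and r < d.\<close>

lemma norm_quadratic_root_le:
  fixes \<alpha> z :: complex
  assumes "\<alpha>\<^sup>2 = z * \<alpha> - of_nat r" "norm z \<le> real r + 1"
    and R: "R = ((real r + 1) + sqrt ((real r + 1)\<^sup>2 + 4 * (real r + 1))) / 2"
  shows "norm \<alpha> \<le> R"
proof (rule ccontr)
  let ?d = "real r + 1"
  define q where "q = sqrt (?d\<^sup>2 + 4 * ?d)"
  have q: "q\<^sup>2 = ?d\<^sup>2 + 4 * ?d" "?d \<le> q"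
    unfolding q_def by (auto intro: real_le_rsqrt)
  have Rq: "R = (?d + q) / 2" by (simp add: R q_def)
  have RR: "R * R - ?d * R = ?d"
    using q(1) unfolding Rq by (simp add: field_simps power2_eq_square)
  have Rd: "?d \<le> R" using q(2) by (simp add: Rq)
  assume "\<not> norm \<alpha> \<le> R"
  then have "R < norm \<alpha>" by simp
  moreover have "(norm \<alpha>)\<^sup>2 \<le> ?d * norm \<alpha> + r"
  proof -
    have "(norm \<alpha>)\<^sup>2 = norm (z * \<alpha> - of_nat r)"
      by (simp flip: assms(1) norm_power)
    also have "\<dots> \<le> norm z * norm \<alpha> + r"
      by (rule order_trans[OF norm_triangle_ineq4]) (simp add: norm_mult)
    also have "\<dots> \<le> ?d * norm \<alpha> + r"
      using assms(2) by (simp add: mult_right_mono)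
    finally show ?thesis .
  qed
  \<comment> \<open>Since R^2 - d R = d, this product equals |\<alpha>|^2 - d |\<alpha>| -
    d.\<close>
  moreover have "0 < (norm \<alpha> - R) * (norm \<alpha> + R - ?d)"
    using Rd calculation(1) norm_ge_zero[of \<alpha>] by (intro mult_pos_pos) auto
  ultimately show False
    using RR by (simp add: algebra_simps power2_eq_square)
qed

lemma poly_dickson:
  fixes \<alpha> \<beta> :: complex
  assumes "\<alpha> + \<beta> = z" "\<alpha> * \<beta> = c"
  shows "poly (dickson c n) z = \<alpha> ^ n + \<beta> ^ n"
proof (induction n rule: induct_nat_012)
  case (ge2 n)
  then show ?case
    using assms by (auto simp: algebra_simps)
qed (use assms in auto)

lemma quadratic_roots:
  fixes z c :: complex
  obtains \<alpha> \<beta> where "\<alpha> + \<beta> = z" "\<alpha> * \<beta> = c"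
proof
  let ?s = "csqrt (z\<^sup>2 - 4 * c)"
  show "(z + ?s) / 2 + (z - ?s) / 2 = z"
    by (simp add: field_simps)
  have "(z + ?s) / 2 * ((z - ?s) / 2) = (z\<^sup>2 - ?s\<^sup>2) / 4"
    by (simp add: algebra_simps power2_eq_square)
  then show "(z + ?s) / 2 * ((z - ?s) / 2) = c"
    by simp
qed

lemma Ln_one_minus_sums:
  fixes w :: complex
  assumes "norm w < 1"
  shows "(\<lambda>n. w ^ Suc n / of_nat (Suc n)) sums - Ln (1 - w)"
proof -
  have "(\<lambda>n. (-1) ^ Suc n / of_nat n * (- w) ^ n) sums Ln (1 + - w)"
    using assms by (intro Ln_series) simp
  then have "(\<lambda>n. - ((-1) ^ Suc n / of_nat n * (- w) ^ n)) sums - Ln (1 - w)"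
    by (intro sums_minus) simp
  moreover have "(\<lambda>n. - ((-1) ^ Suc n / of_nat n * (- w) ^ n)) = (\<lambda>n. w ^ n / of_nat n)"
    by (rule ext) (simp flip: power_mult_distrib)
  ultimately have "(\<lambda>n. w ^ n / of_nat n) sums - Ln (1 - w)"
    by (simp only:)
  then show ?thesis
    \<comment> \<open>The term of index 0 is a division by zero, hence 0, so the index shift changes
      nothing.\<close>
    by (subst sums_Suc_iff) simp
qed

text \<open>Both factors lie in the right half-plane, so their arguments add up to less than \<pi>
  in modulus and no branch is crossed.\<close>

lemma Ln_times_one_minus:
  fixes w w' :: complex
  assumes "norm w < 1" "norm w' < 1"
  shows "Ln ((1 - w) * (1 - w')) = Ln (1 - w) + Ln (1 - w')"
proof -
  have Re: "0 < Re (1 - v)" if "norm v < 1" for v :: complex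
    using abs_Re_le_cmod[of v] that by simp
  then have nz: "1 - w \<noteq> 0" "1 - w' \<noteq> 0"
    using assms by fastforce+
  have "\<bar>Im (Ln (1 - w))\<bar> < pi / 2" "\<bar>Im (Ln (1 - w'))\<bar> < pi / 2"
    using Re_Ln_pos_lt[OF nz(1)] Re_Ln_pos_lt[OF nz(2)] Re assms by auto
  then show ?thesis
    using nz by (intro Ln_times_simple) auto
qed

section \<open>Regular fibres, spectral bound and mean path counts\<close>

context measured_graph
begin

context
  fixes u :: "'v \<Rightarrow> ennreal" and \<mu> :: "complex measure" and r :: nat
  assumes u: "averaging u"
    and deg: "AE x in M. vdegree E x = r + 1"
    and spec: "spectral_measure \<G> m G u \<mu>"
begin

definition regular_units :: "'g set" where
  "regular_units = {\<omega> \<in> units \<G>. \<forall>x\<in>Fib \<omega>. vdegree E x = r + 1}"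

text \<open>A unit is regular iff its fibre sum of the indicator of irregular vertices is 0, and
  such sums are measurable in the unit.\<close>

lemma regular_units_sets: "regular_units \<in> sets \<Omega>"
proof -
  let ?Z = "{x \<in> space V. vdegree E x \<noteq> r + 1}"
  have Z: "?Z \<in> sets V"
    using measurable_vdegree by measurable
  have [measurable]: "(\<lambda>\<omega>. \<integral>\<^sup>+x. indicator ?Z x \<partial>count_space (Fib \<omega>)) \<in> borel_measurable \<Omega>"
    using Z by (intro measurable_fiber_sum borel_measurable_indicator)
  have "{\<omega> \<in> space \<Omega>. (\<integral>\<^sup>+x. indicator ?Z x \<partial>count_space (Fib \<omega>)) = 0} \<in> sets \<Omega>"
    by measurable
  also have "{\<omega> \<in> space \<Omega>. (\<integral>\<^sup>+x. indicator ?Z x \<partial>count_space (Fib \<omega>)) = 0} = regular_units"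
    unfolding regular_units_def
    by (auto simp: nn_integral_0_iff_AE AE_count_space vfiber_iff indicator_def split: if_splits)
  finally show ?thesis .
qed

lemma regular_units_AE: "AE \<omega> in m. \<omega> \<in> regular_units"
  by (rule AE_mp[OF AE_fiber[OF deg] AE_I2]) (simp add: regular_units_def)

lemma regular_units_inv:
  assumes g: "g \<in> space (arrows \<G>)"
  shows "src \<G> g \<in> regular_units \<longleftrightarrow> rng \<G> g \<in> regular_units"
proof -
  have "Fib (rng \<G> g) = act G g ` Fib (src \<G> g)"
    using act_bij[OF g] by (simp add: bij_betw_def)
  then show ?thesis
    using groupoid_closed[OF g] vdegree_act[OF g] by (simp add: regular_units_def)
qed

lemma regular_region_fiber: "\<omega> \<in> regular_units \<Longrightarrow> regular_region E (Fib \<omega>) r"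
proof -
  assume \<omega>: "\<omega> \<in> regular_units"
  interpret bounded_region E "Fib \<omega>" D by (rule region_fiber)
  show ?thesis
    by unfold_locales (use \<omega> symE closed fin irrefl_edges in \<open>auto simp: regular_units_def vdegree_def\<close>)
qed

text \<open>For |z| > r + 1 the Neumann series converges on every regular fibre. Set to 0 over the
  other units, it still inverts A - z in the algebra, where equality is almost everywhere.\<close>

lemma spectrum_bound:
  assumes "z \<in> vn_spectrum \<G> m G (adjacency_operator G)"
  shows "norm z \<le> real r + 1"
proof (rule ccontr)
  assume "\<not> norm z \<le> real r + 1"
  then have z: "real (r + 1) < norm z" by simp
  define a where "a = (\<lambda>k. - 1 / z ^ Suc k)"
  define B where "B = series_family regular_units a"
  have region: "bounded_region E (Fib \<omega>) (r + 1)" if "\<omega> \<in> regular_units" for \<omega>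
    using regular_region_fiber[OF that] by (simp add: regular_region_def)
  \<comment> \<open>The coefficient condition mentions no graph; it is read off at the empty graph,
    as no regular unit is at hand at this point.\<close>
  have a: "summable (\<lambda>k. norm (a k) * (r + 1) ^ k)"
    using bounded_region.resolvent_series_op(1)[of "{}" "{}" "r + 1" z "\<lambda>_. 0"] z
    by (simp add: bounded_region_def sym_def ell2_def a_def)
  have mem: "B \<in> vn_algebra \<G> m G"
    unfolding B_def
    by (rule series_family_mem[OF regular_units_sets region regular_units_inv a])
  let ?A = "family_diff (adjacency_operator G) (family_scale z family_id)"
  have "family_eq m G (family_comp ?A B) family_id" "family_eq m G (family_comp B ?A) family_id"
    unfolding family_eq_def
  proof (rule_tac [!] AE_mp[OF regular_units_AE AE_I2], safe)
    fix \<omega> f assume \<omega>: "\<omega> \<in> regular_units" and f: "f \<in> ell2 (Fib \<omega>)"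
    interpret bounded_region E "Fib \<omega>" "r + 1" using region[OF \<omega>] .
    note res = resolvent_series_op[OF z f, folded a_def]
    show "family_comp ?A B \<omega> f = family_id \<omega> f"
      using \<omega> res(2)
      by (auto simp: family_comp_def family_diff_def family_scale_def family_id_def B_def
          series_family_def adjacency_operator_eq)
    show "family_comp B ?A \<omega> f = family_id \<omega> f"
      using \<omega> res(3)
      by (auto simp: family_comp_def family_diff_def family_scale_def family_id_def B_def
          series_family_def adjacency_operator_eq)
  qed
  then show False
    using assms mem by (auto simp: vn_spectrum_def)
qed

lemma space_\<mu>: "space \<mu> = vn_spectrum \<G> m G (adjacency_operator G)"
  using spec sets_eq_imp_space_eq[of \<mu> "restrict_space borel (vn_spectrum \<G> m G (adjacency_operator G))"]
  by (simp add: spectral_measure_def space_restrict_space)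

lemma finite_measure_\<mu>: "finite_measure \<mu>"
  using spec by (simp add: spectral_measure_def)

lemma measurable_\<mu>: "f \<in> borel_measurable borel \<Longrightarrow> f \<in> borel_measurable \<mu>"
proof -
  have sets: "sets \<mu> = sets (restrict_space borel (vn_spectrum \<G> m G (adjacency_operator G)))"
    using spec by (simp add: spectral_measure_def)
  show "f \<in> borel_measurable borel \<Longrightarrow> f \<in> borel_measurable \<mu>"
    unfolding measurable_cong_sets[OF sets refl] by (rule measurable_restrict_space1)
qed

text \<open>Both sides are the trace of p(A), computed over the vertices and through the spectral
  measure with \<open>poly p\<close> as test function.\<close>

lemma moments: "(\<integral>x. kern E p x x \<partial>density M u) = (\<integral>z. poly p z \<partial>\<mu>)"
proof -
  have "continuous_on (vn_spectrum \<G> m G (adjacency_operator G)) (poly p)"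
    by (intro continuous_intros)
  then show ?thesis
    using spec functional_calculus_poly[of p] vn_trace_poly[OF u, of p]
    by (simp add: spectral_measure_def)
qed

text \<open>Measurability of the path count is bypassed: almost everywhere it equals the integrable
  F. The constant is written as a multiple of the kernel of 1, so that its integral is a multiple of
  \<tau>(I).\<close>

lemma mean_path_count_eq:
  assumes "0 < n"
  shows "complex_of_real (mean_path_count m G u n) =
    (\<integral>z. poly (dickson (of_nat r) n) z \<partial>\<mu>)
    + (if even n then (of_nat r - 1) * vn_trace m G u family_id else 0)"
proof -
  let ?P = "density M u"
  let ?L = "\<lambda>x. \<Sum>y | (x, y) \<in> E. kern E (chebU_sum (of_nat r) n) y y - kern E (chebU_sum (of_nat r) n) x x"
  let ?N = "\<lambda>x. card (reduced_closed_paths E n x)"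
  define c where "c = (if even n then of_nat r - 1 else (0::complex))"
  define F where "F x = kern E (dickson (of_nat r) n) x x + c * kern E 1 x x + ?L x" for x
  have intF: "integrable ?P F"
    unfolding F_def using integrable_kern[OF u] integrable_laplacian_kern[OF u]
    by (intro Bochner_Integration.integrable_add integrable_mult_right)
  have NF: "AE x in M. F x = of_nat (?N x)"
  proof (rule AE_mp[OF AE_M_proj[OF regular_units_AE] AE_I2], rule impI)
    fix x assume x: "x \<in> space M" "proj G x \<in> regular_units"
    then have "x \<in> Fib (proj G x)" by (simp add: vfiber_iff)
    from regular_region.reduced_closed_paths_count[OF regular_region_fiber[OF x(2)] this assms]
    show "F x = of_nat (?N x)"
      by (simp add: F_def c_def)
  qed
  have NF': "AE x in ?P. F x = of_nat (?N x)"
    using NF meas_u(2)[OF u] by (subst AE_density) auto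
  have "(\<integral>\<^sup>+x. of_nat (?N x) * u x \<partial>M) = (\<integral>\<^sup>+x. u x * ennreal (Re (F x)) \<partial>M)"
    using NF by (intro nn_integral_cong_AE) (auto simp: ennreal_of_nat_eq_real_of_nat mult.commute)
  also have "\<dots> = (\<integral>\<^sup>+x. ennreal (Re (F x)) \<partial>?P)"
    using borel_measurable_integrable[OF intF] meas_u(2)[OF u]
    by (intro nn_integral_density[symmetric]) auto
  finally have "mean_path_count m G u n = (\<integral>x. Re (F x) \<partial>?P)"
    unfolding mean_path_count_def using NF' borel_measurable_integrable[OF intF]
    by (subst integral_eq_nn_integral) auto
  then have "complex_of_real (mean_path_count m G u n) = (\<integral>x. complex_of_real (Re (F x)) \<partial>?P)"
    by (simp add: integral_complex_of_real)
  also have "\<dots> = (\<integral>x. F x \<partial>?P)"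
    using NF' borel_measurable_integrable[OF intF] by (intro integral_cong_AE) (auto simp: complex_eq_iff)
  also have "\<dots> = (\<integral>x. kern E (dickson (of_nat r) n) x x + c * kern E 1 x x \<partial>?P) + (\<integral>x. ?L x \<partial>?P)"
    unfolding F_def
    by (intro Bochner_Integration.integral_add Bochner_Integration.integrable_add integrable_mult_right
        integrable_kern[OF u] integrable_laplacian_kern[OF u])
  also have "(\<integral>x. kern E (dickson (of_nat r) n) x x + c * kern E 1 x x \<partial>?P) =
      (\<integral>x. kern E (dickson (of_nat r) n) x x \<partial>?P) + (\<integral>x. c * kern E 1 x x \<partial>?P)"
    by (intro Bochner_Integration.integral_add integrable_mult_right integrable_kern[OF u])
  also have "(\<integral>x. c * kern E 1 x x \<partial>?P) = c * (\<integral>x. kern E 1 x x \<partial>?P)"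
    by (rule integral_mult_right_zero)
  finally show ?thesis
    unfolding integral_laplacian_kern[OF u] moments[symmetric] vn_trace_id[OF u] by (simp add: c_def)
qed

section \<open>Termwise integration of the zeta series\<close>

context
  fixes R :: real and w :: complex
  assumes R: "R = ((real r + 1) + sqrt ((real r + 1)\<^sup>2 + 4 * (real r + 1))) / 2"
    and w: "norm w < inverse R"
begin

lemma R_ge_1: "1 \<le> R"
proof -
  have "real r + 1 \<le> sqrt ((real r + 1)\<^sup>2 + 4 * (real r + 1))"
    by (rule real_le_rsqrt) simp
  then show ?thesis by (simp add: R)
qed

lemma norm_w_R: "norm w * R < 1"
  using w R_ge_1 by (simp add: field_simps)

lemma norm_w: "norm w < 1"
proof -
  have "norm w * 1 \<le> norm w * R"
    using R_ge_1 by (intro mult_left_mono) auto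
  then show ?thesis using norm_w_R by simp
qed

text \<open>The series splits into two logarithmic series at the roots, scaled by w. The bound is
  geometric and uniform in z, which is what exchanging sum and integral requires.\<close>

lemma dickson_sums:
  assumes "norm z \<le> real r + 1"
  shows "(\<lambda>n. poly (dickson (of_nat r) (Suc n)) z * w ^ Suc n / of_nat (Suc n))
      sums - Ln (1 - w * z + w\<^sup>2 * of_nat r)"
    and "norm (poly (dickson (of_nat r) (Suc n)) z * w ^ Suc n / of_nat (Suc n)) \<le> 2 * (norm w * R) ^ Suc n"
proof -
  obtain \<alpha> \<beta> where ab: "\<alpha> + \<beta> = z" "\<alpha> * \<beta> = of_nat r"
    by (rule quadratic_roots)
  have "\<alpha>\<^sup>2 = z * \<alpha> - of_nat r" "\<beta>\<^sup>2 = z * \<beta> - of_nat r"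
    using ab(2) by (auto simp: ab(1)[symmetric] power2_eq_square algebra_simps)
  then have le: "norm \<alpha> \<le> R" "norm \<beta> \<le> R"
    using norm_quadratic_root_le[OF _ assms R] by auto
  then have nle: "norm (w * \<alpha>) \<le> norm w * R" "norm (w * \<beta>) \<le> norm w * R"
    by (auto simp: norm_mult intro: mult_left_mono)
  then have lt: "norm (w * \<alpha>) < 1" "norm (w * \<beta>) < 1"
    using norm_w_R by auto
  have summand: "poly (dickson (of_nat r) (Suc n)) z * w ^ Suc n / of_nat (Suc n) =
      (w * \<alpha>) ^ Suc n / of_nat (Suc n) + (w * \<beta>) ^ Suc n / of_nat (Suc n)" for n
    unfolding poly_dickson[OF ab] power_mult_distrib by (simp add: add_divide_distrib algebra_simps)
  have prod: "(1 - w * \<alpha>) * (1 - w * \<beta>) = 1 - w * z + w\<^sup>2 * of_nat r"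
    using ab by (simp add: algebra_simps power2_eq_square flip: ab)
  show "(\<lambda>n. poly (dickson (of_nat r) (Suc n)) z * w ^ Suc n / of_nat (Suc n))
      sums - Ln (1 - w * z + w\<^sup>2 * of_nat r)"
    unfolding summand prod[symmetric] Ln_times_one_minus[OF lt] minus_add_distrib
    using lt by (intro sums_add Ln_one_minus_sums)
  have "norm ((w * \<gamma>) ^ Suc n / of_nat (Suc n)) \<le> (norm w * R) ^ Suc n"
    if "norm (w * \<gamma>) \<le> norm w * R" for \<gamma>
  proof -
    have "norm ((w * \<gamma>) ^ Suc n / of_nat (Suc n)) = norm (w * \<gamma>) ^ Suc n / real (Suc n)"
      by (simp only: norm_divide norm_power norm_of_nat)
    also have "\<dots> \<le> norm (w * \<gamma>) ^ Suc n"
      using divide_left_mono[of 1 "real (Suc n)" "norm (w * \<gamma>) ^ Suc n"] by simp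
    also have "\<dots> \<le> (norm w * R) ^ Suc n"
      by (intro power_mono that) simp
    finally show ?thesis .
  qed
  from this[OF nle(1)] this[OF nle(2)]
  show "norm (poly (dickson (of_nat r) (Suc n)) z * w ^ Suc n / of_nat (Suc n)) \<le> 2 * (norm w * R) ^ Suc n"
    unfolding summand by (intro order_trans[OF norm_triangle_ineq]) simp
qed

lemma ihara_series:
  "(\<lambda>n. complex_of_real (mean_path_count m G u (Suc n)) / of_nat (Suc n) * w ^ Suc n) sums
    - ((\<integral>z. Ln (1 - w * z + w\<^sup>2 * of_nat r) \<partial>\<mu>)
       + (of_nat r - 1) * vn_trace m G u family_id / 2 * Ln (1 - w\<^sup>2))"
proof -
  interpret \<mu>: finite_measure \<mu> by (rule finite_measure_\<mu>)
  define f where "f n z = poly (dickson (of_nat r) (Suc n)) z * w ^ Suc n / of_nat (Suc n)" for n z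
  have bound: "norm (f n z) \<le> 2 * (norm w * R) ^ Suc n" and fsums: "(\<lambda>n. f n z) sums - Ln (1 - w * z + w\<^sup>2 * of_nat r)"
    if "z \<in> space \<mu>" for n z
    using dickson_sums[OF spectrum_bound] that unfolding space_\<mu> f_def by auto
  have geo: "summable (\<lambda>n. C * (norm w * R) ^ Suc n)" for C
    using norm_w_R R_ge_1 by (subst summable_Suc_iff) (intro summable_mult summable_geometric, simp)
  have meas_poly: "poly p \<in> borel_measurable \<mu>" for p
    by (intro measurable_\<mu> borel_measurable_continuous_onI continuous_intros)
  have meas: "f n \<in> borel_measurable \<mu>" for n
    unfolding f_def using meas_poly by measurable
  have int: "integrable \<mu> (f n)" for n
    using bound meas by (intro \<mu>.integrable_const_bound[where B = "2 * (norm w * R) ^ Suc n"]) auto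
  have sum_abs: "AE z in \<mu>. summable (\<lambda>n. norm (f n z))"
    by (intro AE_I2 summable_comparison_test'[OF geo[of 2]]) (use bound in auto)
  have sum_int: "summable (\<lambda>n. \<integral>z. norm (f n z) \<partial>\<mu>)"
  proof (rule summable_comparison_test'[OF geo])
    fix n
    have "(\<integral>z. norm (f n z) \<partial>\<mu>) \<le> (\<integral>z. 2 * (norm w * R) ^ Suc n \<partial>\<mu>)"
      using bound int by (intro integral_mono) auto
    then show "norm (\<integral>z. norm (f n z) \<partial>\<mu>) \<le> (measure \<mu> (space \<mu>) * 2) * (norm w * R) ^ Suc n"
      by (simp add: mult.assoc integral_nonneg_AE)
  qed
  have "(\<lambda>n. \<integral>z. f n z \<partial>\<mu>) sums (\<integral>z. (\<Sum>n. f n z) \<partial>\<mu>)"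
    by (rule sums_integral[OF int sum_abs sum_int])
  also have "(\<integral>z. (\<Sum>n. f n z) \<partial>\<mu>) = (\<integral>z. - Ln (1 - w * z + w\<^sup>2 * of_nat r) \<partial>\<mu>)"
    using sums_unique[OF fsums] by (intro Bochner_Integration.integral_cong) auto
  finally have 1: "(\<lambda>n. \<integral>z. f n z \<partial>\<mu>) sums - (\<integral>z. Ln (1 - w * z + w\<^sup>2 * of_nat r) \<partial>\<mu>)"
    by simp
  have intf: "(\<integral>z. f n z \<partial>\<mu>) = (\<integral>z. poly (dickson (of_nat r) (Suc n)) z \<partial>\<mu>) / of_nat (Suc n) * w ^ Suc n" for n
    unfolding f_def by simp
  \<comment> \<open>Averaging the logarithmic series at w and -w keeps exactly the even powers, the
    ones carrying the extra multiple of \<tau>(I).\<close>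
  have "(\<lambda>n. 1 / 2 * (w ^ Suc n / of_nat (Suc n) + (- w) ^ Suc n / of_nat (Suc n))) sums
      (1 / 2 * (- Ln (1 - w) + - Ln (1 - - w)))"
    using norm_w by (intro sums_mult sums_add Ln_one_minus_sums) auto
  also have "- Ln (1 - w) + - Ln (1 - - w) = - Ln ((1 - w) * (1 - - w))"
    using norm_w by (subst Ln_times_one_minus) auto
  also have "(1 - w) * (1 - - w) = 1 - w\<^sup>2"
    by (simp add: algebra_simps power2_eq_square)
  finally have "(\<lambda>n. 1 / 2 * (w ^ Suc n / of_nat (Suc n) + (- w) ^ Suc n / of_nat (Suc n))) sums
      (1 / 2 * - Ln (1 - w\<^sup>2))" .
  from sums_add[OF 1 sums_mult[OF this, of "(of_nat r - 1) * vn_trace m G u family_id"]]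
  have S: "(\<lambda>n. (\<integral>z. f n z \<partial>\<mu>) + (of_nat r - 1) * vn_trace m G u family_id *
        (1 / 2 * (w ^ Suc n / of_nat (Suc n) + (- w) ^ Suc n / of_nat (Suc n)))) sums
      (- (\<integral>z. Ln (1 - w * z + w\<^sup>2 * of_nat r) \<partial>\<mu>) +
        (of_nat r - 1) * vn_trace m G u family_id * (1 / 2 * - Ln (1 - w\<^sup>2)))"
    .
  have term_eq: "complex_of_real (mean_path_count m G u (Suc n)) / of_nat (Suc n) * w ^ Suc n =
      (\<integral>z. f n z \<partial>\<mu>) + (of_nat r - 1) * vn_trace m G u family_id *
        (1 / 2 * (w ^ Suc n / of_nat (Suc n) + (- w) ^ Suc n / of_nat (Suc n)))" for n
  proof -
    have "1 / 2 * (w ^ Suc n / of_nat (Suc n) + (- w) ^ Suc n / of_nat (Suc n)) =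
        (if even (Suc n) then w ^ Suc n / of_nat (Suc n) else 0)"
      by (auto simp del: power_Suc of_nat_Suc simp: power_minus_odd)
    then show ?thesis
      unfolding mean_path_count_eq[OF zero_less_Suc] intf
      by (simp del: power_Suc of_nat_Suc dickson.simps add: add_divide_distrib distrib_right)
  qed
  have sum_eq: "- ((\<integral>z. Ln (1 - w * z + w\<^sup>2 * of_nat r) \<partial>\<mu>)
       + (of_nat r - 1) * vn_trace m G u family_id / 2 * Ln (1 - w\<^sup>2)) =
      - (\<integral>z. Ln (1 - w * z + w\<^sup>2 * of_nat r) \<partial>\<mu>) +
        (of_nat r - 1) * vn_trace m G u family_id * (1 / 2 * - Ln (1 - w\<^sup>2))"
    by simp
  show ?thesis
    unfolding term_eq sum_eq by (rule S)
qed

lemma ihara_determinant_formula: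
  "inverse (ihara_zeta m G u w) =
    (1 - w\<^sup>2) powr ((of_nat r - 1) * vn_trace m G u family_id / 2) *
    exp (\<integral>z. Ln (1 - w * z + w\<^sup>2 * of_nat r) \<partial>\<mu>)"
proof -
  have "norm (w\<^sup>2) < 1"
    using norm_w by (simp add: norm_power power_less_one_iff)
  \<comment> \<open>Only for a nonzero base is \<open>powr\<close> the exponential of exponent times
    \<open>Ln\<close>.\<close>
  then have "1 - w\<^sup>2 \<noteq> 0" by auto
  then show ?thesis
    unfolding ihara_zeta_def sums_unique[OF ihara_series, symmetric] exp_minus inverse_inverse_eq
    by (simp add: powr_def exp_add mult.commute)
qed

end

end

end

theorem theorem4p3:
  fixes \<G> :: "'g groupoid" and \<nu> :: "'g \<Rightarrow> 'g measure" and m :: "'g measure"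
    and G :: "('g, 'v) ggraph" and \<uu> :: "'v \<Rightarrow> ennreal" and \<mu> :: "complex measure"
    and r :: nat and R :: real and u :: complex
  assumes "measure_graph \<G> \<nu> m G"
    and "averaging_function \<G> \<nu> G \<uu>"
    and "AE x in vertex_measure m G. vdegree (edges G) x = r + 1"
    and "spectral_measure \<G> m G \<uu> \<mu>"
    and "R = ((real r + 1) + sqrt ((real r + 1)\<^sup>2 + 4 * (real r + 1))) / 2"
    and "norm u < inverse R"
  shows "inverse (ihara_zeta m G \<uu> u) =
    (1 - u\<^sup>2) powr ((of_nat r - 1) * vn_trace m G \<uu> family_id / 2) *
    exp (\<integral>z. Ln (1 - u * z + u\<^sup>2 * of_nat r) \<partial>\<mu>)"
proof -
  interpret measured_graph \<G> \<nu> m G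
    by unfold_locales (rule assms)
  show ?thesis
    using assms(2-6) by (rule ihara_determinant_formula)
qed

end
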